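(* Let $n\geqslant 2$, write points of $\mathbb{R}^n$ as $(x,y)$ with $x\in\mathbb{R}^{n-1}$, $y\in\mathbb{R}$, and let $Y:\mathbb{R}^{n-1}\to\mathbb{R}$ be $C^\infty$-smooth with $|Y(x)|\leqslant C_1+C_2|x|$ for some constants $C_1$ and $C_2<1$. Let $\Omega=\{(x,y)\,:\,x\in\mathbb{R}^{n-1},\ -\infty<y<Y(x)\}$. Fix $(x^*,y^* )\in\Omega$ and $t^*\in\mathbb{R}$, put $T_\pm(x)=t^*\pm(Y(x)-y^* )$ and $K=\{(x,y)\in\mathbb{R}^n\,:\,y-y^*\geqslant|x-x^*|\}$. Let $S$ be a bounded relatively open subset of $\partial\Omega$ containing $K\cap\partial\Omega$ and such that $Y(x)>y^*$ for all $(x,y)$ in the closure $\overline S$. Then for every solution $u\in C^2(\overline\Omega\times\mathbb{R})$ of the wave equation $\partial_t^2u-\Delta u=0$ in $\Omega\times\mathbb{R}$, \[ u(x^*,y^*,t^* )=\frac12\sum_\pm u\big(x^*,Y(x^* ),T_\pm(x^* )\big)+\lim_{h\to 0}\int_S d\sigma_{x,y}\int_{T_-(x)}^{T_+(x)}\big(u\,\partial_\nu w^*-\partial_\nu u\cdot w^*\big)\,dt, \] where $w^*(x,y,t)=w_h(x-x^*,y-y^*,t-t^* )$ with $w_h$ as defined in the context (in particular the limit exists).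
   Context: $\Delta=\sum_{j=1}^{n-1}\partial_{x_j}^2+\partial_y^2$; $x^2=\sum_j x_j^2$; $m=(n-1)/2$. For $h>0$, $\varphi_h$ is the unique $C^\infty$ function on $\mathbb{R}^n$ with $\Delta\varphi_h=0$, $\varphi_h(x,0)=(\pi h)^{-m}e^{-x^2/h}$, $\partial_y\varphi_h(x,0)=0$, and $w_h(x,y,t)=\frac1\pi\int_0^{\pi/2}\varphi_h\big(x,\sqrt{y^2-t^2}\sin s\big)\,ds$ for $y\geqslant|t|$, where at $y=|t|$ the function $w_h$ and its first derivatives are understood as continuous extensions from $\{y>|t|\}$. $\nu$ is the outward unit normal to $\partial\Omega$, $\partial_\nu$ the normal derivative in the $(x,y)$ variables, and $d\sigma$ the surface measure on $\partial\Omega$. *)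

theory Defs
  imports "HOL-Analysis.Analysis"
begin

text \<open>Iterated directional (Frechet) derivatives: g vs z is the derivative of f at z
  along the directions listed in vs (the head of the list is the last applied direction).\<close>

definition deriv_family_on :: "'a::real_normed_vector set \<Rightarrow> ('a \<Rightarrow> real) \<Rightarrow> ('a list \<Rightarrow> 'a \<Rightarrow> real) \<Rightarrow> bool" where
  "deriv_family_on S f g \<longleftrightarrow>
     (\<forall>z\<in>S. g [] z = f z) \<and>
     (\<forall>vs. \<forall>z\<in>S. (g vs has_derivative (\<lambda>v. g (v # vs) z)) (at z))"

definition C_inf_on :: "'a::real_normed_vector set \<Rightarrow> ('a \<Rightarrow> real) \<Rightarrow> bool" where
  "C_inf_on S f \<longleftrightarrow> open S \<and> (\<exists>g. deriv_family_on S f g)"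

text \<open>g witnesses that u belongs to C^2(closure S) for an open S: derivatives up to order 2
  exist in S and extend continuously to the closure (these extensions are g restricted
  to lists of length at most 2, and they are uniquely determined by u).\<close>
definition C2_closure_witness :: "'a::real_normed_vector set \<Rightarrow> ('a \<Rightarrow> real) \<Rightarrow> ('a list \<Rightarrow> 'a \<Rightarrow> real) \<Rightarrow> bool" where
  "C2_closure_witness S u g \<longleftrightarrow> open S \<and>
     (\<forall>z\<in>closure S. g [] z = u z) \<and>
     (\<forall>vs. length vs < 2 \<longrightarrow> (\<forall>z\<in>S. (g vs has_derivative (\<lambda>v. g (v # vs) z)) (at z))) \<and>
     (\<forall>vs. length vs \<le> 2 \<longrightarrow> continuous_on (closure S) (g vs))"

text \<open>The harmonic function phi_h on R^n = R^(n-1) x R, n - 1 = CARD('m), m = (n-1)/2.\<close>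
definition phi :: "real \<Rightarrow> ((real^('m::finite)) \<times> real) \<Rightarrow> real" where
  "phi h = (THE \<phi>. C_inf_on UNIV \<phi> \<and>
      (\<exists>g. deriv_family_on UNIV \<phi> g \<and>
          (\<forall>z. (\<Sum>b\<in>(Basis :: ((real^('m::finite)) \<times> real) set). g [b, b] z) = 0) \<and>
          (\<forall>x. g [(0, 1)] (x, 0) = 0)) \<and>
      (\<forall>x. \<phi> (x, 0) = (pi * h) powr (- real CARD('m) / 2) * exp (- (norm x)\<^sup>2 / h)))"

text \<open>w_h(x,y,t), meaningful for y > |t| (the only points where it is used below).\<close>
definition w :: "real \<Rightarrow> real^('m::finite) \<Rightarrow> real \<Rightarrow> real \<Rightarrow> real" where
  "w h x y t = (1 / pi) * integral {0..pi/2} (\<lambda>s. phi h (x, sqrt (y\<^sup>2 - t\<^sup>2) * sin s))"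

definition grad :: "(real^('m::finite) \<Rightarrow> real) \<Rightarrow> real^('m::finite) \<Rightarrow> real^('m::finite)" where
  "grad Y x = (\<chi> i. frechet_derivative Y (at x) (axis i 1))"

text \<open>Outward unit normal to the graph boundary of {y < Y x} at (x, Y x).\<close>
definition normal :: "(real^('m::finite) \<Rightarrow> real) \<Rightarrow> real^('m::finite) \<Rightarrow> (real^('m::finite)) \<times> real" where
  "normal Y x = (let r = sqrt (1 + (norm (grad Y x))\<^sup>2) in (- (1 / r) *\<^sub>R grad Y x, 1 / r))"

text \<open>Surface integral over a subset S of the graph of Y, via the graph parametrisation:
  d sigma = sqrt(1 + |grad Y|^2) dx.\<close>
definition surf_int :: "(real^('m::finite) \<Rightarrow> real) \<Rightarrow> ((real^('m::finite)) \<times> real) set \<Rightarrow> ((real^('m::finite)) \<times> real \<Rightarrow> real) \<Rightarrow> real" where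
  "surf_int Y S F = integral (fst ` S) (\<lambda>x. F (x, Y x) * sqrt (1 + (norm (grad Y x))\<^sup>2))"

end

theory Submission
  imports Defs "HOL-Probability.Distributions" "HOL-Complex_Analysis.Complex_Analysis"
begin

text \<open>
  The beam \<open>w\<^sub>h\<close> extends to a smooth solution of the wave equation which, restricted to the
  characteristic cone \<open>y = \<bar>t\<bar>\<close>, equals half the Gaussian \<open>\<phi>\<^sub>h (x, 0)\<close>. Integrating
  \<open>div (u \<nabla>w - w \<nabla>u)\<close> over the part of \<open>{\<bar>t\<bar> < y}\<close> below the graph of \<open>Y\<close> turns the
  contribution of the cone into the integral of the Gaussian against the values of \<open>u\<close> at the tip
  and on the rim of the cone; as \<open>h \<rightarrow> 0\<close> the Gaussian concentrates at the tip. A cutoff in \<open>x\<close>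
  restricts this to the projection of \<open>S\<close>; its gradient lives where \<open>Y (x) < \<bar>x\<bar>\<close>, and there the
  beam is exponentially small because \<open>\<phi>\<^sub>h (x, y)\<close> is of order \<open>exp ((y\<^sup>2 - x\<^sup>2) / h)\<close> up to powers
  of \<open>h\<close>.

  The bound on \<open>\<phi>\<^sub>h\<close> comes from its Fourier integral with amplitude
  \<open>exp (- h \<xi>\<^sup>2 / 4) cosh (y \<bar>\<xi>\<bar>)\<close>: the integrand is entire in \<open>\<xi>\<close>, so the contour can be shifted to
  \<open>\<xi> + 2 i x / h\<close>, and \<open>\<bar>Re sqrt (\<zeta> \<cdot> \<zeta>)\<bar> \<le> \<bar>Re \<zeta>\<bar>\<close>. Uniqueness of \<open>\<phi>\<^sub>h\<close> follows from the same
  estimate: pairing a harmonic function with zero Cauchy data with a cut-off translate of \<open>\<phi>\<^sub>h\<close>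
  recovers its normal derivative on any other hyperplane in the limit \<open>h \<rightarrow> 0\<close>.
\<close>

lemma has_derivative_quadratic_bound:
  fixes f :: "'a::real_normed_vector \<Rightarrow> 'b::real_normed_vector"
  assumes D: "bounded_linear D"
    and bd: "\<And>v. norm v \<le> 1 \<Longrightarrow> norm (f (z + v) - f z - D v) \<le> C * (norm v)\<^sup>2"
  shows "(f has_derivative D) (at z)"
proof (rule has_derivativeI_sandwich[where e=1 and H="\<lambda>y. \<bar>C\<bar> * norm (y - z)"])
  show "bounded_linear D" by fact
  show "norm (f y - f z - D (y - z)) / norm (y - z) \<le> \<bar>C\<bar> * norm (y - z)"
    if "y \<noteq> z" "dist y z < 1" for y
  proof -
    have "norm (f (z + (y - z)) - f z - D (y - z)) \<le> C * (norm (y - z))\<^sup>2"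
      using that by (intro bd) (auto simp: dist_norm)
    also have "\<dots> \<le> \<bar>C\<bar> * (norm (y - z))\<^sup>2"
      by (intro mult_right_mono) auto
    finally show ?thesis using that by (simp add: field_simps power2_eq_square)
  qed
  have "((\<lambda>y. \<bar>C\<bar> * norm (y - z)) \<longlongrightarrow> \<bar>C\<bar> * norm (z - z)) (at z)"
    by (intro tendsto_intros)
  then show "((\<lambda>y. \<bar>C\<bar> * norm (y - z)) \<longlongrightarrow> 0) (at z)" by simp
qed auto

lemma has_derivative_integral_quadratic_bound:
  fixes f :: "'z::euclidean_space \<Rightarrow> 's \<Rightarrow> 'b::{banach, second_countable_topology}"
  assumes int: "\<And>v. norm v \<le> 1 \<Longrightarrow> integrable M (f (z + v))"
    and intD: "\<And>v. integrable M (\<lambda>s. D s v)"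
    and lin: "\<And>s. linear (D s)"
    and B: "integrable M B"
    and bd: "\<And>s v. norm v \<le> 1 \<Longrightarrow> norm (f (z + v) s - f z s - D s v) \<le> B s * (norm v)\<^sup>2"
  shows "((\<lambda>w. \<integral>s. f w s \<partial>M) has_derivative (\<lambda>v. \<integral>s. D s v \<partial>M)) (at z)"
proof (rule has_derivative_quadratic_bound[where C="\<integral>s. B s \<partial>M"])
  show "bounded_linear (\<lambda>v. \<integral>s. D s v \<partial>M)"
    unfolding linear_conv_bounded_linear[symmetric]
    by (rule linearI)
      (use intD in \<open>simp_all add: linear_add[OF lin] linear_scale[OF lin]\<close>)
  fix v :: 'z assume v: "norm v \<le> 1"
  have i0: "integrable M (f z)" using int[of 0] by simp
  have "norm ((\<integral>s. f (z + v) s \<partial>M) - (\<integral>s. f z s \<partial>M) - (\<integral>s. D s v \<partial>M))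
      = norm (\<integral>s. f (z + v) s - f z s - D s v \<partial>M)"
    using int[OF v] i0 intD[of v] by simp
  also have "\<dots> \<le> (\<integral>s. norm (f (z + v) s - f z s - D s v) \<partial>M)"
    by (rule integral_norm_bound)
  also have "\<dots> \<le> (\<integral>s. B s * (norm v)\<^sup>2 \<partial>M)"
    using int[OF v] i0 intD[of v] B bd[OF v]
    by (intro integral_mono) (auto intro!: integrable_norm)
  finally show "norm ((\<integral>s. f (z + v) s \<partial>M) - (\<integral>s. f z s \<partial>M) - (\<integral>s. D s v \<partial>M)) \<le> (\<integral>s. B s \<partial>M) * (norm v)\<^sup>2"
    by simp
qed

lemma holomorphic_quadratic_remainder:
  fixes f :: "complex \<Rightarrow> complex"
  assumes hol: "f holomorphic_on UNIV"
    and B: "\<And>w. norm w \<le> norm z + 2 \<Longrightarrow> norm (f w) \<le> B"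
  shows "norm v \<le> 1 \<Longrightarrow> norm (f (z + v) - f z - deriv f z * v) \<le> 2 * B * (norm v)\<^sup>2"
    and "norm (deriv f z) \<le> B"
proof -
  have der: "norm ((deriv ^^ n) f w) \<le> fact n * B / 1 ^ n" if "norm w \<le> norm z + 1" for n w
  proof (rule Cauchy_inequality)
    show "f holomorphic_on ball w 1" using hol by (rule holomorphic_on_subset) simp
    show "continuous_on (cball w 1) f"
      using hol holomorphic_on_imp_continuous_on holomorphic_on_subset by blast
    show "norm (f x) \<le> B" if "norm (w - x) = 1" for x
    proof (rule B)
      have "norm x \<le> norm w + norm (w - x)" by (metis norm_minus_commute norm_triangle_sub)
      then show "norm x \<le> norm z + 2" using that \<open>norm w \<le> norm z + 1\<close> by simp
    qed
  qed simp
  show "norm (deriv f z) \<le> B" using der[of z 1] by simp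
  assume v: "norm v \<le> 1"
  have "norm (f (z + v) - (\<Sum>i\<le>1. (deriv ^^ i) f z * ((z + v) - z) ^ i / fact i)) \<le> 2 * B * norm ((z + v) - z) ^ Suc 1 / fact 1"
  proof (rule complex_Taylor[where S="cball z 1" and f="\<lambda>i. (deriv ^^ i) f", unfolded funpow_0])
    show "((deriv ^^ i) f has_field_derivative (deriv ^^ Suc i) f x) (at x within cball z 1)" for i x
      using hol holomorphic_higher_deriv[OF hol open_UNIV]
      by (metis (no_types, lifting) UNIV_I comp_apply funpow.simps(2) has_field_derivative_at_within holomorphic_derivI open_UNIV)
    show "norm ((deriv ^^ Suc 1) f x) \<le> 2 * B" if "x \<in> cball z 1" for x
    proof -
      have "norm x \<le> norm z + dist z x" by (metis dist_norm norm_minus_commute norm_triangle_sub)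
      then show ?thesis using der[of x 2] that by (simp add: numeral_2_eq_2)
    qed
  qed (use v in \<open>auto simp: dist_norm\<close>)
  then show "norm (f (z + v) - f z - deriv f z * v) \<le> 2 * B * (norm v)\<^sup>2"
    by (simp add: algebra_simps power2_eq_square)
qed

lemma holomorphic_integral:
  fixes f :: "complex \<Rightarrow> 's \<Rightarrow> complex"
  assumes hol: "\<And>s. (\<lambda>z. f z s) holomorphic_on UNIV"
    and meas: "\<And>z. f z \<in> borel_measurable M"
    and dom: "\<And>R. \<exists>B. integrable M B \<and> (\<forall>z s. norm z \<le> R \<longrightarrow> norm (f z s) \<le> B s)"
  shows "(\<lambda>z. \<integral>s. f z s \<partial>M) holomorphic_on UNIV"
proof -
  have int: "integrable M (f z)" for z
  proof -
    obtain B where "integrable M B" "\<forall>w s. norm w \<le> norm z \<longrightarrow> norm (f w s) \<le> B s"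
      using dom by blast
    then show ?thesis
      by (intro Bochner_Integration.integrable_bound[OF _ meas, of B]) (auto intro!: AE_I2 order_trans[OF _ abs_ge_self])
  qed
  have "((\<lambda>z. \<integral>s. f z s \<partial>M) has_field_derivative (\<integral>s. deriv (\<lambda>z. f z s) z \<partial>M)) (at z)" for z
  proof -
    obtain B where B: "integrable M B" and Bd: "\<And>w s. norm w \<le> norm z + 2 \<Longrightarrow> norm (f w s) \<le> B s"
      using dom by blast
    have lim: "(\<lambda>n. (f (z + 1 / of_nat (Suc n)) s - f z s) / (1 / of_nat (Suc n))) \<longlonglongrightarrow> deriv (\<lambda>z. f z s) z" for s
    proof -
      have "((\<lambda>z. f z s) has_field_derivative deriv (\<lambda>z. f z s) z) (at z)"
        by (rule holomorphic_derivI[OF hol open_UNIV UNIV_I])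
      then have "((\<lambda>v. (f (z + v) s - f z s) / v) \<longlongrightarrow> deriv (\<lambda>z. f z s) z) (at 0)"
        by (simp add: DERIV_def)
      moreover have "filterlim (\<lambda>n. 1 / of_nat (Suc n) :: complex) (at 0) sequentially"
        unfolding filterlim_at
        by (auto simp flip: of_nat_Suc intro!: LIMSEQ_Suc[OF lim_1_over_n])
      ultimately show ?thesis by (rule filterlim_compose)
    qed
    have mD: "(\<lambda>s. deriv (\<lambda>z. f z s) z) \<in> borel_measurable M"
      by (rule borel_measurable_LIMSEQ_metric[OF _ lim]) (intro borel_measurable_divide borel_measurable_diff meas borel_measurable_const)
    have iD: "integrable M (\<lambda>s. deriv (\<lambda>z. f z s) z)"
      using holomorphic_quadratic_remainder(2)[OF hol Bd]
      by (intro Bochner_Integration.integrable_bound[OF B mD]) (auto intro!: AE_I2 order_trans[OF _ abs_ge_self])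
    have "((\<lambda>z. \<integral>s. f z s \<partial>M) has_derivative (\<lambda>v. \<integral>s. deriv (\<lambda>z. f z s) z * v \<partial>M)) (at z)"
      by (rule has_derivative_integral_quadratic_bound[where B="\<lambda>s. 2 * B s"])
        (use int iD B holomorphic_quadratic_remainder(1)[OF hol Bd] in
          \<open>auto intro!: bounded_linear.linear[OF bounded_linear_mult_right]\<close>)
    then show ?thesis
      by (simp add: has_field_derivative_def)
  qed
  then show ?thesis by (auto simp: holomorphic_on_open)
qed

lemma entire_constant_on_reals:
  fixes f :: "complex \<Rightarrow> complex"
  assumes hol: "f holomorphic_on UNIV" and const: "\<And>s::real. f (of_real s) = c"
  shows "f z = c"
proof -
  have "f z - c = 0"
  proof (rule analytic_continuation[where S=UNIV and U="range complex_of_real" and \<xi>=0 and f="\<lambda>z. f z - c"])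
    show "(0::complex) islimpt range complex_of_real"
      unfolding islimpt_approachable
    proof (intro allI impI)
      fix e :: real assume "e > 0"
      then show "\<exists>x'\<in>range complex_of_real. x' \<noteq> 0 \<and> dist x' 0 < e"
        by (intro bexI[where x="complex_of_real (e/2)"] rangeI) auto
    qed
  qed (use assms in \<open>auto intro!: holomorphic_intros\<close>)
  then show ?thesis by simp
qed

subsection \<open>Gaussian integrals\<close>

lemma gaussian_real:
  assumes c: "c > (0::real)"
  shows "has_bochner_integral lborel (\<lambda>x. exp (- c * x\<^sup>2)) (sqrt (pi / c))"
proof -
  have eq: "normal_density 0 (1 / sqrt (2 * c)) x * sqrt (pi / c) = exp (- c * x\<^sup>2)" for x
    using c by (simp add: normal_density_def power_divide real_sqrt_mult real_sqrt_divide field_simps)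
  have "has_bochner_integral lborel (normal_density 0 (1 / sqrt (2 * c))) 1"
    using c by (simp add: has_bochner_integral_iff integrable_normal_density integral_normal_density)
  from has_bochner_integral_mult_left[OF this, of "sqrt (pi / c)"] show ?thesis
    by (simp only: eq) simp
qed

lemma gaussian_euclidean:
  assumes c: "c > (0::real)"
  shows "has_bochner_integral lborel (\<lambda>x::'a::euclidean_space. exp (- c * (norm x)\<^sup>2)) (sqrt (pi / c) ^ DIM('a))"
proof (rule has_bochner_integral_nn_integral)
  have "(\<integral>\<^sup>+x. ennreal (exp (- c * (norm x)\<^sup>2)) \<partial>(lborel :: 'a measure))
      = (\<integral>\<^sup>+x. (\<Prod>b\<in>Basis. ennreal (exp (- c * (x \<bullet> b)\<^sup>2))) \<partial>(lborel :: 'a measure))"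
  proof (rule nn_integral_cong)
    fix x :: 'a
    have "exp (- c * (norm x)\<^sup>2) = (\<Prod>b\<in>Basis. exp (- c * (x \<bullet> b)\<^sup>2))"
      by (simp add: norm_eq_sqrt_inner euclidean_inner[of x x] exp_sum[symmetric] sum_distrib_left
          sum_nonneg power2_eq_square)
    then show "ennreal (exp (- c * (norm x)\<^sup>2)) = (\<Prod>b\<in>Basis. ennreal (exp (- c * (x \<bullet> b)\<^sup>2)))"
      by (simp add: prod_ennreal)
  qed
  also have "\<dots> = (\<Prod>b\<in>(Basis::'a set). \<integral>\<^sup>+x. ennreal (exp (- c * x\<^sup>2)) \<partial>lborel)"
    by (rule nn_integral_lborel_prod[where f="\<lambda>b x. ennreal (exp (- c * x\<^sup>2))"]) auto
  also have "(\<integral>\<^sup>+x. ennreal (exp (- c * x\<^sup>2)) \<partial>lborel) = ennreal (sqrt (pi / c))"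
    using gaussian_real[OF c] by (simp add: has_bochner_integral_iff nn_integral_eq_integral)
  finally show "(\<integral>\<^sup>+x. ennreal (exp (- c * (norm x)\<^sup>2)) \<partial>(lborel :: 'a measure)) = ennreal (sqrt (pi / c) ^ DIM('a))"
    using c by (simp add: ennreal_power)
qed (use c in auto)

lemma gaussian_exp_le:
  fixes c N t :: real
  assumes "c > 0"
  shows "exp (- c * t\<^sup>2 + N * t) \<le> exp (N\<^sup>2 / (2 * c)) * exp (- (c / 2) * t\<^sup>2)"
proof -
  have "0 \<le> (c * t - N)\<^sup>2 / (2 * c)" using assms by simp
  also have "\<dots> = c / 2 * t\<^sup>2 - N * t + N\<^sup>2 / (2 * c)"
    using assms by (simp add: field_simps power2_eq_square)
  finally show ?thesis by (simp flip: exp_add)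
qed

lemma integrable_gaussian_exp:
  assumes c: "c > (0::real)"
  shows "integrable lborel (\<lambda>x::'a::euclidean_space. exp (- c * (norm x)\<^sup>2 + N * norm x))"
proof (rule Bochner_Integration.integrable_bound)
  show "integrable lborel (\<lambda>x::'a. exp (N\<^sup>2 / (2 * c)) * exp (- (c / 2) * (norm x)\<^sup>2))"
    using gaussian_euclidean[of "c / 2"] c by (auto simp: has_bochner_integral_iff)
qed (use gaussian_exp_le[OF c] in auto)

subsection \<open>Superpositions of exponentials\<close>

locale exp_superposition =
  fixes M :: "'s measure" and k :: "'s \<Rightarrow> 'z::euclidean_space \<Rightarrow> complex" and r :: "'s \<Rightarrow> real"
  assumes lin: "linear (k s)"
    and k_meas[measurable]: "(\<lambda>s. k s z) \<in> borel_measurable M"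
    and r_meas[measurable]: "r \<in> borel_measurable M"
    and k_le: "norm (k s z) \<le> r s * norm z"
    and r_nonneg: "0 \<le> r s"
begin

definition amplitude :: "('s \<Rightarrow> complex) \<Rightarrow> bool" where
  "amplitude a \<longleftrightarrow> a \<in> borel_measurable M \<and> (\<forall>N::nat. integrable M (\<lambda>s. norm (a s) * exp (N * r s)))"

definition superpos :: "('s \<Rightarrow> complex) \<Rightarrow> 'z \<Rightarrow> complex" where
  "superpos a z = (\<integral>s. a s * exp (k s z) \<partial>M)"

lemma amplitude_meas: "amplitude a \<Longrightarrow> a \<in> borel_measurable M"
  by (simp add: amplitude_def)

lemma amplitude_mult:
  assumes "amplitude a"
  shows "amplitude (\<lambda>s. a s * k s v)"
proof -
  have [measurable]: "a \<in> borel_measurable M" using assms by (rule amplitude_meas)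
  have "integrable M (\<lambda>s. norm (a s * k s v) * exp (N * r s))" for N :: nat
  proof (rule Bochner_Integration.integrable_bound)
    show "integrable M (\<lambda>s. norm v * (norm (a s) * exp (Suc N * r s)))"
      using assms unfolding amplitude_def by (intro integrable_mult_right) blast
    have "norm (k s v) * exp (N * r s) \<le> norm v * exp (Suc N * r s)" for s
    proof -
      have "norm (k s v) \<le> r s * norm v" by (rule k_le)
      also have "\<dots> \<le> exp (r s) * norm v"
        using exp_ge_add_one_self[of "r s"] by (intro mult_right_mono) (linarith, simp)
      finally have "norm (k s v) * exp (N * r s) \<le> (exp (r s) * norm v) * exp (N * r s)"
        by (intro mult_right_mono) auto
      then show ?thesis by (simp add: algebra_simps exp_add)
    qed
    then have "norm (a s) * (norm (k s v) * exp (N * r s)) \<le> norm v * (norm (a s) * exp (Suc N * r s))" for s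
      using mult_left_mono[OF _ norm_ge_zero[of "a s"], of "norm (k s v) * exp (N * r s)" "norm v * exp (Suc N * r s)"]
      by (simp only: mult_ac)
    then show "AE s in M. norm (norm (a s * k s v) * exp (N * r s)) \<le> norm (norm v * (norm (a s) * exp (Suc N * r s)))"
      by (intro AE_I2) (simp add: norm_mult mult_ac)
  qed simp
  then show ?thesis unfolding amplitude_def by simp
qed

lemma amplitude_prod: "amplitude a \<Longrightarrow> amplitude (\<lambda>s. a s * (\<Prod>v\<leftarrow>vs. k s v))"
proof (induction vs)
  case (Cons v vs)
  then have "amplitude (\<lambda>s. (a s * (\<Prod>v\<leftarrow>vs. k s v)) * k s v)" by (intro amplitude_mult)
  then show ?case by (simp add: mult_ac)
qed simp

lemma superpos_integrable:
  assumes "amplitude a"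
  shows "integrable M (\<lambda>s. a s * exp (k s z))"
proof -
  have [measurable]: "a \<in> borel_measurable M" using assms by (rule amplitude_meas)
  obtain N :: nat where N: "norm z \<le> N" using real_arch_simple by blast
  show ?thesis
  proof (rule Bochner_Integration.integrable_bound)
    show "(\<lambda>s. a s * exp (k s z)) \<in> borel_measurable M" by measurable
    show "integrable M (\<lambda>s. norm (a s) * exp (N * r s))" using assms by (simp add: amplitude_def)
    have "norm (exp (k s z)) \<le> exp (N * r s)" for s
    proof -
      have "norm (exp (k s z)) \<le> exp (norm (k s z))" by (rule norm_exp)
      also have "norm (k s z) \<le> r s * norm z" by (rule k_le)
      also have "\<dots> \<le> N * r s" using mult_right_mono[OF N r_nonneg[of s]] by (simp add: mult.commute)
      finally show ?thesis by simp
    qed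
    then show "AE s in M. norm (a s * exp (k s z)) \<le> norm (norm (a s) * exp (N * r s))"
      by (intro AE_I2) (simp add: norm_mult mult_left_mono)
  qed
qed

lemma superpos_has_derivative:
  assumes a: "amplitude a"
  shows "(superpos a has_derivative (\<lambda>v. superpos (\<lambda>s. a s * k s v) z)) (at z)"
proof -
  obtain N :: nat where N: "norm z + 1 \<le> N" using real_arch_simple by blast
  have "((\<lambda>w. \<integral>s. a s * exp (k s w) \<partial>M) has_derivative (\<lambda>v. \<integral>s. a s * k s v * exp (k s z) \<partial>M)) (at z)"
  proof (rule has_derivative_integral_quadratic_bound)
    show "integrable M (\<lambda>s. a s * exp (k s (z + v)))" for v by (rule superpos_integrable[OF a])
    show "integrable M (\<lambda>s. a s * k s v * exp (k s z))" for v
      by (rule superpos_integrable[OF amplitude_mult[OF a]])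
    show "linear (\<lambda>v. a s * k s v * exp (k s z))" for s
      by (rule linearI) (simp_all add: linear_add[OF lin] linear_scale[OF lin] algebra_simps)
    show "integrable M (\<lambda>s. 2 * (norm (a s) * exp (real (Suc N) * r s)))"
      using a unfolding amplitude_def by (intro integrable_mult_right) blast
    fix s and v :: 'z assume v: "norm v \<le> 1"
    have kv: "norm (k s v) \<le> r s * norm v" by (rule k_le)
    have "norm (k s v) \<le> r s" using kv v r_nonneg[of s] mult_left_mono[OF v r_nonneg[of s]] by simp
    have "norm (exp (k s v) - (\<Sum>i\<le>1. (k s v) ^ i / fact i)) \<le> exp \<bar>Re (k s v)\<bar> * norm (k s v) ^ Suc 1 / fact 1"
      by (rule Taylor_exp)
    also have "\<dots> \<le> exp (r s) * (r s * norm v) ^ 2 / fact 1"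
      using abs_Re_le_cmod[of "k s v"] \<open>norm (k s v) \<le> r s\<close> kv
      by (intro divide_right_mono mult_mono) (auto simp: power2_eq_square intro!: mult_mono r_nonneg)
    finally have 1: "norm (exp (k s v) - 1 - k s v) \<le> exp (r s) * (r s * norm v)\<^sup>2"
      by (simp add: algebra_simps)
    have "norm (exp (k s z)) \<le> exp (r s * norm z)"
      using order_trans[OF norm_exp] k_le[of s z] by (meson exp_le_cancel_iff)
    have "norm (exp (k s z)) * norm (exp (k s v) - 1 - k s v)
        \<le> exp (r s * norm z) * (exp (r s) * (r s * norm v)\<^sup>2)"
      by (intro mult_mono 1) (use \<open>norm (exp (k s z)) \<le> exp (r s * norm z)\<close> in auto)
    also have "\<dots> = exp (r s * (norm z + 1)) * (r s)\<^sup>2 * (norm v)\<^sup>2"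
      by (simp add: algebra_simps exp_add power_mult_distrib)
    also have "\<dots> \<le> exp (r s * N) * (2 * exp (r s)) * (norm v)\<^sup>2"
    proof (intro mult_right_mono mult_mono)
      show "(r s)\<^sup>2 \<le> 2 * exp (r s)"
        using exp_lower_Taylor_quadratic[OF r_nonneg[of s]] r_nonneg[of s] by simp
      show "exp (r s * (norm z + 1)) \<le> exp (r s * N)" using N r_nonneg[of s] by (simp add: mult_left_mono)
    qed auto
    finally have 2: "norm (exp (k s z)) * norm (exp (k s v) - 1 - k s v) \<le> 2 * exp (real (Suc N) * r s) * (norm v)\<^sup>2"
      by (simp add: algebra_simps exp_add)
    have "a s * exp (k s (z + v)) - a s * exp (k s z) - a s * k s v * exp (k s z)
        = a s * (exp (k s z) * (exp (k s v) - 1 - k s v))"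
      by (simp add: linear_add[OF lin] exp_add algebra_simps)
    then have "norm (a s * exp (k s (z + v)) - a s * exp (k s z) - a s * k s v * exp (k s z))
        = norm (a s) * (norm (exp (k s z)) * norm (exp (k s v) - 1 - k s v))"
      by (simp add: norm_mult)
    also have "\<dots> \<le> norm (a s) * (2 * exp (real (Suc N) * r s) * (norm v)\<^sup>2)"
      by (intro mult_left_mono 2) auto
    finally show "norm (a s * exp (k s (z + v)) - a s * exp (k s z) - a s * k s v * exp (k s z))
        \<le> 2 * (norm (a s) * exp (real (Suc N) * r s)) * (norm v)\<^sup>2"
      by (simp add: mult_ac)
  qed
  then show ?thesis by (simp add: superpos_def[abs_def])
qed

lemma superpos_deriv_family:
  assumes a: "amplitude a"
  shows "deriv_family_on UNIV (\<lambda>z. Re (superpos a z)) (\<lambda>vs z. Re (superpos (\<lambda>s. a s * (\<Prod>v\<leftarrow>vs. k s v)) z))"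
proof -
  have "((\<lambda>z. Re (superpos (\<lambda>s. a s * (\<Prod>v\<leftarrow>vs. k s v)) z)) has_derivative
         (\<lambda>v. Re (superpos (\<lambda>s. a s * (\<Prod>v\<leftarrow>v # vs. k s v)) z))) (at z)" for vs z
    using superpos_has_derivative[OF amplitude_prod[OF a], of vs z]
    by (intro has_derivative_Re) (simp add: mult_ac)
  then show ?thesis by (simp add: deriv_family_on_def)
qed

lemma superpos_sum:
  assumes "finite B" "\<And>b. b \<in> B \<Longrightarrow> amplitude (a b)"
  shows "(\<Sum>b\<in>B. superpos (a b) z) = superpos (\<lambda>s. \<Sum>b\<in>B. a b s) z"
  unfolding superpos_def using superpos_integrable[OF assms(2)]
  by (simp add: sum_distrib_right)

end

lemma deriv_family_on_add:
  assumes "deriv_family_on S f g" "deriv_family_on S f' g'"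
  shows "deriv_family_on S (\<lambda>z. f z + f' z) (\<lambda>vs z. g vs z + g' vs z)"
  using assms unfolding deriv_family_on_def by (auto intro!: has_derivative_add)

lemma deriv_family_on_cmult:
  assumes "deriv_family_on S f g"
  shows "deriv_family_on S (\<lambda>z. c * f z) (\<lambda>vs z. c * g vs z)"
  using assms unfolding deriv_family_on_def by (auto intro!: has_derivative_mult_right)

lemma deriv_family_on_linear:
  fixes L :: "'a::real_normed_vector \<Rightarrow> 'b::real_normed_vector"
  assumes "deriv_family_on UNIV f g" and L: "bounded_linear L"
  shows "deriv_family_on UNIV (\<lambda>z. f (L z)) (\<lambda>vs z. g (map L vs) (L z))"
proof -
  have "((\<lambda>z. g (map L vs) (L z)) has_derivative (\<lambda>v. g (L v # map L vs) (L z))) (at z)" for vs z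
    using assms(1) unfolding deriv_family_on_def
    by (intro has_derivative_compose[OF bounded_linear_imp_has_derivative[OF L]]) auto
  then show ?thesis using assms(1) by (simp add: deriv_family_on_def)
qed

subsection \<open>Shifting the contour of a Gaussian integral\<close>

definition cosh_sqrt :: "complex \<Rightarrow> complex" where
  "cosh_sqrt q = cosh (csqrt q)"

lemma cosh_sqrt_power2: "cosh_sqrt (z\<^sup>2) = cosh z"
proof -
  have "csqrt (z\<^sup>2) = z \<or> csqrt (z\<^sup>2) = - z" by (metis power2_csqrt power2_eq_iff)
  then show ?thesis unfolding cosh_sqrt_def by auto
qed

lemma norm_cosh_sqrt: "norm (cosh_sqrt q) \<le> exp (sqrt ((norm q + Re q) / 2))"
proof -
  have *: "norm (cosh z) \<le> exp \<bar>Re z\<bar>" for z :: complex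
  proof -
    have "norm (cosh z) \<le> (norm (exp z) + norm (exp (- z))) / 2"
      unfolding cosh_def using norm_triangle_ineq[of "exp z" "exp (- z)"] by simp
    also have "\<dots> \<le> (exp \<bar>Re z\<bar> + exp \<bar>Re z\<bar>) / 2"
      by (intro divide_right_mono add_mono) auto
    finally show ?thesis by simp
  qed
  have "0 \<le> norm q + Re q" using abs_Re_le_cmod[of q] by linarith
  then show ?thesis using *[of "csqrt q"] by (simp add: cosh_sqrt_def)
qed

lemma norm_cosh_sqrt_le: "norm (cosh_sqrt q) \<le> exp (sqrt (norm q))"
proof -
  have "(norm q + Re q) / 2 \<le> norm q" using complex_Re_le_cmod[of q] by simp
  then show ?thesis
    by (intro order_trans[OF norm_cosh_sqrt]) simp
qed

lemma holomorphic_cosh_sqrt: "cosh_sqrt holomorphic_on UNIV"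
proof (rule no_isolated_singularity[where K="{0}"])
  have pos: "cosh_sqrt holomorphic_on - \<real>\<^sub>\<le>\<^sub>0"
    unfolding cosh_sqrt_def[abs_def] cosh_def by (intro holomorphic_intros) auto
  have neg: "cosh_sqrt holomorphic_on {q. - q \<notin> \<real>\<^sub>\<le>\<^sub>0}"
  proof -
    have eq: "cosh_sqrt q = cosh (\<i> * csqrt (- q))" for q
      by (subst cosh_sqrt_power2[symmetric]) (simp add: power_mult_distrib)
    show ?thesis
      unfolding eq cosh_def by (intro holomorphic_intros) auto
  qed
  have open2: "open {q::complex. - q \<notin> \<real>\<^sub>\<le>\<^sub>0}"
  proof -
    have "{q::complex. - q \<notin> \<real>\<^sub>\<le>\<^sub>0} = uminus -` (- \<real>\<^sub>\<le>\<^sub>0)" by auto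
    then show ?thesis
      by (simp add: open_vimage continuous_on_minus open_Compl closed_nonpos_Reals_complex)
  qed
  have "UNIV - {0::complex} = - \<real>\<^sub>\<le>\<^sub>0 \<union> {q. - q \<notin> \<real>\<^sub>\<le>\<^sub>0}"
    by (auto simp: complex_nonpos_Reals_iff complex_eq_iff)
  then show hol: "cosh_sqrt holomorphic_on UNIV - {0}"
    using holomorphic_on_Un[OF pos neg _ open2] closed_nonpos_Reals_complex by (simp add: open_Compl)
  have "isCont cosh_sqrt q" for q
  proof (cases "q = 0")
    case True
    have "((\<lambda>q. csqrt q) \<longlongrightarrow> 0) (at 0)"
    proof (rule tendsto_norm_zero_cancel)
      have "((\<lambda>q::complex. sqrt (norm q)) \<longlongrightarrow> sqrt (norm (0::complex))) (at 0)" by (intro tendsto_intros)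
      then show "((\<lambda>q. norm (csqrt q)) \<longlongrightarrow> 0) (at 0)" by simp
    qed
    then have "((\<lambda>q. cosh (csqrt q)) \<longlongrightarrow> cosh 0) (at 0)"
      unfolding cosh_def by (intro tendsto_intros) auto
    then show ?thesis using True by (simp add: isCont_def cosh_sqrt_def[abs_def])
  next
    case False
    then show ?thesis using hol holomorphic_on_imp_continuous_on[OF hol]
      by (simp add: continuous_on_eq_continuous_at open_delete)
  qed
  then show "continuous_on UNIV cosh_sqrt" by (simp add: continuous_on_eq_continuous_at)
qed auto

lemma integral_lborel_translate:
  fixes f :: "'a::euclidean_space \<Rightarrow> 'b::{banach, second_countable_topology}"
  assumes [measurable]: "f \<in> borel_measurable borel"
  shows "(\<integral>x. f (x + a) \<partial>lborel) = (\<integral>x. f x \<partial>lborel)"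
proof -
  have "(\<integral>x. f x \<partial>lborel) = (\<integral>x. f x \<partial>distr lborel borel ((+) a))" by (simp add: lborel_distr_plus)
  also have "\<dots> = (\<integral>x. f (a + x) \<partial>lborel)" by (rule integral_distr) auto
  finally show ?thesis by (simp add: add.commute)
qed

lemma Re_le_of_norm: "norm z \<le> c \<Longrightarrow> Re z \<le> c" for z :: complex
  using complex_Re_le_cmod order_trans by blast

lemma gaussian_contour_shift:
  fixes x :: "'a::euclidean_space" and P :: "complex \<Rightarrow> 'a \<Rightarrow> complex" and h y A :: real
  defines "\<eta> \<equiv> (2 / h) *\<^sub>R x"
  assumes h: "h > 0"
    and hol: "\<And>\<xi>. (\<lambda>\<sigma>. P \<sigma> \<xi>) holomorphic_on UNIV"
    and [measurable]: "\<And>\<sigma>. P \<sigma> \<in> borel_measurable borel"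
    and shift: "\<And>s \<xi>. P (of_real s) \<xi> = P 0 (\<xi> + s *\<^sub>R \<eta>)"
    and growth: "\<And>\<sigma> \<xi>. norm (P \<sigma> \<xi>) \<le> A * (1 + norm \<xi> + norm \<sigma> * norm \<eta>)\<^sup>2"
  shows "(\<integral>\<xi>. P 0 \<xi> * cosh (of_real (norm \<xi> * y)) * exp (of_real (- (h / 4) * (norm \<xi>)\<^sup>2) + \<i> * of_real (\<xi> \<bullet> x)) \<partial>lborel)
       = (\<integral>\<xi>. P \<i> \<xi> * cosh_sqrt (of_real (y\<^sup>2) * (of_real (\<xi> \<bullet> \<xi> - \<eta> \<bullet> \<eta>) + 2 * \<i> * of_real (\<xi> \<bullet> \<eta>)))
            * of_real (exp (- (h / 4) * (norm \<xi>)\<^sup>2 - (norm x)\<^sup>2 / h)) \<partial>lborel)"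
proof -
  define Q where "Q \<sigma> \<xi> = of_real (\<xi> \<bullet> \<xi>) + 2 * \<sigma> * of_real (\<xi> \<bullet> \<eta>) + \<sigma>\<^sup>2 * of_real (\<eta> \<bullet> \<eta>)" for \<sigma> :: complex and \<xi> :: 'a
  define F where "F \<sigma> \<xi> = P \<sigma> \<xi> * cosh_sqrt (of_real (y\<^sup>2) * Q \<sigma> \<xi>) *
      exp (- of_real (h / 4) * Q \<sigma> \<xi> + \<i> * (of_real (\<xi> \<bullet> x) + \<sigma> * of_real (\<eta> \<bullet> x)))" for \<sigma> :: complex and \<xi> :: 'a
  have [measurable]: "cosh_sqrt \<in> borel_measurable borel"
    using holomorphic_on_imp_continuous_on[OF holomorphic_cosh_sqrt] borel_measurable_continuous_onI by blast
  have meas[measurable]: "F \<sigma> \<in> borel_measurable borel" for \<sigma>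
    unfolding F_def Q_def by measurable
  have A0: "A \<ge> 0"
  proof -
    have "0 \<le> A * (1 + norm (0::'a) + norm (0::complex) * norm \<eta>)\<^sup>2"
      using order_trans[OF norm_ge_zero growth[of 0 0]] .
    then show ?thesis by simp
  qed
  have holF: "(\<lambda>\<sigma>. F \<sigma> \<xi>) holomorphic_on UNIV" for \<xi>
  proof -
    have "(\<lambda>\<sigma>. of_real (y\<^sup>2) * Q \<sigma> \<xi>) holomorphic_on UNIV"
      unfolding Q_def by (intro holomorphic_intros)
    from holomorphic_on_compose_gen[OF this holomorphic_cosh_sqrt]
    have "(\<lambda>\<sigma>. cosh_sqrt (of_real (y\<^sup>2) * Q \<sigma> \<xi>)) holomorphic_on UNIV"
      by (simp add: o_def)
    then show ?thesis
      unfolding F_def Q_def by (intro holomorphic_intros hol)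
  qed
  have dom: "\<exists>B. integrable lborel B \<and> (\<forall>\<sigma> \<xi>. norm \<sigma> \<le> R \<longrightarrow> norm (F \<sigma> \<xi>) \<le> B \<xi>)" for R
  proof -
    define R' where "R' = \<bar>R\<bar> * norm \<eta>"
    define N where "N = 1 + \<bar>y\<bar> + (h / 2) * R'"
    define C where "C = A * 2 * exp (1 + R') * exp (\<bar>y\<bar> * R') * exp ((h / 4) * R'\<^sup>2 + R' * norm x)"
    have R'0: "R' \<ge> 0" by (simp add: R'_def)
    have "norm (F \<sigma> \<xi>) \<le> C * exp (- (h / 4) * (norm \<xi>)\<^sup>2 + N * norm \<xi>)" if "norm \<sigma> \<le> R" for \<sigma> \<xi>
    proof -
      have s\<eta>: "norm \<sigma> * norm \<eta> \<le> R'" unfolding R'_def using that by (intro mult_right_mono) auto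
      have cs: "norm (2 * \<sigma> * of_real (\<xi> \<bullet> \<eta>) + \<sigma>\<^sup>2 * of_real (\<eta> \<bullet> \<eta>)) \<le> 2 * R' * norm \<xi> + R'\<^sup>2"
      proof -
        have "norm (2 * \<sigma> * of_real (\<xi> \<bullet> \<eta>)) \<le> 2 * norm \<sigma> * (norm \<xi> * norm \<eta>)"
          using Cauchy_Schwarz_ineq2[of \<xi> \<eta>] by (simp add: norm_mult mult_left_mono)
        also have "\<dots> \<le> 2 * R' * norm \<xi>" using mult_right_mono[OF s\<eta>, of "2 * norm \<xi>"] by (simp add: mult_ac)
        finally have 1: "norm (2 * \<sigma> * of_real (\<xi> \<bullet> \<eta>)) \<le> 2 * R' * norm \<xi>" .
        have "norm (\<sigma>\<^sup>2 * of_real (\<eta> \<bullet> \<eta>)) = (norm \<sigma> * norm \<eta>)\<^sup>2"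
          by (simp add: norm_mult norm_power power_mult_distrib power2_norm_eq_inner)
        also have "\<dots> \<le> R'\<^sup>2" using s\<eta> by (intro power_mono) auto
        finally show ?thesis using 1 norm_triangle_mono by blast
      qed
      have nQ: "norm (Q \<sigma> \<xi>) \<le> (norm \<xi> + R')\<^sup>2"
      proof -
        have "norm (Q \<sigma> \<xi>) \<le> norm (of_real (\<xi> \<bullet> \<xi>) :: complex) + (2 * R' * norm \<xi> + R'\<^sup>2)"
          unfolding Q_def add.assoc by (rule norm_triangle_mono[OF order_refl cs])
        then show ?thesis by (simp add: power2_sum dot_square_norm mult_ac norm_power)
      qed
      have p: "norm (P \<sigma> \<xi>) \<le> A * (2 * exp (1 + R' + norm \<xi>))"
      proof -
        have "norm (P \<sigma> \<xi>) \<le> A * (1 + norm \<xi> + norm \<sigma> * norm \<eta>)\<^sup>2" by (rule growth)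
        also have "(1 + norm \<xi> + norm \<sigma> * norm \<eta>)\<^sup>2 \<le> (1 + R' + norm \<xi>)\<^sup>2"
          using s\<eta> by (intro power_mono) (auto intro: add_nonneg_nonneg)
        also have "(1 + R' + norm \<xi>)\<^sup>2 \<le> 2 * exp (1 + R' + norm \<xi>)"
          using exp_lower_Taylor_quadratic[of "1 + R' + norm \<xi>"] R'0 norm_ge_zero[of \<xi>] by linarith
        finally show ?thesis using A0 by (simp add: mult_left_mono)
      qed
      have c: "norm (cosh_sqrt (of_real (y\<^sup>2) * Q \<sigma> \<xi>)) \<le> exp (\<bar>y\<bar> * (norm \<xi> + R'))"
      proof -
        have "norm (of_real (y\<^sup>2) * Q \<sigma> \<xi>) \<le> (\<bar>y\<bar> * (norm \<xi> + R'))\<^sup>2"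
          using nQ by (simp add: norm_mult power_mult_distrib norm_power mult_left_mono)
        then have "sqrt (norm (of_real (y\<^sup>2) * Q \<sigma> \<xi>)) \<le> \<bar>y\<bar> * (norm \<xi> + R')"
          using R'0 by (intro real_le_lsqrt) auto
        then show ?thesis using norm_cosh_sqrt_le order_trans exp_le_cancel_iff by blast
      qed
      have e: "norm (exp (- of_real (h / 4) * Q \<sigma> \<xi> + \<i> * (of_real (\<xi> \<bullet> x) + \<sigma> * of_real (\<eta> \<bullet> x))))
          \<le> exp (- (h / 4) * (norm \<xi>)\<^sup>2 + (h / 4) * (2 * R' * norm \<xi> + R'\<^sup>2) + R' * norm x)"
      proof -
        have a: "- (2 * R' * norm \<xi> + R'\<^sup>2) \<le> Re (2 * \<sigma> * of_real (\<xi> \<bullet> \<eta>) + \<sigma>\<^sup>2 * of_real (\<eta> \<bullet> \<eta>))"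
          using cs abs_Re_le_cmod abs_le_D2 order_trans minus_le_iff by (metis (no_types, lifting))
        have 1: "Re (- of_real (h / 4) * Q \<sigma> \<xi>) \<le> - (h / 4) * (norm \<xi>)\<^sup>2 + (h / 4) * (2 * R' * norm \<xi> + R'\<^sup>2)"
        proof -
          have "Re (- of_real (h / 4) * Q \<sigma> \<xi>) = - (h / 4) * (norm \<xi>)\<^sup>2 - (h / 4) * Re (2 * \<sigma> * of_real (\<xi> \<bullet> \<eta>) + \<sigma>\<^sup>2 * of_real (\<eta> \<bullet> \<eta>))"
            unfolding Q_def by (simp add: dot_square_norm algebra_simps)
          moreover have "(h / 4) * - (2 * R' * norm \<xi> + R'\<^sup>2) \<le> (h / 4) * Re (2 * \<sigma> * of_real (\<xi> \<bullet> \<eta>) + \<sigma>\<^sup>2 * of_real (\<eta> \<bullet> \<eta>))"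
            using a h by (intro mult_left_mono) auto
          ultimately show ?thesis by (simp only: mult_minus_right)
        qed
        have "norm (\<sigma> * of_real (\<eta> \<bullet> x)) \<le> norm \<sigma> * (norm \<eta> * norm x)"
          using Cauchy_Schwarz_ineq2[of \<eta> x] by (simp add: norm_mult mult_left_mono)
        also have "\<dots> \<le> R' * norm x" using mult_right_mono[OF s\<eta>, of "norm x"] by (simp add: mult_ac)
        finally have "norm (\<sigma> * of_real (\<eta> \<bullet> x)) \<le> R' * norm x" .
        then have "norm (\<i> * (\<sigma> * of_real (\<eta> \<bullet> x))) \<le> R' * norm x" by (simp add: norm_mult)
        from Re_le_of_norm[OF this]
        have "Re (\<i> * (of_real (\<xi> \<bullet> x) + \<sigma> * of_real (\<eta> \<bullet> x))) \<le> R' * norm x"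
          by (simp add: distrib_left)
        then show ?thesis using 1 by (simp only: norm_exp_eq_Re exp_le_cancel_iff plus_complex.sel)
      qed
      have "norm (F \<sigma> \<xi>) \<le> (A * (2 * exp (1 + R' + norm \<xi>))) * exp (\<bar>y\<bar> * (norm \<xi> + R')) *
          exp (- (h / 4) * (norm \<xi>)\<^sup>2 + (h / 4) * (2 * R' * norm \<xi> + R'\<^sup>2) + R' * norm x)"
        unfolding F_def norm_mult using A0 by (intro mult_mono p c e) auto
      also have "\<dots> = C * exp (- (h / 4) * (norm \<xi>)\<^sup>2 + N * norm \<xi>)"
        unfolding C_def N_def by (simp add: exp_add[symmetric] exp_diff[symmetric] algebra_simps)
      finally show ?thesis .
    qed
    moreover have "integrable lborel (\<lambda>\<xi>::'a. C * exp (- (h / 4) * (norm \<xi>)\<^sup>2 + N * norm \<xi>))"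
      using integrable_gaussian_exp[of "h / 4" N] h by auto
    ultimately show ?thesis by blast
  qed
  have "(\<lambda>\<sigma>. \<integral>\<xi>. F \<sigma> \<xi> \<partial>lborel) holomorphic_on UNIV"
    by (rule holomorphic_integral[OF holF _ dom]) simp
  moreover have "(\<integral>\<xi>. F (of_real s) \<xi> \<partial>lborel) = (\<integral>\<xi>. F 0 \<xi> \<partial>lborel)" for s
  proof -
    have Q: "Q (of_real s) \<xi> = Q 0 (\<xi> + s *\<^sub>R \<eta>)" for \<xi>
      unfolding Q_def
      by (simp add: complex_eq_iff inner_add_left inner_add_right inner_commute algebra_simps power2_eq_square)
    have "F (of_real s) \<xi> = F 0 (\<xi> + s *\<^sub>R \<eta>)" for \<xi>
      unfolding F_def Q shift by (simp add: inner_add_left algebra_simps)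
    then show ?thesis using integral_lborel_translate[OF meas[of 0], of "s *\<^sub>R \<eta>"] by simp
  qed
  ultimately have eq: "(\<integral>\<xi>. F \<i> \<xi> \<partial>lborel) = (\<integral>\<xi>. F 0 \<xi> \<partial>lborel)"
    by (rule entire_constant_on_reals)
  have F0: "F 0 \<xi> = P 0 \<xi> * cosh (of_real (norm \<xi> * y)) * exp (of_real (- (h / 4) * (norm \<xi>)\<^sup>2) + \<i> * of_real (\<xi> \<bullet> x))" for \<xi>
  proof -
    have "of_real (y\<^sup>2) * Q 0 \<xi> = (of_real (norm \<xi> * y))\<^sup>2"
      unfolding Q_def by (simp add: dot_square_norm power_mult_distrib)
    then show ?thesis unfolding F_def cosh_sqrt_power2[symmetric] by (simp add: Q_def dot_square_norm)
  qed
  have Fi: "F \<i> \<xi> = P \<i> \<xi> * cosh_sqrt (of_real (y\<^sup>2) * (of_real (\<xi> \<bullet> \<xi> - \<eta> \<bullet> \<eta>) + 2 * \<i> * of_real (\<xi> \<bullet> \<eta>)))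
            * of_real (exp (- (h / 4) * (norm \<xi>)\<^sup>2 - (norm x)\<^sup>2 / h))" for \<xi>
  proof -
    have q: "Q \<i> \<xi> = of_real (\<xi> \<bullet> \<xi> - \<eta> \<bullet> \<eta>) + 2 * \<i> * of_real (\<xi> \<bullet> \<eta>)" by (simp add: Q_def)
    have "- of_real (h / 4) * Q \<i> \<xi> + \<i> * (of_real (\<xi> \<bullet> x) + \<i> * of_real (\<eta> \<bullet> x)) = of_real (- (h / 4) * (norm \<xi>)\<^sup>2 - (norm x)\<^sup>2 / h)"
      unfolding q \<eta>_def using h by (simp add: complex_eq_iff dot_square_norm field_simps power2_eq_square)
    then have "exp (- of_real (h / 4) * Q \<i> \<xi> + \<i> * (of_real (\<xi> \<bullet> x) + \<i> * of_real (\<eta> \<bullet> x))) = of_real (exp (- (h / 4) * (norm \<xi>)\<^sup>2 - (norm x)\<^sup>2 / h))"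
      by (simp only: exp_of_real)
    then show ?thesis unfolding F_def q by simp
  qed
  show ?thesis using eq by (simp only: F0 Fi)
qed

lemma gaussian_contour_shift_bound:
  fixes x :: "'a::euclidean_space" and P :: "complex \<Rightarrow> 'a \<Rightarrow> complex" and h y A R \<kappa> \<gamma> :: real
  defines "\<eta> \<equiv> (2 / h) *\<^sub>R x"
  assumes h: "h > 0"
    and hol: "\<And>\<xi>. (\<lambda>\<sigma>. P \<sigma> \<xi>) holomorphic_on UNIV"
    and [measurable]: "\<And>\<sigma>. P \<sigma> \<in> borel_measurable borel"
    and shift: "\<And>s \<xi>. P (of_real s) \<xi> = P 0 (\<xi> + s *\<^sub>R \<eta>)"
    and growth: "\<And>\<sigma> \<xi>. norm (P \<sigma> \<xi>) \<le> A * (1 + norm \<xi> + norm \<sigma> * norm \<eta>)\<^sup>2"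
    and \<kappa>: "0 < \<kappa>" "\<kappa> \<le> 1 / 2" and R: "norm x \<le> R"
    and \<gamma>: "y\<^sup>2 * (1 + 2 * \<kappa>) \<le> (norm x)\<^sup>2 - \<gamma>"
  shows "norm (\<integral>\<xi>. P 0 \<xi> * cosh (of_real (norm \<xi> * y)) * exp (of_real (- (h / 4) * (norm \<xi>)\<^sup>2) + \<i> * of_real (\<xi> \<bullet> x)) \<partial>lborel)
       \<le> A * (1 + 2 * R / h)\<^sup>2 * (2 + 16 / (\<kappa> * h)) * sqrt (8 * pi / (\<kappa> * h)) ^ DIM('a) * exp (- \<gamma> / h)"
proof -
  define G where "G \<xi> = P \<i> \<xi> * cosh_sqrt (of_real (y\<^sup>2) * (of_real (\<xi> \<bullet> \<xi> - \<eta> \<bullet> \<eta>) + 2 * \<i> * of_real (\<xi> \<bullet> \<eta>)))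
            * of_real (exp (- (h / 4) * (norm \<xi>)\<^sup>2 - (norm x)\<^sup>2 / h))" for \<xi>
  define K where "K = A * (1 + 2 * R / h)\<^sup>2 * (2 + 16 / (\<kappa> * h)) * exp (- \<gamma> / h)"
  have [measurable]: "cosh_sqrt \<in> borel_measurable borel"
    using holomorphic_on_imp_continuous_on[OF holomorphic_cosh_sqrt] borel_measurable_continuous_onI by blast
  have [measurable]: "G \<in> borel_measurable borel" unfolding G_def by measurable
  have A0: "A \<ge> 0"
  proof -
    have "0 \<le> A * (1 + norm (0::'a) + norm (0::complex) * norm \<eta>)\<^sup>2"
      using order_trans[OF norm_ge_zero growth[of 0 0]] .
    then show ?thesis by simp
  qed
  have R0: "R \<ge> 0" using R norm_ge_zero order_trans by blast
  have bd: "norm (G \<xi>) \<le> K * exp (- (\<kappa> * h / 8) * (norm \<xi>)\<^sup>2)" for \<xi>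
  proof -
    have "norm \<eta> \<le> 2 * R / h" unfolding \<eta>_def using h R by (simp add: divide_right_mono)
    have "norm (P \<i> \<xi>) \<le> A * (1 + norm \<xi> + norm \<eta>)\<^sup>2" using growth[of \<i> \<xi>] by simp
    also have "\<dots> \<le> A * ((1 + 2 * R / h) * (1 + norm \<xi>))\<^sup>2"
    proof (intro mult_left_mono power_mono A0)
      have "(1 + 2 * R / h) * (1 + norm \<xi>) = 1 + norm \<xi> + 2 * R / h + (2 * R / h) * norm \<xi>" by (simp add: algebra_simps add_divide_distrib)
      moreover have "0 \<le> (2 * R / h) * norm \<xi>" using h R0 by simp
      ultimately show "1 + norm \<xi> + norm \<eta> \<le> (1 + 2 * R / h) * (1 + norm \<xi>)"
        using \<open>norm \<eta> \<le> 2 * R / h\<close> by linarith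
    qed auto
    also have "\<dots> = A * (1 + 2 * R / h)\<^sup>2 * (1 + norm \<xi>)\<^sup>2" by (simp add: power_mult_distrib)
    also have "(1 + norm \<xi>)\<^sup>2 \<le> (2 + 16 / (\<kappa> * h)) * exp ((\<kappa> * h / 8) * (norm \<xi>)\<^sup>2)"
    proof -
      have "0 \<le> (norm \<xi> - 1)\<^sup>2" by simp
      then have "(1 + norm \<xi>)\<^sup>2 \<le> 2 + 2 * (norm \<xi>)\<^sup>2" by (simp add: power2_eq_square algebra_simps)
      also have "\<dots> = 2 * 1 + 16 / (\<kappa> * h) * ((\<kappa> * h / 8) * (norm \<xi>)\<^sup>2)" using h \<kappa> by simp
      also have "\<dots> \<le> 2 * exp ((\<kappa> * h / 8) * (norm \<xi>)\<^sup>2) + 16 / (\<kappa> * h) * exp ((\<kappa> * h / 8) * (norm \<xi>)\<^sup>2)"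
      proof (intro add_mono mult_left_mono)
        show "(\<kappa> * h / 8) * (norm \<xi>)\<^sup>2 \<le> exp ((\<kappa> * h / 8) * (norm \<xi>)\<^sup>2)"
          using exp_ge_add_one_self[of "(\<kappa> * h / 8) * (norm \<xi>)\<^sup>2"] by linarith
      qed (use h \<kappa> in auto)
      finally show ?thesis by (simp add: algebra_simps)
    qed
    finally have p: "norm (P \<i> \<xi>) \<le> A * (1 + 2 * R / h)\<^sup>2 * ((2 + 16 / (\<kappa> * h)) * exp ((\<kappa> * h / 8) * (norm \<xi>)\<^sup>2))"
      using A0 by (simp add: mult_left_mono)
    have c: "norm (cosh_sqrt (of_real (y\<^sup>2) * (of_real (\<xi> \<bullet> \<xi> - \<eta> \<bullet> \<eta>) + 2 * \<i> * of_real (\<xi> \<bullet> \<eta>)))) \<le> exp (\<bar>y\<bar> * norm \<xi>)"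
    proof -
      define q :: complex where "q = of_real (\<xi> \<bullet> \<xi> - \<eta> \<bullet> \<eta>) + 2 * \<i> * of_real (\<xi> \<bullet> \<eta>)"
      have "norm q \<le> \<xi> \<bullet> \<xi> + \<eta> \<bullet> \<eta>"
      proof -
        have "(norm q)\<^sup>2 = (\<xi> \<bullet> \<xi> - \<eta> \<bullet> \<eta>)\<^sup>2 + (2 * (\<xi> \<bullet> \<eta>))\<^sup>2" unfolding q_def by (simp add: cmod_power2)
        also have "\<dots> \<le> (\<xi> \<bullet> \<xi> + \<eta> \<bullet> \<eta>)\<^sup>2"
          using Cauchy_Schwarz_ineq[of \<xi> \<eta>] by (simp add: power2_eq_square algebra_simps)
        finally show ?thesis by (rule power2_le_imp_le) simp
      qed
      then have "(norm q + Re q) / 2 \<le> (norm \<xi>)\<^sup>2" unfolding q_def by (simp add: dot_square_norm)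
      then have "y\<^sup>2 * ((norm q + Re q) / 2) \<le> y\<^sup>2 * (norm \<xi>)\<^sup>2" by (rule mult_left_mono) simp
      then have "(norm (of_real (y\<^sup>2) * q) + Re (of_real (y\<^sup>2) * q)) / 2 \<le> (\<bar>y\<bar> * norm \<xi>)\<^sup>2"
        by (simp add: norm_mult norm_power power_mult_distrib algebra_simps)
      then have "sqrt ((norm (of_real (y\<^sup>2) * q) + Re (of_real (y\<^sup>2) * q)) / 2) \<le> \<bar>y\<bar> * norm \<xi>"
        by (intro real_le_lsqrt) auto
      then show ?thesis unfolding q_def[symmetric] by (intro order_trans[OF norm_cosh_sqrt]) simp
    qed
    have e: "\<bar>y\<bar> * norm \<xi> + (- (h / 4) * (norm \<xi>)\<^sup>2 - (norm x)\<^sup>2 / h) \<le> - \<gamma> / h - (\<kappa> * h / 4) * (norm \<xi>)\<^sup>2"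
    proof -
      have "h * (\<bar>y\<bar> * norm \<xi>) \<le> y\<^sup>2 * (1 + 2 * \<kappa>) + (1 - \<kappa>) * (h\<^sup>2 / 4) * (norm \<xi>)\<^sup>2"
      proof -
        define K' e where "K' = 1 + 2 * \<kappa>" and "e = h * norm \<xi>"
        have "1 \<le> (1 - \<kappa>) * K'"
          using mult_nonneg_nonneg[of \<kappa> "1 - 2 * \<kappa>"] \<kappa> by (simp add: K'_def algebra_simps)
        from mult_right_mono[OF this, of "e\<^sup>2"] have "e\<^sup>2 \<le> (1 - \<kappa>) * K' * e\<^sup>2" by simp
        moreover have "0 \<le> (2 * K' * \<bar>y\<bar> - e)\<^sup>2" by simp
        ultimately have "K' * (4 * (\<bar>y\<bar> * e)) \<le> K' * (4 * (K' * y\<^sup>2) + (1 - \<kappa>) * e\<^sup>2)"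
          by (simp add: power2_eq_square algebra_simps)
        then have "4 * (\<bar>y\<bar> * e) \<le> 4 * (K' * y\<^sup>2) + (1 - \<kappa>) * e\<^sup>2"
          using \<kappa> by (simp add: K'_def)
        then have "\<bar>y\<bar> * e \<le> y\<^sup>2 * K' + (1 - \<kappa>) * e\<^sup>2 / 4" by (simp add: mult.commute)
        moreover have "(1 - \<kappa>) * e\<^sup>2 / 4 = (1 - \<kappa>) * (h\<^sup>2 / 4) * (norm \<xi>)\<^sup>2"
          by (simp add: e_def power_mult_distrib)
        ultimately have "\<bar>y\<bar> * e \<le> y\<^sup>2 * K' + (1 - \<kappa>) * (h\<^sup>2 / 4) * (norm \<xi>)\<^sup>2" by simp
        then show ?thesis by (simp add: K'_def e_def mult_ac)
      qed
      also have "\<dots> \<le> (norm x)\<^sup>2 - \<gamma> + (1 - \<kappa>) * (h\<^sup>2 / 4) * (norm \<xi>)\<^sup>2" using \<gamma> by simp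
      finally have "\<bar>y\<bar> * norm \<xi> \<le> ((norm x)\<^sup>2 - \<gamma> + (1 - \<kappa>) * (h\<^sup>2 / 4) * (norm \<xi>)\<^sup>2) / h"
        using h by (simp add: pos_le_divide_eq mult_ac)
      also have "\<dots> = (norm x)\<^sup>2 / h - \<gamma> / h + (h / 4) * (norm \<xi>)\<^sup>2 - (\<kappa> * h / 4) * (norm \<xi>)\<^sup>2"
        using h by (simp add: field_simps power2_eq_square)
      finally show ?thesis by simp
    qed
    have "norm (G \<xi>) \<le> A * (1 + 2 * R / h)\<^sup>2 * ((2 + 16 / (\<kappa> * h)) * exp ((\<kappa> * h / 8) * (norm \<xi>)\<^sup>2)) * exp (\<bar>y\<bar> * norm \<xi>)
        * exp (- (h / 4) * (norm \<xi>)\<^sup>2 - (norm x)\<^sup>2 / h)"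
      unfolding G_def norm_mult norm_of_real abs_exp_cancel
      using A0 h \<kappa> R0 by (intro mult_mono p c mult_nonneg_nonneg) auto
    also have "\<dots> = A * (1 + 2 * R / h)\<^sup>2 * (2 + 16 / (\<kappa> * h)) * (exp ((\<kappa> * h / 8) * (norm \<xi>)\<^sup>2) * exp (\<bar>y\<bar> * norm \<xi> + (- (h / 4) * (norm \<xi>)\<^sup>2 - (norm x)\<^sup>2 / h)))"
      by (simp only: exp_add mult_ac)
    also have "\<dots> \<le> A * (1 + 2 * R / h)\<^sup>2 * (2 + 16 / (\<kappa> * h)) * (exp ((\<kappa> * h / 8) * (norm \<xi>)\<^sup>2) * exp (- \<gamma> / h - (\<kappa> * h / 4) * (norm \<xi>)\<^sup>2))"
      using A0 h \<kappa> R0 e by (intro mult_left_mono mult_nonneg_nonneg) auto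
    also have "exp ((\<kappa> * h / 8) * (norm \<xi>)\<^sup>2) * exp (- \<gamma> / h - (\<kappa> * h / 4) * (norm \<xi>)\<^sup>2) = exp (- \<gamma> / h) * exp (- (\<kappa> * h / 8) * (norm \<xi>)\<^sup>2)"
      unfolding exp_add[symmetric] by (rule arg_cong[where f=exp]) (simp add: algebra_simps)
    finally show ?thesis by (simp add: K_def mult_ac)
  qed
  have gi: "has_bochner_integral lborel (\<lambda>\<xi>::'a. K * exp (- (\<kappa> * h / 8) * (norm \<xi>)\<^sup>2)) (K * sqrt (pi / (\<kappa> * h / 8)) ^ DIM('a))"
    using h \<kappa> by (intro has_bochner_integral_mult_right gaussian_euclidean) simp
  then have gint: "integrable lborel (\<lambda>\<xi>::'a. K * exp (- (\<kappa> * h / 8) * (norm \<xi>)\<^sup>2))" by (rule integrable.intros)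
  have "norm (\<integral>\<xi>. G \<xi> \<partial>lborel) \<le> (\<integral>\<xi>. K * exp (- (\<kappa> * h / 8) * (norm \<xi>)\<^sup>2) \<partial>(lborel :: 'a measure))"
  proof (rule Bochner_Integration.integral_norm_bound_integral)
    show "integrable lborel G"
      by (rule Bochner_Integration.integrable_bound[OF gint], simp, rule AE_I2)
        (unfold real_norm_def, rule order_trans[OF bd abs_ge_self])
  qed (use gint bd in auto)
  also have "\<dots> = K * sqrt (pi / (\<kappa> * h / 8)) ^ DIM('a)" using gi by (simp add: has_bochner_integral_iff)
  also have "pi / (\<kappa> * h / 8) = 8 * pi / (\<kappa> * h)" by simp
  finally have "norm (\<integral>\<xi>. G \<xi> \<partial>lborel) \<le> K * sqrt (8 * pi / (\<kappa> * h)) ^ DIM('a)" .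
  moreover have "(\<integral>\<xi>. P 0 \<xi> * cosh (of_real (norm \<xi> * y)) * exp (of_real (- (h / 4) * (norm \<xi>)\<^sup>2) + \<i> * of_real (\<xi> \<bullet> x)) \<partial>lborel)
     = (\<integral>\<xi>. G \<xi> \<partial>lborel)"
    unfolding G_def \<eta>_def
    by (rule gaussian_contour_shift[OF h hol _ shift[unfolded \<eta>_def] growth[unfolded \<eta>_def]]) measurable
  ultimately show ?thesis by (simp add: K_def mult_ac)
qed

subsection \<open>The harmonic extension of a Gaussian\<close>

definition plane_exp :: "'a::euclidean_space \<Rightarrow> 'a \<times> real \<Rightarrow> complex" where
  "plane_exp \<xi> z = of_real (norm \<xi> * snd z) + \<i> * of_real (\<xi> \<bullet> fst z)"

definition gauss_amp :: "real \<Rightarrow> 'a::euclidean_space \<Rightarrow> complex" where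
  "gauss_amp h \<xi> = of_real ((1 / (2 * pi)) ^ DIM('a) * exp (- (h / 4) * (norm \<xi>)\<^sup>2))"

definition reflect :: "'a \<times> real \<Rightarrow> 'a \<times> real" where
  "reflect z = (fst z, - snd z)"

interpretation harm: exp_superposition lborel "plane_exp :: 'a::euclidean_space \<Rightarrow> _" "\<lambda>\<xi>. 2 * norm \<xi>"
proof (rule exp_superposition.intro)
  show "linear (plane_exp \<xi>)" for \<xi> :: 'a
    by (rule linearI) (simp_all add: plane_exp_def algebra_simps scaleR_conv_of_real inner_add_right)
  show "norm (plane_exp \<xi> z) \<le> 2 * norm \<xi> * norm z" for \<xi> :: 'a and z
  proof -
    have "norm (plane_exp \<xi> z) \<le> norm \<xi> * \<bar>snd z\<bar> + \<bar>\<xi> \<bullet> fst z\<bar>"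
      unfolding plane_exp_def
      by (rule order_trans[OF norm_triangle_ineq]) (simp add: norm_mult abs_mult)
    also have "\<dots> \<le> norm \<xi> * norm z + norm \<xi> * norm z"
    proof (rule add_mono)
      show "norm \<xi> * \<bar>snd z\<bar> \<le> norm \<xi> * norm z"
        using norm_snd_le[of "snd z" "fst z"] by (intro mult_left_mono) auto
      have "\<bar>\<xi> \<bullet> fst z\<bar> \<le> norm \<xi> * norm (fst z)" by (rule Cauchy_Schwarz_ineq2)
      also have "\<dots> \<le> norm \<xi> * norm z"
        using norm_fst_le[of "fst z" "snd z"] by (intro mult_left_mono) auto
      finally show "\<bar>\<xi> \<bullet> fst z\<bar> \<le> norm \<xi> * norm z" .
    qed
    finally show ?thesis by simp
  qed
  show "(\<lambda>s. plane_exp s z) \<in> borel_measurable lborel" for z :: "'a \<times> real" unfolding plane_exp_def by measurable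
qed auto

lemma gauss_amp_measurable[measurable]: "gauss_amp h \<in> borel_measurable borel"
  unfolding gauss_amp_def[abs_def] by measurable

lemma gauss_amp_amplitude: "h > 0 \<Longrightarrow> harm.amplitude (gauss_amp h)"
  unfolding harm.amplitude_def
proof (intro conjI allI)
  fix N :: nat assume h: "h > 0"
  have "integrable lborel (\<lambda>\<xi>::'a. (1 / (2 * pi)) ^ DIM('a) * exp (- (h / 4) * (norm \<xi>)\<^sup>2 + real (2 * N) * norm \<xi>))"
    using h by (intro integrable_mult_right integrable_gaussian_exp) simp
  also have "(\<lambda>\<xi>::'a. (1 / (2 * pi)) ^ DIM('a) * exp (- (h / 4) * (norm \<xi>)\<^sup>2 + real (2 * N) * norm \<xi>))
      = (\<lambda>\<xi>. norm (gauss_amp h \<xi>) * exp (real N * (2 * norm \<xi>)))"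
    unfolding exp_add by (simp add: gauss_amp_def fun_eq_iff norm_mult norm_power norm_divide mult_ac)
  finally show "integrable lborel (\<lambda>\<xi>::'a. norm (gauss_amp h \<xi>) * exp (real N * (2 * norm \<xi>)))" .
qed simp

definition Phi_deriv :: "real \<Rightarrow> ('a::euclidean_space \<times> real) list \<Rightarrow> 'a \<times> real \<Rightarrow> real" where
  "Phi_deriv h vs z = (1 / 2) * (Re (harm.superpos (\<lambda>\<xi>. gauss_amp h \<xi> * (\<Prod>v\<leftarrow>vs. plane_exp \<xi> v)) z)
     + Re (harm.superpos (\<lambda>\<xi>. gauss_amp h \<xi> * (\<Prod>v\<leftarrow>map reflect vs. plane_exp \<xi> v)) (reflect z)))"

abbreviation Phi :: "real \<Rightarrow> 'a::euclidean_space \<times> real \<Rightarrow> real" where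
  "Phi h \<equiv> Phi_deriv h []"

lemma Phi_deriv_family:
  assumes "h > 0"
  shows "deriv_family_on UNIV (Phi h :: 'a::euclidean_space \<times> real \<Rightarrow> real) (Phi_deriv h)"
proof -
  have L: "bounded_linear (reflect :: 'a \<times> real \<Rightarrow> _)"
    unfolding reflect_def[abs_def] by (intro bounded_linear_Pair bounded_linear_minus bounded_linear_fst bounded_linear_snd)
  note F = harm.superpos_deriv_family[OF gauss_amp_amplitude[OF assms], where ?'a='a]
  have "deriv_family_on UNIV (\<lambda>z. (1/2) * (Re (harm.superpos (gauss_amp h) z) + Re (harm.superpos (gauss_amp h) (reflect z))))
     (Phi_deriv h :: ('a \<times> real) list \<Rightarrow> _)"
    using deriv_family_on_cmult[OF deriv_family_on_add[OF F deriv_family_on_linear[OF F L]], of "1/2"]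
    by (simp add: Phi_deriv_def[abs_def])
  then show ?thesis by (simp add: Phi_deriv_def[abs_def])
qed

lemma Phi_deriv_has_derivative:
  "h > 0 \<Longrightarrow> (Phi_deriv h vs has_derivative (\<lambda>v. Phi_deriv h (v # vs) z)) (at z)"
  using Phi_deriv_family[of h] unfolding deriv_family_on_def by blast

lemma Phi_deriv_continuous: "h > 0 \<Longrightarrow> continuous_on S (Phi_deriv h vs)"
  by (meson Phi_deriv_has_derivative continuous_at_imp_continuous_on has_derivative_continuous)

lemma Phi_deriv_cosh:
  assumes h: "h > 0" and even: "\<And>\<xi>. (\<Prod>v\<leftarrow>map reflect vs. plane_exp \<xi> v) = (\<Prod>v\<leftarrow>vs. plane_exp \<xi> v)"
  shows "Phi_deriv h vs (x, y) = Re (\<integral>\<xi>. (of_real ((1 / (2 * pi)) ^ DIM('a)) * (\<Prod>v\<leftarrow>vs. plane_exp \<xi> v)) * cosh (of_real (norm \<xi> * y))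
      * exp (of_real (- (h / 4) * (norm \<xi>)\<^sup>2) + \<i> * of_real (\<xi> \<bullet> x)) \<partial>(lborel :: 'a::euclidean_space measure))"
proof -
  let ?a = "\<lambda>\<xi>. gauss_amp h \<xi> * (\<Prod>v\<leftarrow>vs. plane_exp \<xi> v)"
  note int = harm.superpos_integrable[OF harm.amplitude_prod[OF gauss_amp_amplitude[OF h]], of vs]
  have "Phi_deriv h vs (x, y) = Re ((\<integral>\<xi>. ?a \<xi> * exp (plane_exp \<xi> (x, y)) \<partial>lborel) + (\<integral>\<xi>. ?a \<xi> * exp (plane_exp \<xi> (x, - y)) \<partial>lborel)) / 2"
    unfolding Phi_deriv_def even harm.superpos_def by (simp add: reflect_def)
  also have "\<dots> = Re ((\<integral>\<xi>. ?a \<xi> * exp (plane_exp \<xi> (x, y)) + ?a \<xi> * exp (plane_exp \<xi> (x, - y)) \<partial>lborel) / 2)"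
    by (subst Bochner_Integration.integral_add[OF int int]) simp
  also have "(\<integral>\<xi>. ?a \<xi> * exp (plane_exp \<xi> (x, y)) + ?a \<xi> * exp (plane_exp \<xi> (x, - y)) \<partial>lborel) / 2
     = (\<integral>\<xi>. (?a \<xi> * exp (plane_exp \<xi> (x, y)) + ?a \<xi> * exp (plane_exp \<xi> (x, - y))) / 2 \<partial>lborel)"
    by simp
  also have "(\<lambda>\<xi>. (?a \<xi> * exp (plane_exp \<xi> (x, y)) + ?a \<xi> * exp (plane_exp \<xi> (x, - y))) / 2)
     = (\<lambda>\<xi>. (of_real ((1 / (2 * pi)) ^ DIM('a)) * (\<Prod>v\<leftarrow>vs. plane_exp \<xi> v)) * cosh (of_real (norm \<xi> * y))
      * exp (of_real (- (h / 4) * (norm \<xi>)\<^sup>2) + \<i> * of_real (\<xi> \<bullet> x)))"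
    unfolding gauss_amp_def plane_exp_def[of _ "(_, _)"] cosh_def fun_eq_iff fst_conv snd_conv
      mult_minus_right of_real_minus exp_add of_real_mult exp_of_real[symmetric] scaleR_conv_of_real
    by (simp add: field_simps)
  finally show ?thesis .
qed

lemma Phi_deriv_single: "h > 0 \<Longrightarrow> Phi_deriv h [(b, 0)] (x, y) = Re (\<integral>\<xi>. (of_real ((1 / (2 * pi)) ^ DIM('a)) * (\<i> * of_real (\<xi> \<bullet> b))) * cosh (of_real (norm \<xi> * y))
      * exp (of_real (- (h / 4) * (norm \<xi>)\<^sup>2) + \<i> * of_real (\<xi> \<bullet> x)) \<partial>(lborel :: 'a::euclidean_space measure))"
  by (subst Phi_deriv_cosh) (simp_all add: reflect_def plane_exp_def)

lemma Phi_deriv_yy: "h > 0 \<Longrightarrow> Phi_deriv h [(0, 1), (0, 1)] (x, y) = Re (\<integral>\<xi>. (of_real ((1 / (2 * pi)) ^ DIM('a)) * of_real (\<xi> \<bullet> \<xi>)) * cosh (of_real (norm \<xi> * y))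
      * exp (of_real (- (h / 4) * (norm \<xi>)\<^sup>2) + \<i> * of_real (\<xi> \<bullet> x)) \<partial>(lborel :: 'a::euclidean_space measure))"
  by (subst Phi_deriv_cosh) (simp_all add: reflect_def plane_exp_def dot_square_norm power2_eq_square)

lemma Phi_cosh: "h > 0 \<Longrightarrow> Phi h (x, y) = Re (\<integral>\<xi>. of_real ((1 / (2 * pi)) ^ DIM('a)) * cosh (of_real (norm \<xi> * y))
      * exp (of_real (- (h / 4) * (norm \<xi>)\<^sup>2) + \<i> * of_real (\<xi> \<bullet> x)) \<partial>(lborel :: 'a::euclidean_space measure))"
  by (subst Phi_deriv_cosh) simp_all

lemma sum_Basis_prod:
  "(\<Sum>b\<in>(Basis :: ('a::euclidean_space \<times> real) set). f b) = (\<Sum>b\<in>Basis. f (b, 0)) + f (0, 1)"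
proof -
  have B: "(Basis :: ('a \<times> real) set) = insert (0, 1) ((\<lambda>b. (b, 0)) ` Basis)" by (auto simp: Basis_prod_def)
  have "(\<Sum>b\<in>(Basis :: ('a \<times> real) set). f b) = sum f ((\<lambda>b. (b, 0)) ` Basis) + f (0, 1)"
    unfolding B by (subst sum.insert) (auto simp: add.commute)
  then show ?thesis by (simp add: sum.reindex inj_on_def)
qed

lemma Phi_harmonic:
  assumes h: "h > 0"
  shows "(\<Sum>b\<in>(Basis :: ('a::euclidean_space \<times> real) set). Phi_deriv h [b, b] z) = 0"
proof -
  have zero: "(\<Sum>b\<in>(Basis :: ('a \<times> real) set). plane_exp \<xi> b * plane_exp \<xi> b) = 0" for \<xi> :: 'a
  proof -
    have "norm \<xi> * norm \<xi> = (\<Sum>b\<in>Basis. (\<xi> \<bullet> b) * (\<xi> \<bullet> b))"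
      using euclidean_inner[of \<xi> \<xi>] by (simp add: dot_square_norm power2_eq_square)
    then show ?thesis
      unfolding sum_Basis_prod by (simp add: plane_exp_def complex_eq_iff sum_negf)
  qed
  have zero': "(\<Sum>b\<in>(Basis :: ('a \<times> real) set). plane_exp \<xi> (reflect b) * plane_exp \<xi> (reflect b)) = 0" for \<xi> :: 'a
  proof -
    have "(\<Sum>b\<in>(Basis :: ('a \<times> real) set). plane_exp \<xi> (reflect b) * plane_exp \<xi> (reflect b)) = (\<Sum>b\<in>(Basis :: ('a \<times> real) set). plane_exp \<xi> b * plane_exp \<xi> b)"
      unfolding sum_Basis_prod by (simp add: plane_exp_def reflect_def)
    then show ?thesis by (simp add: zero)
  qed
  have amp: "harm.amplitude (\<lambda>\<xi>. gauss_amp h \<xi> * (plane_exp \<xi> v * plane_exp \<xi> v))" for v :: "'a \<times> real"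
    using harm.amplitude_prod[OF gauss_amp_amplitude[OF h], of "[v, v]"] by simp
  have "(\<Sum>b\<in>(Basis :: ('a \<times> real) set). Phi_deriv h [b, b] z)
     = (1 / 2) * (Re (\<Sum>b\<in>(Basis :: ('a \<times> real) set). harm.superpos (\<lambda>\<xi>. gauss_amp h \<xi> * (plane_exp \<xi> b * plane_exp \<xi> b)) z)
     + Re (\<Sum>b\<in>(Basis :: ('a \<times> real) set). harm.superpos (\<lambda>\<xi>. gauss_amp h \<xi> * (plane_exp \<xi> (reflect b) * plane_exp \<xi> (reflect b))) (reflect z)))"
    unfolding Phi_deriv_def by (simp add: sum.distrib sum_divide_distrib[symmetric])
  also have "(\<Sum>b\<in>(Basis :: ('a \<times> real) set). harm.superpos (\<lambda>\<xi>. gauss_amp h \<xi> * (plane_exp \<xi> b * plane_exp \<xi> b)) z) = 0"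
    by (subst harm.superpos_sum) (simp_all add: amp sum_distrib_left[symmetric] zero harm.superpos_def)
  also have "(\<Sum>b\<in>(Basis :: ('a \<times> real) set). harm.superpos (\<lambda>\<xi>. gauss_amp h \<xi> * (plane_exp \<xi> (reflect b) * plane_exp \<xi> (reflect b))) (reflect z)) = 0"
    by (subst harm.superpos_sum) (simp_all add: amp sum_distrib_left[symmetric] zero' harm.superpos_def)
  also have "(1 / 2) * (Re 0 + Re 0) = 0" by simp
  finally show ?thesis .
qed

lemma Phi_deriv_y_zero: "Phi_deriv h [(0, 1)] (x, 0) = 0"
proof -
  have "gauss_amp h \<xi> * plane_exp \<xi> (0, -1) = - (gauss_amp h \<xi> * plane_exp \<xi> (0, 1))" for \<xi> :: 'a
    by (simp add: plane_exp_def)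
  then show ?thesis by (simp add: Phi_deriv_def reflect_def harm.superpos_def)
qed

lemma Phi_initial:
  fixes x :: "'a::euclidean_space"
  assumes h: "h > 0"
  shows "Phi h (x, 0) = (pi * h) powr (- real DIM('a) / 2) * exp (- (norm x)\<^sup>2 / h)"
proof -
  let ?c = "(1 / (2 * pi)) ^ DIM('a)"
  have "Phi h (x, 0) = Re (\<integral>\<xi>. of_real ?c * cosh (of_real (norm \<xi> * 0)) * exp (of_real (- (h / 4) * (norm \<xi>)\<^sup>2) + \<i> * of_real (\<xi> \<bullet> x)) \<partial>lborel)"
    using Phi_cosh[OF h] .
  also have "(\<integral>\<xi>. of_real ?c * cosh (of_real (norm \<xi> * 0)) * exp (of_real (- (h / 4) * (norm \<xi>)\<^sup>2) + \<i> * of_real (\<xi> \<bullet> x)) \<partial>lborel)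
    = (\<integral>\<xi>. of_real ?c * cosh_sqrt (of_real (0\<^sup>2) * (of_real (\<xi> \<bullet> \<xi> - ((2 / h) *\<^sub>R x) \<bullet> ((2 / h) *\<^sub>R x)) + 2 * \<i> * of_real (\<xi> \<bullet> ((2 / h) *\<^sub>R x))))
            * of_real (exp (- (h / 4) * (norm \<xi>)\<^sup>2 - (norm x)\<^sup>2 / h)) \<partial>lborel)"
  proof (rule gaussian_contour_shift[OF h, where A="?c"])
    fix \<sigma> :: complex and \<xi> :: 'a
    have "(1::real) \<le> (1 + norm \<xi> + norm \<sigma> * norm ((2 / h) *\<^sub>R x))\<^sup>2" using h by (simp add: one_le_power)
    from mult_left_mono[OF this, of ?c]
    show "norm (of_real ?c :: complex) \<le> ?c * (1 + norm \<xi> + norm \<sigma> * norm ((2 / h) *\<^sub>R x))\<^sup>2"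
      by (simp add: norm_power norm_divide)
  qed (auto intro!: holomorphic_intros)
  also have "\<dots> = (\<integral>\<xi>. of_real (?c * exp (- (norm x)\<^sup>2 / h) * exp (- (h / 4) * (norm \<xi>)\<^sup>2)) \<partial>(lborel :: 'a measure))"
  proof (intro Bochner_Integration.integral_cong refl)
    fix \<xi> :: 'a
    have "exp (- (h / 4) * (norm \<xi>)\<^sup>2 - (norm x)\<^sup>2 / h) = exp (- (norm x)\<^sup>2 / h) * exp (- (h / 4) * (norm \<xi>)\<^sup>2)"
      by (simp add: exp_add[symmetric])
    then show "of_real ?c * cosh_sqrt (of_real (0\<^sup>2) * (of_real (\<xi> \<bullet> \<xi> - ((2 / h) *\<^sub>R x) \<bullet> ((2 / h) *\<^sub>R x)) + 2 * \<i> * of_real (\<xi> \<bullet> ((2 / h) *\<^sub>R x))))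
            * of_real (exp (- (h / 4) * (norm \<xi>)\<^sup>2 - (norm x)\<^sup>2 / h))
        = (of_real (?c * exp (- (norm x)\<^sup>2 / h) * exp (- (h / 4) * (norm \<xi>)\<^sup>2)) :: complex)"
      by (simp only: of_real_mult) (simp add: cosh_sqrt_def)
  qed
  also have "\<dots> = of_real (?c * exp (- (norm x)\<^sup>2 / h) * sqrt (pi / (h / 4)) ^ DIM('a))"
    using gaussian_euclidean[of "h / 4", where 'a='a] h by (simp add: has_bochner_integral_iff)
  also have "Re \<dots> = (?c * sqrt (pi / (h / 4)) ^ DIM('a)) * exp (- (norm x)\<^sup>2 / h)" by simp
  also have "?c * sqrt (pi / (h / 4)) ^ DIM('a) = (1 / sqrt (pi * h)) ^ DIM('a)"
    unfolding power_mult_distrib[symmetric] using h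
    by (intro arg_cong[where f="\<lambda>t. t ^ DIM('a)"]) (simp add: real_sqrt_divide real_sqrt_mult field_simps)
  also have "\<dots> = (pi * h) powr (- real DIM('a) / 2)"
  proof -
    have "1 / sqrt (pi * h) = (pi * h) powr (- 1 / 2)"
      using h by (simp add: powr_minus_divide powr_half_sqrt[symmetric])
    then show ?thesis using h by (simp add: powr_realpow[symmetric] powr_powr)
  qed
  finally show ?thesis .
qed

lemma exp_neg_inverse_tendsto_0:
  fixes K \<gamma> :: real
  assumes "\<gamma> > 0"
  shows "((\<lambda>h. K / h ^ n * exp (- \<gamma> / h)) \<longlongrightarrow> 0) (at_right 0)"
proof -
  have "((\<lambda>t. t ^ n / exp t) \<longlongrightarrow> (0::real)) at_top" by (rule tendsto_power_div_exp_0)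
  moreover have "filterlim (\<lambda>h. \<gamma> * inverse h) at_top (at_right (0::real))"
    by (intro filterlim_tendsto_pos_mult_at_top[OF tendsto_const assms] filterlim_inverse_at_top_right)
  ultimately have "((\<lambda>h. (\<gamma> * inverse h) ^ n / exp (\<gamma> * inverse h)) \<longlongrightarrow> 0) (at_right 0)"
    by (rule filterlim_compose)
  from tendsto_mult_right_zero[OF this, of "K / \<gamma> ^ n"]
  show ?thesis using assms
    by (simp add: exp_minus field_simps power_mult_distrib power_divide)
qed

lemma Phi_decay:
  fixes R \<delta> :: real
  assumes \<delta>: "\<delta> > 0"
  obtains \<epsilon> :: "real \<Rightarrow> real" where "(\<epsilon> \<longlongrightarrow> 0) (at_right 0)"
    and "\<And>h (x::'a::euclidean_space) y. 0 < h \<Longrightarrow> h \<le> 1 \<Longrightarrow> norm x \<le> R \<Longrightarrow> \<bar>y\<bar> \<le> norm x - \<delta> \<Longrightarrow> \<bar>Phi h (x, y)\<bar> \<le> \<epsilon> h"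
    and "\<And>h (x::'a::euclidean_space) y b. 0 < h \<Longrightarrow> h \<le> 1 \<Longrightarrow> norm x \<le> R \<Longrightarrow> \<bar>y\<bar> \<le> norm x - \<delta> \<Longrightarrow> b \<in> Basis \<Longrightarrow> \<bar>Phi_deriv h [(b, 0)] (x, y)\<bar> \<le> \<epsilon> h"
    and "\<And>h (x::'a::euclidean_space) y. 0 < h \<Longrightarrow> h \<le> 1 \<Longrightarrow> norm x \<le> R \<Longrightarrow> \<bar>y\<bar> \<le> norm x - \<delta> \<Longrightarrow> \<bar>Phi_deriv h [(0, 1), (0, 1)] (x, y)\<bar> \<le> \<epsilon> h"
proof -
  define \<kappa> where "\<kappa> = min (1 / 2) (\<delta>\<^sup>2 / (4 * (R\<^sup>2 + 1)))"
  have pos: "0 < 4 * (R\<^sup>2 + 1)" by (intro mult_pos_pos add_nonneg_pos) auto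
  have \<kappa>: "0 < \<kappa>" "\<kappa> \<le> 1 / 2" "\<kappa> \<le> \<delta>\<^sup>2 / (4 * (R\<^sup>2 + 1))"
    unfolding \<kappa>_def using \<delta> pos by (simp_all only: min.cobounded1 min.cobounded2) simp
  define c :: real where "c = (1 / (2 * pi)) ^ DIM('a)"
  have c0: "c \<ge> 0" by (simp add: c_def)
  define E where "E h = c * (1 + 2 * \<bar>R\<bar> / h)\<^sup>2 * (2 + 16 / (\<kappa> * h)) * sqrt (8 * pi / (\<kappa> * h)) ^ DIM('a) * exp (- (\<delta>\<^sup>2 / 2) / h)" for h
  define C where "C = c * (1 + 2 * \<bar>R\<bar>)\<^sup>2 * (2 + 16 / \<kappa>) * (1 + 8 * pi / \<kappa>) ^ DIM('a)"
  have E_le: "E h \<le> C / h ^ (3 + DIM('a)) * exp (- (\<delta>\<^sup>2 / 2) / h)" "0 \<le> E h" if "0 < h" "h \<le> 1" for h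
  proof -
    show "0 \<le> E h" unfolding E_def using that \<kappa> c0 by (intro mult_nonneg_nonneg) auto
    have h1: "1 \<le> 1 / h" using that by simp
    have a: "(1 + 2 * \<bar>R\<bar> / h)\<^sup>2 \<le> ((1 + 2 * \<bar>R\<bar>) / h)\<^sup>2"
      using that h1 by (intro power_mono) (auto simp: add_divide_distrib)
    have b: "2 + 16 / (\<kappa> * h) \<le> (2 + 16 / \<kappa>) / h"
      using that mult_left_mono[OF h1, of 2] \<kappa> by (simp add: add_divide_distrib)
    have "sqrt (8 * pi / (\<kappa> * h)) \<le> 1 + 8 * pi / (\<kappa> * h)"
    proof (rule real_le_lsqrt)
      show "8 * pi / (\<kappa> * h) \<le> (1 + 8 * pi / (\<kappa> * h))\<^sup>2"
      proof -
        have "q \<le> (1 + q)\<^sup>2" if "0 \<le> q" for q :: real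
          using that zero_le_power2[of q] by (simp add: power2_sum)
        then show ?thesis using that \<kappa> by simp
      qed
    qed (use that \<kappa> in auto)
    also have "\<dots> \<le> (1 + 8 * pi / \<kappa>) / h" using that h1 \<kappa> by (simp add: add_divide_distrib)
    finally have d: "sqrt (8 * pi / (\<kappa> * h)) ^ DIM('a) \<le> ((1 + 8 * pi / \<kappa>) / h) ^ DIM('a)"
      using that \<kappa> by (intro power_mono) auto
    have "E h \<le> c * ((1 + 2 * \<bar>R\<bar>) / h)\<^sup>2 * ((2 + 16 / \<kappa>) / h) * ((1 + 8 * pi / \<kappa>) / h) ^ DIM('a) * exp (- (\<delta>\<^sup>2 / 2) / h)"
      unfolding E_def using that \<kappa> c0 by (intro mult_mono a b d order_refl mult_nonneg_nonneg) auto
    also have "\<dots> = C / h ^ (3 + DIM('a)) * exp (- (\<delta>\<^sup>2 / 2) / h)"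
      using that by (simp add: C_def power_divide power_add power2_eq_square power3_eq_cube)
    finally show "E h \<le> C / h ^ (3 + DIM('a)) * exp (- (\<delta>\<^sup>2 / 2) / h)" .
  qed
  have lim: "(E \<longlongrightarrow> 0) (at_right 0)"
  proof (rule tendsto_sandwich)
    have ev: "\<forall>\<^sub>F h::real in at_right 0. 0 < h \<and> h \<le> 1"
      by (auto simp: eventually_at_right_field intro!: exI[of _ 1])
    show "\<forall>\<^sub>F h in at_right 0. 0 \<le> E h" using ev by eventually_elim (use E_le in auto)
    show "\<forall>\<^sub>F h in at_right 0. E h \<le> C / h ^ (3 + DIM('a)) * exp (- (\<delta>\<^sup>2 / 2) / h)"
      using ev by eventually_elim (use E_le in auto)
    show "((\<lambda>h. C / h ^ (3 + DIM('a)) * exp (- (\<delta>\<^sup>2 / 2) / h)) \<longlongrightarrow> 0) (at_right 0)"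
      using \<delta> by (intro exp_neg_inverse_tendsto_0) simp
  qed simp
  have bound: "\<bar>Re (\<integral>\<xi>. P 0 \<xi> * cosh (of_real (norm \<xi> * y)) * exp (of_real (- (h / 4) * (norm \<xi>)\<^sup>2) + \<i> * of_real (\<xi> \<bullet> x)) \<partial>lborel)\<bar> \<le> E h"
    if h: "0 < h" "h \<le> 1" and x: "norm x \<le> R" "\<bar>y\<bar> \<le> norm x - \<delta>"
      and P: "\<And>\<xi>. (\<lambda>\<sigma>. P \<sigma> \<xi>) holomorphic_on UNIV" "\<And>\<sigma>. P \<sigma> \<in> borel_measurable borel"
        "\<And>s \<xi>. P (of_real s) \<xi> = P 0 (\<xi> + s *\<^sub>R (2 / h) *\<^sub>R x)"
        "\<And>\<sigma> \<xi>. norm (P \<sigma> \<xi>) \<le> c * (1 + norm \<xi> + norm \<sigma> * norm ((2 / h) *\<^sub>R x))\<^sup>2"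
      for h y and x :: 'a and P :: "complex \<Rightarrow> 'a \<Rightarrow> complex"
  proof -
    have "y\<^sup>2 \<le> (norm x - \<delta>)\<^sup>2" using x power_mono[of "\<bar>y\<bar>" "norm x - \<delta>" 2] by simp
    moreover have "(norm x - \<delta>)\<^sup>2 \<le> (norm x)\<^sup>2 - \<delta>\<^sup>2"
    proof -
      have "\<delta> \<le> norm x" using x by linarith
      then have "\<delta> * \<delta> \<le> \<delta> * norm x" using \<delta> by (intro mult_left_mono) auto
      then show ?thesis by (simp add: power2_eq_square algebra_simps)
    qed
    ultimately have y2: "y\<^sup>2 \<le> (norm x)\<^sup>2 - \<delta>\<^sup>2" by simp
    have "(norm x)\<^sup>2 \<le> R\<^sup>2" using x by (intro power_mono) auto
    then have "y\<^sup>2 \<le> R\<^sup>2 + 1" using y2 zero_le_power2[of \<delta>] by linarith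
    then have "y\<^sup>2 * (2 * \<kappa>) \<le> (R\<^sup>2 + 1) * (2 * (\<delta>\<^sup>2 / (4 * (R\<^sup>2 + 1))))"
      using \<kappa> by (intro mult_mono) auto
    also have "\<dots> = \<delta>\<^sup>2 / 2" using pos by (simp add: field_simps)
    finally have g: "y\<^sup>2 * (1 + 2 * \<kappa>) \<le> (norm x)\<^sup>2 - \<delta>\<^sup>2 / 2" using y2 by (simp add: algebra_simps)
    have "\<bar>Re (\<integral>\<xi>. P 0 \<xi> * cosh (of_real (norm \<xi> * y)) * exp (of_real (- (h / 4) * (norm \<xi>)\<^sup>2) + \<i> * of_real (\<xi> \<bullet> x)) \<partial>lborel)\<bar>
       \<le> norm (\<integral>\<xi>. P 0 \<xi> * cosh (of_real (norm \<xi> * y)) * exp (of_real (- (h / 4) * (norm \<xi>)\<^sup>2) + \<i> * of_real (\<xi> \<bullet> x)) \<partial>lborel)"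
      by (rule abs_Re_le_cmod)
    also have "\<dots> \<le> E h"
      unfolding E_def
      by (rule gaussian_contour_shift_bound[OF h(1) P \<kappa>(1,2) _ g]) (use x in auto)
    finally show ?thesis .
  qed
  show thesis
  proof
    show "(E \<longlongrightarrow> 0) (at_right 0)" by (rule lim)
    fix h y :: real and x :: 'a assume hx: "0 < h" "h \<le> 1" "norm x \<le> R" "\<bar>y\<bar> \<le> norm x - \<delta>"
    define \<eta> where "\<eta> = (2 / h) *\<^sub>R x"
    have ge1: "1 \<le> 1 + norm \<xi> + norm \<sigma> * norm \<eta>" for \<xi> :: 'a and \<sigma> :: complex by simp
    show "\<bar>Phi h (x, y)\<bar> \<le> E h"
      unfolding Phi_cosh[OF hx(1)] c_def[symmetric]
    proof (rule bound[OF hx, where P="\<lambda>\<sigma> \<xi>. of_real c"], unfold \<eta>_def[symmetric])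
      show "norm (of_real c :: complex) \<le> c * (1 + norm \<xi> + norm \<sigma> * norm \<eta>)\<^sup>2" for \<sigma> :: complex and \<xi> :: 'a
        using mult_left_mono[OF one_le_power[OF ge1[of \<xi> \<sigma>], of 2] c0] c0 by simp
    qed (auto intro!: holomorphic_intros)
    show "\<bar>Phi_deriv h [(0, 1), (0, 1)] (x, y)\<bar> \<le> E h"
    proof -
      have "\<bar>Re (\<integral>\<xi>. (of_real c * (of_real (\<xi> \<bullet> \<xi>) + 2 * 0 * of_real (\<xi> \<bullet> \<eta>) + 0\<^sup>2 * of_real (\<eta> \<bullet> \<eta>))) * cosh (of_real (norm \<xi> * y)) * exp (of_real (- (h / 4) * (norm \<xi>)\<^sup>2) + \<i> * of_real (\<xi> \<bullet> x)) \<partial>lborel)\<bar> \<le> E h"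
      proof (rule bound[OF hx, where P="\<lambda>\<sigma> \<xi>. of_real c * (of_real (\<xi> \<bullet> \<xi>) + 2 * \<sigma> * of_real (\<xi> \<bullet> \<eta>) + \<sigma>\<^sup>2 * of_real (\<eta> \<bullet> \<eta>))"], unfold \<eta>_def[symmetric])
        fix \<sigma> :: complex and \<xi> :: 'a
        have "norm (of_real (\<xi> \<bullet> \<xi>) + 2 * \<sigma> * of_real (\<xi> \<bullet> \<eta>) + \<sigma>\<^sup>2 * of_real (\<eta> \<bullet> \<eta>))
            \<le> (norm \<xi>)\<^sup>2 + 2 * norm \<sigma> * (norm \<xi> * norm \<eta>) + (norm \<sigma>)\<^sup>2 * (norm \<eta>)\<^sup>2"
          using Cauchy_Schwarz_ineq2[of \<xi> \<eta>]
          by (intro norm_triangle_mono)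
            (auto simp: norm_mult norm_power dot_square_norm mult_left_mono)
        also have "\<dots> = (norm \<xi> + norm \<sigma> * norm \<eta>)\<^sup>2" by (simp add: power2_sum power_mult_distrib)
        also have "\<dots> \<le> (1 + norm \<xi> + norm \<sigma> * norm \<eta>)\<^sup>2" by (intro power_mono) auto
        finally show "norm (of_real c * (of_real (\<xi> \<bullet> \<xi>) + 2 * \<sigma> * of_real (\<xi> \<bullet> \<eta>) + \<sigma>\<^sup>2 * of_real (\<eta> \<bullet> \<eta>))) \<le> c * (1 + norm \<xi> + norm \<sigma> * norm \<eta>)\<^sup>2"
          using c0 by (simp add: norm_mult mult_left_mono)
      qed (auto intro!: holomorphic_intros simp: inner_add_left inner_add_right inner_commute algebra_simps power2_eq_square)
      then show ?thesis unfolding Phi_deriv_yy[OF hx(1)] c_def[symmetric] by simp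
    qed
    fix b :: 'a assume b: "b \<in> Basis"
    show "\<bar>Phi_deriv h [(b, 0)] (x, y)\<bar> \<le> E h"
    proof -
      have "\<bar>Re (\<integral>\<xi>. (of_real c * (\<i> * (of_real (\<xi> \<bullet> b) + 0 * of_real (\<eta> \<bullet> b)))) * cosh (of_real (norm \<xi> * y)) * exp (of_real (- (h / 4) * (norm \<xi>)\<^sup>2) + \<i> * of_real (\<xi> \<bullet> x)) \<partial>lborel)\<bar> \<le> E h"
      proof (rule bound[OF hx, where P="\<lambda>\<sigma> \<xi>. of_real c * (\<i> * (of_real (\<xi> \<bullet> b) + \<sigma> * of_real (\<eta> \<bullet> b)))"], unfold \<eta>_def[symmetric])
        fix \<sigma> :: complex and \<xi> :: 'a
        have "norm (of_real (\<xi> \<bullet> b) + \<sigma> * of_real (\<eta> \<bullet> b)) \<le> norm \<xi> + norm \<sigma> * norm \<eta>"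
          using Basis_le_norm[OF b, of \<xi>] Basis_le_norm[OF b, of \<eta>]
          by (intro norm_triangle_mono) (auto simp: norm_mult mult_left_mono)
        also have "\<dots> \<le> (1 + norm \<xi> + norm \<sigma> * norm \<eta>)\<^sup>2"
          using self_le_power[OF ge1[of \<xi> \<sigma>], of 2] by simp
        finally show "norm (of_real c * (\<i> * (of_real (\<xi> \<bullet> b) + \<sigma> * of_real (\<eta> \<bullet> b)))) \<le> c * (1 + norm \<xi> + norm \<sigma> * norm \<eta>)\<^sup>2"
          using c0 by (simp add: norm_mult mult_left_mono)
      qed (auto intro!: holomorphic_intros simp: inner_add_left)
      then show ?thesis unfolding Phi_deriv_single[OF hx(1)] c_def[symmetric] by simp
    qed
  qed
qed

subsection \<open>Approximation of the identity\<close>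

lemma gaussian_approx_identity:
  fixes f :: "'a::euclidean_space \<Rightarrow> real"
  assumes cont: "continuous_on UNIV f" and bounded: "\<And>x. \<bar>f x\<bar> \<le> M"
  shows "((\<lambda>h. \<integral>x. f x * ((pi * h) powr (- real DIM('a) / 2) * exp (- (norm (x - a))\<^sup>2 / h)) \<partial>lborel) \<longlongrightarrow> f a) (at_right 0)"
proof -
  define G where "G h x = (pi * h) powr (- real DIM('a) / 2) * exp (- (norm (x - a))\<^sup>2 / h)" for h and x :: 'a
  have powr: "(pi * h) powr (- real DIM('a) / 2) = 1 / sqrt (pi * h) ^ DIM('a)" if "h > 0" for h
  proof -
    have "sqrt (pi * h) ^ DIM('a) = (pi * h) powr (real DIM('a) / 2)"
      using that by (simp add: powr_half_sqrt[symmetric] powr_realpow[symmetric] powr_powr)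
    then show ?thesis by (simp add: powr_minus_divide)
  qed
  have gint: "has_bochner_integral lborel (\<lambda>x. exp (- (norm (x - a))\<^sup>2 / h)) (sqrt (pi * h) ^ DIM('a))" if "h > 0" for h
  proof -
    have g: "has_bochner_integral lborel (\<lambda>x::'a. exp (- (1 / h) * (norm x)\<^sup>2)) (sqrt (pi / (1 / h)) ^ DIM('a))"
      using that by (intro gaussian_euclidean) simp
    have "integrable lborel (\<lambda>x. (\<lambda>x::'a. exp (- (1 / h) * (norm x)\<^sup>2)) (- a + x))"
      using g integrable_distr_eq[of "(+) (- a)" lborel borel "\<lambda>x::'a. exp (- (1 / h) * (norm x)\<^sup>2)"]
      by (simp add: lborel_distr_plus has_bochner_integral_iff)
    moreover have "(\<integral>x. exp (- (1 / h) * (norm (x + - a))\<^sup>2) \<partial>lborel) = (\<integral>x. exp (- (1 / h) * (norm x)\<^sup>2) \<partial>(lborel :: 'a measure))"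
      by (rule integral_lborel_translate) measurable
    ultimately show ?thesis using g by (simp add: has_bochner_integral_iff)
  qed
  have Gint: "integrable lborel (G h)" "(\<integral>x. G h x \<partial>lborel) = 1" if "h > 0" for h
  proof -
    have G: "G h = (\<lambda>x. (1 / sqrt (pi * h) ^ DIM('a)) * exp (- (norm (x - a))\<^sup>2 / h))"
      unfolding G_def powr[OF that] ..
    have "has_bochner_integral lborel (G h) ((1 / sqrt (pi * h) ^ DIM('a)) * sqrt (pi * h) ^ DIM('a))"
      unfolding G by (intro has_bochner_integral_mult_right gint that)
    then show "integrable lborel (G h)" "(\<integral>x. G h x \<partial>lborel) = 1"
      using that by (auto simp: has_bochner_integral_iff)
  qed
  have [measurable]: "f \<in> borel_measurable borel" using cont by (rule borel_measurable_continuous_onI)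
  have fG: "integrable lborel (\<lambda>x. f x * G h x)" if "h > 0" for h
  proof (rule Bochner_Integration.integrable_bound)
    show "integrable lborel (\<lambda>x. M * G h x)" using Gint that by simp
    show "AE x in lborel. norm (f x * G h x) \<le> norm (M * G h x)"
      by (intro AE_I2) (use bounded in \<open>auto simp: G_def abs_mult intro!: mult_right_mono order_trans[OF bounded abs_ge_self]\<close>)
  qed (simp add: G_def)
  show ?thesis
    unfolding G_def[symmetric] tendsto_iff
  proof (intro allI impI)
    fix e :: real assume e: "e > 0"
    then obtain d where d: "d > 0" "\<And>x. dist x a < d \<Longrightarrow> dist (f x) (f a) < e / 2"
      using cont[unfolded continuous_on_iff] by (metis UNIV_I half_gt_zero)
    define T where "T h = 2 * M * sqrt 2 ^ DIM('a) * exp (- (d\<^sup>2 / 2) / h)" for h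
    have M0: "M \<ge> 0" using bounded[of a] by linarith
    have main: "\<bar>(\<integral>x. f x * G h x \<partial>lborel) - f a\<bar> \<le> e / 2 + T h" if h: "h > 0" for h
    proof -
      define H where "H x = (e / 2) * G h x + 2 * M * exp (- (d\<^sup>2 / 2) / h) * (1 / sqrt (pi * h) ^ DIM('a)) * exp (- (norm (x - a))\<^sup>2 / (2 * h))" for x
      have Hi: "has_bochner_integral lborel H ((e / 2) * 1 + 2 * M * exp (- (d\<^sup>2 / 2) / h) * (1 / sqrt (pi * h) ^ DIM('a)) * sqrt (pi * (2 * h)) ^ DIM('a))"
        unfolding H_def
        by (intro has_bochner_integral_add has_bochner_integral_mult_right gint)
          (use Gint[OF h] h in \<open>auto simp: has_bochner_integral_iff\<close>)
      have bd: "\<bar>f x * G h x - f a * G h x\<bar> \<le> H x" for x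
      proof (cases "dist x a < d")
        case True
        have "\<bar>f x - f a\<bar> * G h x \<le> (e / 2) * G h x"
          using d(2)[OF True] by (intro mult_right_mono) (auto simp: dist_real_def G_def)
        moreover have "0 \<le> 2 * M * exp (- (d\<^sup>2 / 2) / h) * (1 / sqrt (pi * h) ^ DIM('a)) * exp (- (norm (x - a))\<^sup>2 / (2 * h))"
          using M0 h by simp
        ultimately show ?thesis by (simp add: H_def left_diff_distrib[symmetric] abs_mult G_def)
      next
        case False
        have "\<bar>f x - f a\<bar> \<le> 2 * M" using bounded[of x] bounded[of a] by linarith
        moreover have "G h x \<le> exp (- (d\<^sup>2 / 2) / h) * (1 / sqrt (pi * h) ^ DIM('a)) * exp (- (norm (x - a))\<^sup>2 / (2 * h))"
        proof -
          have "d\<^sup>2 \<le> (norm (x - a))\<^sup>2" using False d(1) by (intro power_mono) (auto simp: dist_norm)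
          then have "- (norm (x - a))\<^sup>2 / h \<le> - (d\<^sup>2 / 2) / h + - (norm (x - a))\<^sup>2 / (2 * h)"
            using h by (simp add: field_simps)
          then have "exp (- (norm (x - a))\<^sup>2 / h) \<le> exp (- (d\<^sup>2 / 2) / h) * exp (- (norm (x - a))\<^sup>2 / (2 * h))"
            by (simp flip: exp_add)
          moreover have "0 \<le> 1 / sqrt (pi * h) ^ DIM('a)" using h by simp
          ultimately have "1 / sqrt (pi * h) ^ DIM('a) * exp (- (norm (x - a))\<^sup>2 / h)
              \<le> 1 / sqrt (pi * h) ^ DIM('a) * (exp (- (d\<^sup>2 / 2) / h) * exp (- (norm (x - a))\<^sup>2 / (2 * h)))"
            by (rule mult_left_mono)
          then show ?thesis
            unfolding G_def powr[OF h] by (simp add: mult_ac)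
        qed
        ultimately have "\<bar>f x - f a\<bar> * G h x \<le> 2 * M * (exp (- (d\<^sup>2 / 2) / h) * (1 / sqrt (pi * h) ^ DIM('a)) * exp (- (norm (x - a))\<^sup>2 / (2 * h)))"
          using M0 by (intro mult_mono) (auto simp: G_def)
        moreover have "0 \<le> (e / 2) * G h x" using e by (simp add: G_def)
        ultimately show ?thesis by (simp add: H_def left_diff_distrib[symmetric] abs_mult G_def)
      qed
      have "\<bar>(\<integral>x. f x * G h x \<partial>lborel) - f a\<bar> = norm (\<integral>x. f x * G h x - f a * G h x \<partial>lborel)"
        using fG[OF h] Gint[OF h] by simp
      also have "\<dots> \<le> (\<integral>x. H x \<partial>lborel)"
        using fG[OF h] Gint[OF h] Hi bd
        by (intro Bochner_Integration.integral_norm_bound_integral) (auto simp: has_bochner_integral_iff)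
      also have "\<dots> = e / 2 + T h"
        using Hi h by (simp add: has_bochner_integral_iff T_def real_sqrt_mult power_mult_distrib)
      finally show ?thesis .
    qed
    have "(T \<longlongrightarrow> 0) (at_right 0)"
      using exp_neg_inverse_tendsto_0[of "d\<^sup>2 / 2" "2 * M * sqrt 2 ^ DIM('a)" 0] d(1) by (simp add: T_def[abs_def])
    then have "\<forall>\<^sub>F h in at_right 0. T h < e / 2" using e by (intro order_tendstoD) auto
    moreover have "\<forall>\<^sub>F h::real in at_right 0. 0 < h" by (simp add: eventually_at_right_less)
    ultimately show "\<forall>\<^sub>F h in at_right 0. dist (\<integral>x. f x * G h x \<partial>lborel) (f a) < e"
      by eventually_elim (use main in \<open>force simp: dist_real_def\<close>)
  qed
qed

subsection \<open>Cutoff functions and integration by parts\<close>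

lemma DERIV_max_0_power2: "((\<lambda>s. (max 0 s)\<^sup>2) has_real_derivative 2 * max 0 s) (at s)"
proof -
  consider "s > 0" | "s < 0" | "s = 0" by linarith
  then show ?thesis
  proof cases
    case 1
    have "((\<lambda>s. s\<^sup>2) has_real_derivative 2 * max 0 s) (at s)" using 1 by (auto intro!: derivative_eq_intros)
    then show ?thesis
      by (rule has_field_derivative_transform_within_open[where S="{0<..}"]) (use 1 in auto)
  next
    case 2
    have "((\<lambda>s. 0) has_real_derivative 2 * max 0 s) (at s)" using 2 by (auto intro!: derivative_eq_intros)
    then show ?thesis
      by (rule has_field_derivative_transform_within_open[where S="{..<0}"]) (use 2 in auto)
  next
    case 3
    have "((\<lambda>s. (max 0 s)\<^sup>2) has_derivative (\<lambda>v. 0 * v)) (at (0::real))"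
      by (rule has_derivative_quadratic_bound[where C=1]) (auto simp: max_def)
    then show ?thesis using 3 by (simp add: has_field_derivative_def lambda_zero)
  qed
qed

definition ramp :: "real \<Rightarrow> real" where
  "ramp s = 2 * (max 0 s)\<^sup>2 - 4 * (max 0 (s - 1 / 2))\<^sup>2 + 2 * (max 0 (s - 1))\<^sup>2"

definition ramp' :: "real \<Rightarrow> real" where
  "ramp' s = 4 * max 0 s - 8 * max 0 (s - 1 / 2) + 4 * max 0 (s - 1)"

lemma DERIV_ramp: "(ramp has_real_derivative ramp' s) (at s)"
proof -
  have d: "((\<lambda>s. (max 0 (s - a))\<^sup>2) has_real_derivative 2 * max 0 (s - a)) (at s)" for a
    using DERIV_shift[of "\<lambda>s. (max 0 s)\<^sup>2" "2 * max 0 (s - a)" s "- a"] DERIV_max_0_power2[of "s - a"] by simp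
  show ?thesis
    unfolding ramp_def[abs_def] ramp'_def
    by (rule DERIV_cong[OF DERIV_add[OF DERIV_diff[OF DERIV_cmult[OF DERIV_max_0_power2] DERIV_cmult[OF d]] DERIV_cmult[OF d]]])
      simp
qed

lemma ramp_eq_0: "s \<le> 0 \<Longrightarrow> ramp s = 0" and ramp_eq_1: "s \<ge> 1 \<Longrightarrow> ramp s = 1"
  by (auto simp: ramp_def power2_eq_square algebra_simps)

lemma ramp'_eq_0: "s \<le> 0 \<or> s \<ge> 1 \<Longrightarrow> ramp' s = 0"
  by (auto simp: ramp'_def)

lemma continuous_on_ramp: "continuous_on S f \<Longrightarrow> continuous_on S (\<lambda>x. ramp (f x))"
  and continuous_on_ramp': "continuous_on S f \<Longrightarrow> continuous_on S (\<lambda>x. ramp' (f x))"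
  unfolding ramp_def ramp'_def by (auto intro!: continuous_intros)

lemma continuous_on_cutoff_mult:
  fixes c X :: "'a::euclidean_space \<Rightarrow> real"
  assumes "open P" "compact K" "K \<subseteq> P" "continuous_on P c" "continuous_on P X" "\<And>x. x \<notin> K \<Longrightarrow> c x = 0"
  shows "continuous_on UNIV (\<lambda>x. c x * X x)"
proof -
  have "continuous_on (P \<union> - K) (\<lambda>x. c x * X x)"
  proof (rule continuous_on_open_Un)
    have "continuous_on (- K) (\<lambda>x. 0::real)" by simp
    then show "continuous_on (- K) (\<lambda>x. c x * X x)"
      by (rule continuous_on_cong[THEN iffD1, rotated -1]) (use assms in auto)
  qed (use assms in \<open>auto intro!: continuous_intros simp: compact_imp_closed open_Compl\<close>)
  moreover have "P \<union> - K = UNIV" using assms by auto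
  ultimately show ?thesis by simp
qed

lemma integral_compact_support:
  fixes f :: "'a::euclidean_space \<Rightarrow> real"
  assumes "continuous_on UNIV f" "\<And>x. x \<notin> C \<Longrightarrow> f x = 0" "C = cbox a b"
  shows "f integrable_on UNIV" "integral UNIV f = integral C f" "integral UNIV f = (\<integral>x. f x \<partial>lborel)" "integrable lborel f"
proof -
  have z: "(\<lambda>x. if x \<in> C then f x else 0) = f" using assms(2) by auto
  have cC: "continuous_on C f" using assms(1) continuous_on_subset subset_UNIV by blast
  then have "f integrable_on C" unfolding assms(3) by (rule integrable_continuous)
  then have "(\<lambda>x. if x \<in> C then f x else 0) integrable_on UNIV" by (simp only: integrable_restrict_UNIV)
  then show "f integrable_on UNIV" by (simp only: z)
  show "integral UNIV f = integral C f" using integral_restrict_UNIV[of C f] by (simp only: z)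
  have "compact C" unfolding assms(3) by (rule compact_cbox)
  from borel_integrable_compact[OF this cC] have "integrable lborel (\<lambda>x. indicator C x *\<^sub>R f x)" .
  also have "(\<lambda>x. indicator C x *\<^sub>R f x) = f"
  proof
    show "indicator C x *\<^sub>R f x = f x" for x by (cases "x \<in> C") (auto simp: assms(2))
  qed
  finally show i: "integrable lborel f" .
  show "integral UNIV f = (\<integral>x. f x \<partial>lborel)" using integral_lborel[OF i] by simp
qed

lemma compact_subset_cbox:
  fixes K :: "'a::euclidean_space set"
  assumes "compact K" obtains a b where "K \<subseteq> cbox a b"
  using bounded_subset_cbox_symmetric[OF compact_imp_bounded[OF assms]] that by metis

lemma integral_directional_derivative:
  fixes f f' :: "'a::euclidean_space \<Rightarrow> real"
  assumes der: "\<And>x. ((\<lambda>s. f (x + s *\<^sub>R e)) has_real_derivative f' x) (at 0)"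
    and cf: "continuous_on UNIV f" and cf': "continuous_on UNIV f'"
    and K: "compact K" and f0: "\<And>x. x \<notin> K \<Longrightarrow> f x = 0"
  shows "integral UNIV f' = 0"
proof -
  define K' where "K' = (\<lambda>(x, s). x - s *\<^sub>R e) ` (K \<times> {-1..1::real})"
  have "compact K'" unfolding K'_def
    by (intro compact_continuous_image compact_Times K compact_Icc) (auto intro!: continuous_intros simp: split_beta)
  then obtain a b where ab: "K' \<subseteq> cbox a b" using compact_subset_cbox by blast
  have f0': "f (x + s *\<^sub>R e) = 0" if "s \<in> {-1..1}" "x \<notin> cbox a b" for x s
  proof (rule f0, rule notI)
    assume "x + s *\<^sub>R e \<in> K"
    then have "(\<lambda>(x, s). x - s *\<^sub>R e) (x + s *\<^sub>R e, s) \<in> K'" unfolding K'_def using that by blast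
    then show False using ab that by auto
  qed
  have der': "((\<lambda>s. f (x + s *\<^sub>R e)) has_real_derivative f' (x + s *\<^sub>R e)) (at s)" for x s
  proof -
    have "((\<lambda>t. f (x + s *\<^sub>R e + (t + - s) *\<^sub>R e)) has_real_derivative f' (x + s *\<^sub>R e)) (at s)"
      using DERIV_shift[of "\<lambda>t. f (x + s *\<^sub>R e + t *\<^sub>R e)" "f' (x + s *\<^sub>R e)" s "- s"] der[of "x + s *\<^sub>R e"] by simp
    then show ?thesis by (simp add: algebra_simps)
  qed
  have f'0: "f' x = 0" if "x \<notin> cbox a b" for x
  proof -
    have "((\<lambda>s. 0) has_real_derivative f' x) (at 0)"
      by (rule has_field_derivative_transform_within_open[OF der[of x], where S="{-1<..<1}"]) (use that f0' in auto)
    then show ?thesis using DERIV_unique DERIV_const by blast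
  qed
  have "((\<lambda>s. integral (cbox a b) (\<lambda>x. f (x + s *\<^sub>R e))) has_real_derivative integral (cbox a b) (\<lambda>x. f' (x + 0 *\<^sub>R e))) (at 0 within {-1..1})"
  proof (rule leibniz_rule_field_derivative[where fx="\<lambda>s x. f' (x + s *\<^sub>R e)"])
    show "((\<lambda>s. f (x + s *\<^sub>R e)) has_real_derivative f' (x + s *\<^sub>R e)) (at s within {-1..1})" for x s
      using der' has_field_derivative_at_within by blast
    show "(\<lambda>x. f (x + s *\<^sub>R e)) integrable_on cbox a b" for s
      by (intro integrable_continuous continuous_on_compose2[OF cf]) (auto intro!: continuous_intros)
    show "continuous_on ({-1..1} \<times> cbox a b) (\<lambda>(s, x). f' (x + s *\<^sub>R e))"
      by (auto intro!: continuous_on_compose2[OF cf'] continuous_intros simp: split_beta)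
  qed auto
  moreover have "integral (cbox a b) (\<lambda>x. f (x + s *\<^sub>R e)) = integral (cbox a b) f" if "s \<in> {-1..1}" for s
  proof -
    have c: "continuous_on UNIV (\<lambda>x. f (x + s *\<^sub>R e))" by (intro continuous_on_compose2[OF cf]) (auto intro!: continuous_intros)
    have "integral (cbox a b) (\<lambda>x. f (x + s *\<^sub>R e)) = (\<integral>x. f (x + s *\<^sub>R e) \<partial>lborel)"
      using integral_compact_support(2,3)[OF c f0'[OF that] refl] by simp
    also have "\<dots> = (\<integral>x. f x \<partial>lborel)"
      by (rule integral_lborel_translate) (rule borel_measurable_continuous_onI[OF cf])
    also have "\<dots> = integral (cbox a b) f"
      using integral_compact_support(2,3)[OF cf f0'[of 0, simplified] refl] by simp
    finally show ?thesis .
  qed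
  ultimately have "((\<lambda>s. integral (cbox a b) f) has_real_derivative integral (cbox a b) f') (at 0 within {-1..1})"
    by (subst (asm) has_field_derivative_cong_eventually[where g="\<lambda>s. integral (cbox a b) f"])
      (auto simp: eventually_at_filter)
  moreover have "((\<lambda>s. integral (cbox a b) f) has_real_derivative 0) (at (0::real) within {-1..1})" by simp
  moreover have "at (0::real) within {-1..1} = at 0" by (rule at_within_interior) simp
  ultimately have "integral (cbox a b) f' = 0" using DERIV_unique by metis
  then show ?thesis using integral_compact_support(2)[OF cf' f'0 refl] by simp
qed

lemma integration_by_parts_cutoff:
  fixes c c' X X' :: "'a::euclidean_space \<Rightarrow> real"
  assumes P: "open P" "compact K" "K \<subseteq> P"
    and c: "continuous_on UNIV c" "continuous_on UNIV c'" "\<And>x. x \<notin> K \<Longrightarrow> c x = 0"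
    and dc: "\<And>x. ((\<lambda>s. c (x + s *\<^sub>R e)) has_real_derivative c' x) (at 0)"
    and X: "continuous_on P X" "continuous_on P X'"
    and dX: "\<And>x. x \<in> P \<Longrightarrow> ((\<lambda>s. X (x + s *\<^sub>R e)) has_real_derivative X' x) (at 0)"
  shows "integral UNIV (\<lambda>x. c x * X' x) = - integral UNIV (\<lambda>x. c' x * X x)"
    and "x \<notin> K \<Longrightarrow> c' x = 0"
proof -
  have loc: "\<forall>\<^sub>F s in nhds (0::real). x + s *\<^sub>R e \<in> U" if "open U" "x \<in> U" for U x
  proof -
    have "((\<lambda>s. x + s *\<^sub>R e) \<longlongrightarrow> x + 0 *\<^sub>R e) (nhds 0)" by (intro tendsto_intros filterlim_ident)
    then show ?thesis using that topological_tendstoD by fastforce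
  qed
  have K': "open (- K)" using P by (simp add: compact_imp_closed open_Compl)
  have c'0: "c' x = 0" if "x \<notin> K" for x
  proof -
    have ev: "\<forall>\<^sub>F s in nhds (0::real). c (x + s *\<^sub>R e) = 0"
      using loc[OF K', of x] that by (auto elim!: eventually_mono simp: c)
    then have "((\<lambda>s. 0) has_real_derivative c' x) (at 0)"
      using DERIV_cong_ev[OF refl ev refl, of "c' x"] dc[of x] by simp
    then show ?thesis using DERIV_unique DERIV_const by blast
  qed
  then show "x \<notin> K \<Longrightarrow> c' x = 0" .
  have cP: "continuous_on P c" "continuous_on P c'" using c continuous_on_subset by blast+
  have c1: "continuous_on UNIV (\<lambda>x. c x * X' x)" by (rule continuous_on_cutoff_mult[OF P cP(1) X(2) c(3)])
  have c2: "continuous_on UNIV (\<lambda>x. c' x * X x)" by (rule continuous_on_cutoff_mult[OF P cP(2) X(1) c'0])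
  have c3: "continuous_on UNIV (\<lambda>x. c x * X x)" by (rule continuous_on_cutoff_mult[OF P cP(1) X(1) c(3)])
  have d: "((\<lambda>s. c (x + s *\<^sub>R e) * X (x + s *\<^sub>R e)) has_real_derivative (c' x * X x + c x * X' x)) (at 0)" for x
  proof (cases "x \<in> K")
    case True
    then have "x \<in> P" using P by auto
    from DERIV_mult[OF dc dX[OF this]] show ?thesis by (simp add: mult.commute)
  next
    case False
    have ev: "\<forall>\<^sub>F s in nhds (0::real). c (x + s *\<^sub>R e) * X (x + s *\<^sub>R e) = 0"
      using loc[OF K', of x] False by (auto elim!: eventually_mono simp: c)
    have "((\<lambda>s. c (x + s *\<^sub>R e) * X (x + s *\<^sub>R e)) has_real_derivative 0) (at 0)"
      by (subst DERIV_cong_ev[OF refl ev refl]) simp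
    then show ?thesis using False c'0 c(3) by simp
  qed
  have "integral UNIV (\<lambda>x. c' x * X x + c x * X' x) = 0"
    by (rule integral_directional_derivative[OF d c3 _ P(2)]) (use c1 c2 c in \<open>auto intro!: continuous_intros\<close>)
  moreover obtain a b where ab: "K \<subseteq> cbox a b" using compact_subset_cbox[OF P(2)] by blast
  have "(\<lambda>x. c' x * X x) integrable_on UNIV" "(\<lambda>x. c x * X' x) integrable_on UNIV"
    by (rule integral_compact_support(1)[OF c2 _ refl, of a b], use ab c'0 in auto)
      (rule integral_compact_support(1)[OF c1 _ refl, of a b], use ab c in auto)
  ultimately show "integral UNIV (\<lambda>x. c x * X' x) = - integral UNIV (\<lambda>x. c' x * X x)"
    by (simp add: Henstock_Kurzweil_Integration.integral_add)
qed

subsection \<open>Uniqueness in the Cauchy problem for harmonic functions\<close>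

lemma has_derivative_directional:
  fixes f :: "'a::real_normed_vector \<Rightarrow> real"
  assumes "(f has_derivative D) (at z)"
  shows "((\<lambda>s. f (z + s *\<^sub>R v)) has_real_derivative D v) (at 0)"
proof -
  have "((\<lambda>s. z + s *\<^sub>R v) has_derivative (\<lambda>s. s *\<^sub>R v)) (at 0)"
    by (auto intro!: derivative_eq_intros)
  moreover have "(f has_derivative D) (at (z + 0 *\<^sub>R v))" using assms by simp
  ultimately have "((\<lambda>s. f (z + s *\<^sub>R v)) has_derivative (\<lambda>s. D (s *\<^sub>R v))) (at 0)"
    by (rule has_derivative_compose)
  then show ?thesis
    unfolding has_field_derivative_def
    by (rule has_derivative_eq_rhs) (simp add: fun_eq_iff linear_scale[OF has_derivative_linear[OF assms]])
qed

lemma has_derivative_line: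
  fixes f :: "'a::real_normed_vector \<Rightarrow> real"
  assumes "(f has_derivative D) (at (z + s *\<^sub>R v))"
  shows "((\<lambda>s. f (z + s *\<^sub>R v)) has_real_derivative D v) (at s within S)"
proof -
  have "((\<lambda>t. f (z + s *\<^sub>R v + (t + - s) *\<^sub>R v)) has_real_derivative D v) (at s)"
    using DERIV_shift[of "\<lambda>t. f (z + s *\<^sub>R v + t *\<^sub>R v)" "D v" s "- s"] has_derivative_directional[OF assms, of v] by simp
  then show ?thesis by (simp add: algebra_simps has_field_derivative_at_within)
qed

lemma harmonic_Cauchy_unique_y:
  fixes \<psi> :: "'a::euclidean_space \<times> real \<Rightarrow> real"
  assumes fam: "deriv_family_on UNIV \<psi> g"
    and harmonic: "\<And>z. (\<Sum>b\<in>Basis. g [b, b] z) = 0"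
    and g0: "\<And>x. g [(0, 1)] (x, 0) = 0" and \<psi>0: "\<And>x. \<psi> (x, 0) = 0"
  shows "g [(0, 1)] (x0, y0) = 0"
proof -
  have der: "(g vs has_derivative (\<lambda>v. g (v # vs) z)) (at z)" for vs z
    using fam unfolding deriv_family_on_def by blast
  have \<psi>: "\<psi> = g []" using fam by (auto simp: deriv_family_on_def)
  have cont: "continuous_on S (g vs)" for S vs
    by (meson der continuous_at_imp_continuous_on has_derivative_continuous)
  define r where "r = 2 * \<bar>y0\<bar> + 1"
  define c where "c x = ramp (r\<^sup>2 + 1 - (norm (x - x0))\<^sup>2)" for x
  define c' where "c' b x = ramp' (r\<^sup>2 + 1 - (norm (x - x0))\<^sup>2) * (- 2 * ((x - x0) \<bullet> b))" for b x
  define K where "K = cball x0 (r + 1)"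
  have r: "r \<ge> 1" by (simp add: r_def)
  have K: "compact K" "K \<subseteq> UNIV" by (auto simp: K_def)
  have c_cont: "continuous_on S c" "continuous_on S (c' b)" for S b
    unfolding c_def[abs_def] c'_def[abs_def]
    by (auto intro!: continuous_intros continuous_on_ramp continuous_on_ramp')
  have c0: "c x = 0" if "x \<notin> K" for x
  proof -
    have "r + 1 \<le> norm (x - x0)" using that by (simp add: K_def dist_norm norm_minus_commute)
    then have "(r + 1)\<^sup>2 \<le> (norm (x - x0))\<^sup>2" using r by (intro power_mono) auto
    then show ?thesis unfolding c_def using r by (intro ramp_eq_0) (simp add: power2_sum)
  qed
  have dc: "((\<lambda>s. c (x + s *\<^sub>R b)) has_real_derivative c' b x) (at 0)" for x b
  proof -
    have "((\<lambda>s. r\<^sup>2 + 1 - (x + s *\<^sub>R b - x0) \<bullet> (x + s *\<^sub>R b - x0)) has_real_derivative - 2 * ((x - x0) \<bullet> b)) (at 0)"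
    proof -
      have "(\<lambda>s. r\<^sup>2 + 1 - (x + s *\<^sub>R b - x0) \<bullet> (x + s *\<^sub>R b - x0)) = (\<lambda>s. r\<^sup>2 + 1 - ((x - x0) \<bullet> (x - x0) + 2 * s * ((x - x0) \<bullet> b) + s\<^sup>2 * (b \<bullet> b)))"
        by (simp add: fun_eq_iff algebra_simps inner_commute power2_eq_square)
      then show ?thesis by (auto intro!: derivative_eq_intros)
    qed
    from DERIV_chain2[OF DERIV_ramp this]
    show ?thesis by (simp add: c_def c'_def power2_norm_eq_inner)
  qed
  have c'_far: "r \<le> norm (x - x0) \<and> norm (x - x0) \<le> r + 1" if "c' b x \<noteq> 0" for b x
  proof -
    have *: "0 < r\<^sup>2 + 1 - (norm (x - x0))\<^sup>2" "r\<^sup>2 + 1 - (norm (x - x0))\<^sup>2 < 1"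
    proof -
      have "ramp' (r\<^sup>2 + 1 - (norm (x - x0))\<^sup>2) \<noteq> 0" using that by (simp add: c'_def)
      then have "\<not> (r\<^sup>2 + 1 - (norm (x - x0))\<^sup>2 \<le> 0 \<or> r\<^sup>2 + 1 - (norm (x - x0))\<^sup>2 \<ge> 1)" using ramp'_eq_0 by blast
      then show "0 < r\<^sup>2 + 1 - (norm (x - x0))\<^sup>2" "r\<^sup>2 + 1 - (norm (x - x0))\<^sup>2 < 1" by linarith+
    qed
    have "r \<le> norm (x - x0)" by (rule power2_le_imp_le) (use * in linarith, simp)
    moreover have "norm (x - x0) \<le> r + 1"
      by (rule power2_le_imp_le) (use * r in \<open>simp_all add: power2_sum\<close>)
    ultimately show ?thesis by blast
  qed
  obtain \<epsilon> :: "real \<Rightarrow> real" where \<epsilon>: "(\<epsilon> \<longlongrightarrow> 0) (at_right 0)"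
    and \<epsilon>1: "\<And>h (x::'a) y. 0 < h \<Longrightarrow> h \<le> 1 \<Longrightarrow> norm x \<le> r + 1 \<Longrightarrow> \<bar>y\<bar> \<le> norm x - 1 \<Longrightarrow> \<bar>Phi h (x, y)\<bar> \<le> \<epsilon> h"
    and \<epsilon>2: "\<And>h (x::'a) y b. 0 < h \<Longrightarrow> h \<le> 1 \<Longrightarrow> norm x \<le> r + 1 \<Longrightarrow> \<bar>y\<bar> \<le> norm x - 1 \<Longrightarrow> b \<in> Basis \<Longrightarrow> \<bar>Phi_deriv h [(b, 0)] (x, y)\<bar> \<le> \<epsilon> h"
    using Phi_decay[of 1 "r + 1", where 'a='a] by (metis zero_less_one)
  obtain a1 a2 where box: "K \<subseteq> cbox a1 a2" using compact_subset_cbox[OF K(1)] by blast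
  define I where "I = {- \<bar>y0\<bar>..\<bar>y0\<bar>}"
  define m where "m = (\<lambda>(x, y). \<Sum>b\<in>(Basis :: 'a set). \<bar>c' b x\<bar> * (\<bar>g [(b, 0)] (x, y)\<bar> + \<bar>\<psi> (x, y)\<bar>))"
  have "continuous_on (cbox a1 a2 \<times> I) m"
    unfolding m_def \<psi> split_beta
    by (intro continuous_intros continuous_on_compose2[OF c_cont(2)] continuous_on_compose2[OF cont]) auto
  then have "bounded (m ` (cbox a1 a2 \<times> I))"
    by (intro compact_imp_bounded compact_continuous_image) (auto simp: I_def intro: compact_Times)
  then obtain M where M: "\<And>x y. x \<in> cbox a1 a2 \<Longrightarrow> y \<in> I \<Longrightarrow> \<bar>m (x, y)\<bar> \<le> M"
    unfolding bounded_iff by fastforce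
  define V where "V h vs z = Phi_deriv h vs (z - (x0, y0))" for h vs and z :: "'a \<times> real"
  define f where "f h = (\<integral>x. (c x * g [(0, 1)] (x, y0)) * ((pi * h) powr (- real DIM('a) / 2) * exp (- (norm (x - x0))\<^sup>2 / h)) \<partial>lborel)" for h
  have est: "\<bar>f h\<bar> \<le> \<epsilon> h * (M * measure lborel (cbox a1 a2) * \<bar>y0\<bar>)" if h: "0 < h" "h \<le> 1" for h
  proof -
    have Vder: "(V h vs has_derivative (\<lambda>v. V h (v # vs) z)) (at z)" for vs z
    proof -
      have "((\<lambda>z. z - (x0, y0)) has_derivative (\<lambda>v. v)) (at z)" by (auto intro!: derivative_eq_intros)
      from has_derivative_compose[OF this Phi_deriv_has_derivative[OF h(1)]]
      show ?thesis unfolding V_def[abs_def] .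
    qed
    have Vcont: "continuous_on S (V h vs)" for S vs
      by (meson Vder continuous_at_imp_continuous_on has_derivative_continuous)
    have Vharm: "(\<Sum>b\<in>Basis. V h [b, b] z) = 0" for z
      unfolding V_def by (rule Phi_harmonic[OF h(1)])
    define A where "A y = integral (cbox a1 a2) (\<lambda>x. c x * (\<psi> (x, y) * V h [(0, 1)] (x, y) - V h [] (x, y) * g [(0, 1)] (x, y)))" for y
    define X where "X b y x = V h [] (x, y) * g [(b, 0)] (x, y) - \<psi> (x, y) * V h [(b, 0)] (x, y)" for b y and x :: 'a
    define X' where "X' b y x = V h [] (x, y) * g [(b, 0), (b, 0)] (x, y) - \<psi> (x, y) * V h [(b, 0), (b, 0)] (x, y)" for b y and x :: 'a
    have line: "((\<lambda>s. F (x + s *\<^sub>R b, y)) has_real_derivative D (b, 0)) (at 0)"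
      if "(F has_derivative D) (at (x, y))" for F :: "'a \<times> real \<Rightarrow> real" and D x y b
      using has_derivative_directional[OF that, of "(b, 0)"] by simp
    have liney: "((\<lambda>y. F (x, y)) has_real_derivative D (0, 1)) (at y within S)"
      if "(F has_derivative D) (at (x, y))" for F :: "'a \<times> real \<Rightarrow> real" and D x y S
      using has_derivative_line[of F D "(x, 0)" y "(0, 1)" S] that by simp
    have Xd: "((\<lambda>s. X b y (x + s *\<^sub>R b)) has_real_derivative X' b y x) (at 0)" for b y x
      unfolding X_def X'_def \<psi>
      by (rule DERIV_cong[OF DERIV_diff[OF DERIV_mult[OF line[OF Vder] line[OF der]] DERIV_mult[OF line[OF der] line[OF Vder]]]])
        simp
    have Xc: "continuous_on S (X b y)" "continuous_on S (X' b y)" for S b y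
    proof -
      show "continuous_on S (X b y)" unfolding X_def[abs_def] \<psi>
        by (intro continuous_intros continuous_on_compose2[OF Vcont] continuous_on_compose2[OF cont]) auto
      show "continuous_on S (X' b y)" unfolding X'_def[abs_def] \<psi>
        by (intro continuous_intros continuous_on_compose2[OF Vcont] continuous_on_compose2[OF cont]) auto
    qed
    have zero_K: "c' b x = 0" if "x \<notin> K" for b x
      using integration_by_parts_cutoff(2)[OF open_UNIV K c_cont(1) c_cont(2) c0 dc Xc Xd that] .
    have parts: "integral (cbox a1 a2) (\<lambda>x. c x * X' b y x) = - integral (cbox a1 a2) (\<lambda>x. c' b x * X b y x)" for b y
    proof -
      have e1: "integral UNIV (\<lambda>x. c x * X' b y x) = integral (cbox a1 a2) (\<lambda>x. c x * X' b y x)"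
        by (rule integral_compact_support(2)[OF _ _ refl]) (use c0 box in \<open>auto intro!: continuous_intros c_cont Xc\<close>)
      have e2: "integral UNIV (\<lambda>x. c' b x * X b y x) = integral (cbox a1 a2) (\<lambda>x. c' b x * X b y x)"
        by (rule integral_compact_support(2)[OF _ _ refl]) (use zero_K box in \<open>auto intro!: continuous_intros c_cont Xc\<close>)
      have "integral UNIV (\<lambda>x. c x * X' b y x) = - integral UNIV (\<lambda>x. c' b x * X b y x)"
        by (rule integration_by_parts_cutoff(1)[OF open_UNIV K c_cont(1) c_cont(2) c0 dc Xc(1) Xc(2) Xd])
      then show ?thesis by (simp only: e1 e2)
    qed
    have Ad: "(A has_real_derivative - (\<Sum>b\<in>Basis. integral (cbox a1 a2) (\<lambda>x. c' b x * X b y x))) (at y within I)" if "y \<in> I" for y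
    proof -
      have "(A has_real_derivative integral (cbox a1 a2) (\<lambda>x. c x * (\<psi> (x, y) * V h [(0, 1), (0, 1)] (x, y) - V h [] (x, y) * g [(0, 1), (0, 1)] (x, y)))) (at y within I)"
        unfolding A_def[abs_def]
      proof (rule leibniz_rule_field_derivative[where fx="\<lambda>y x. c x * (\<psi> (x, y) * V h [(0, 1), (0, 1)] (x, y) - V h [] (x, y) * g [(0, 1), (0, 1)] (x, y))"])
        fix y x
        show "((\<lambda>y. c x * (\<psi> (x, y) * V h [(0, 1)] (x, y) - V h [] (x, y) * g [(0, 1)] (x, y))) has_real_derivative
           c x * (\<psi> (x, y) * V h [(0, 1), (0, 1)] (x, y) - V h [] (x, y) * g [(0, 1), (0, 1)] (x, y))) (at y within I)"
          unfolding \<psi>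
          by (rule DERIV_cong[OF DERIV_cmult[OF DERIV_diff[OF DERIV_mult[OF liney[OF der] liney[OF Vder]] DERIV_mult[OF liney[OF Vder] liney[OF der]]]]])
            simp
        show "(\<lambda>x. c x * (\<psi> (x, y) * V h [(0, 1)] (x, y) - V h [] (x, y) * g [(0, 1)] (x, y))) integrable_on cbox a1 a2"
          unfolding \<psi>
          by (intro integrable_continuous continuous_intros c_cont continuous_on_compose2[OF Vcont] continuous_on_compose2[OF cont]) auto
      next
        show "continuous_on (I \<times> cbox a1 a2) (\<lambda>(y, x). c x * (\<psi> (x, y) * V h [(0, 1), (0, 1)] (x, y) - V h [] (x, y) * g [(0, 1), (0, 1)] (x, y)))"
          unfolding \<psi> split_beta
          by (intro continuous_intros continuous_on_compose2[OF c_cont(1)] continuous_on_compose2[OF Vcont] continuous_on_compose2[OF cont]) auto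
      qed (use that in \<open>auto simp: I_def\<close>)
      also have "(\<lambda>x. c x * (\<psi> (x, y) * V h [(0, 1), (0, 1)] (x, y) - V h [] (x, y) * g [(0, 1), (0, 1)] (x, y))) = (\<lambda>x. \<Sum>b\<in>Basis. c x * X' b y x)"
      proof
        fix x
        have "V h [(0, 1), (0, 1)] (x, y) = - (\<Sum>b\<in>Basis. V h [(b, 0), (b, 0)] (x, y))"
          "g [(0, 1), (0, 1)] (x, y) = - (\<Sum>b\<in>Basis. g [(b, 0), (b, 0)] (x, y))"
          using Vharm[of "(x, y)"] harmonic[of "(x, y)"] by (simp_all add: sum_Basis_prod)
        then show "c x * (\<psi> (x, y) * V h [(0, 1), (0, 1)] (x, y) - V h [] (x, y) * g [(0, 1), (0, 1)] (x, y)) = (\<Sum>b\<in>Basis. c x * X' b y x)"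
          by (simp add: X'_def sum_distrib_left sum_subtractf right_diff_distrib)
      qed
      also have "integral (cbox a1 a2) (\<lambda>x. \<Sum>b\<in>Basis. c x * X' b y x) = (\<Sum>b\<in>Basis. integral (cbox a1 a2) (\<lambda>x. c x * X' b y x))"
        by (rule Henstock_Kurzweil_Integration.integral_sum) (auto intro!: integrable_continuous continuous_intros c_cont Xc)
      finally show ?thesis by (simp add: parts sum_negf)
    qed
    have bd: "\<bar>- (\<Sum>b\<in>Basis. integral (cbox a1 a2) (\<lambda>x. c' b x * X b y x))\<bar> \<le> \<epsilon> h * M * measure lborel (cbox a1 a2)" if y: "y \<in> I" for y
    proof -
      have "(\<Sum>b\<in>Basis. integral (cbox a1 a2) (\<lambda>x. c' b x * X b y x)) = integral (cbox a1 a2) (\<lambda>x. \<Sum>b\<in>Basis. c' b x * X b y x)"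
        by (rule Henstock_Kurzweil_Integration.integral_sum[symmetric]) (auto intro!: integrable_continuous continuous_intros c_cont Xc)
      also have "norm \<dots> \<le> \<epsilon> h * M * measure lborel (cbox a1 a2)"
      proof (rule has_integral_bound[OF _ integrable_integral])
        have e0: "0 \<le> \<epsilon> h"
        proof -
          obtain b0 :: 'a where "b0 \<in> Basis" using nonempty_Basis by blast
          then have "\<bar>Phi h (r *\<^sub>R b0, 0)\<bar> \<le> \<epsilon> h" using h r by (intro \<epsilon>1) auto
          then show ?thesis by linarith
        qed
        have M0: "0 \<le> M" if "x \<in> cbox a1 a2" for x using M[OF that y] by linarith
        have "x0 \<in> K" using r by (simp add: K_def)
        then show "0 \<le> \<epsilon> h * M" using e0 M0 box by auto
        show "norm (\<Sum>b\<in>Basis. c' b x * X b y x) \<le> \<epsilon> h * M" if x: "x \<in> cbox a1 a2" for x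
        proof -
          have "\<bar>c' b x * X b y x\<bar> \<le> \<epsilon> h * (\<bar>c' b x\<bar> * (\<bar>g [(b, 0)] (x, y)\<bar> + \<bar>\<psi> (x, y)\<bar>))" if b: "b \<in> Basis" for b
          proof (cases "c' b x = 0")
            case False
            note far = c'_far[OF False]
            have ny: "\<bar>y - y0\<bar> \<le> norm (x - x0) - 1" using far y by (auto simp: I_def r_def)
            have V1: "\<bar>V h [] (x, y)\<bar> \<le> \<epsilon> h" "\<bar>V h [(b, 0)] (x, y)\<bar> \<le> \<epsilon> h"
              using \<epsilon>1[OF h _ ny] \<epsilon>2[OF h _ ny b] far by (auto simp: V_def)
            have "\<bar>X b y x\<bar> \<le> \<bar>V h [] (x, y)\<bar> * \<bar>g [(b, 0)] (x, y)\<bar> + \<bar>\<psi> (x, y)\<bar> * \<bar>V h [(b, 0)] (x, y)\<bar>"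
              unfolding X_def abs_mult[symmetric] by (rule abs_triangle_ineq4)
            also have "\<dots> \<le> \<epsilon> h * \<bar>g [(b, 0)] (x, y)\<bar> + \<bar>\<psi> (x, y)\<bar> * \<epsilon> h"
              by (intro add_mono mult_mono V1) (use e0 in auto)
            finally have "\<bar>X b y x\<bar> \<le> \<epsilon> h * (\<bar>g [(b, 0)] (x, y)\<bar> + \<bar>\<psi> (x, y)\<bar>)" by (simp add: algebra_simps)
            from mult_left_mono[OF this abs_ge_zero[of "c' b x"]] show ?thesis by (simp add: abs_mult mult_ac)
          qed simp
          then have "norm (\<Sum>b\<in>Basis. c' b x * X b y x) \<le> (\<Sum>b\<in>(Basis::'a set). \<epsilon> h * (\<bar>c' b x\<bar> * (\<bar>g [(b, 0)] (x, y)\<bar> + \<bar>\<psi> (x, y)\<bar>)))"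
            by (intro sum_norm_le) auto
          also have "\<dots> = \<epsilon> h * m (x, y)" by (simp add: m_def sum_distrib_left)
          also have "\<dots> \<le> \<epsilon> h * M" using M[OF x y] e0 by (intro mult_left_mono) auto
          finally show ?thesis .
        qed
      qed (auto intro!: integrable_continuous continuous_intros c_cont Xc)
      finally show ?thesis by simp
    qed
    have "norm (A y0 - A 0) \<le> (\<epsilon> h * M * measure lborel (cbox a1 a2)) * norm (y0 - 0)"
    proof (rule field_differentiable_bound[where S=I])
      show "convex I" by (simp add: I_def)
    qed (use Ad bd in \<open>auto simp: I_def\<close>)
    moreover have "A 0 = 0" by (simp add: A_def g0 \<psi>0)
    moreover have "A y0 = - f h"
    proof -
      have "f h = (\<integral>x. c x * (V h [] (x, y0) * g [(0, 1)] (x, y0)) \<partial>lborel)"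
        unfolding f_def V_def by (simp add: Phi_initial[OF h(1)] mult_ac)
      also have "\<dots> = integral (cbox a1 a2) (\<lambda>x. c x * (V h [] (x, y0) * g [(0, 1)] (x, y0)))"
      proof -
        have cc: "continuous_on UNIV (\<lambda>x. c x * (V h [] (x, y0) * g [(0, 1)] (x, y0)))"
          by (intro continuous_intros c_cont continuous_on_compose2[OF Vcont] continuous_on_compose2[OF cont]) auto
        have "c x * (V h [] (x, y0) * g [(0, 1)] (x, y0)) = 0" if "x \<notin> cbox a1 a2" for x using c0 box that by auto
        from integral_compact_support(2,3)[OF cc this refl] show ?thesis by simp
      qed
      finally show ?thesis
        unfolding A_def by (simp add: V_def Phi_deriv_y_zero flip: Henstock_Kurzweil_Integration.integral_neg)
    qed
    ultimately show ?thesis by (simp add: mult_ac)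
  qed
  have "(f \<longlongrightarrow> c x0 * g [(0, 1)] (x0, y0)) (at_right 0)"
  proof -
    have cc: "continuous_on UNIV (\<lambda>x. c x * g [(0, 1)] (x, y0))"
      by (intro continuous_intros c_cont continuous_on_compose2[OF cont]) auto
    have "bounded ((\<lambda>x. c x * g [(0, 1)] (x, y0)) ` K)"
      by (rule compact_imp_bounded, rule compact_continuous_image[OF continuous_on_subset[OF cc] K(1)]) simp
    then obtain B where B: "\<And>x. x \<in> K \<Longrightarrow> \<bar>c x * g [(0, 1)] (x, y0)\<bar> \<le> B" unfolding bounded_iff by fastforce
    have "\<bar>c x * g [(0, 1)] (x, y0)\<bar> \<le> \<bar>B\<bar>" for x
      using B[of x] c0[of x] by (cases "x \<in> K") auto
    from gaussian_approx_identity[OF cc this, of x0] show ?thesis unfolding f_def[abs_def] .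
  qed
  moreover have "(f \<longlongrightarrow> 0) (at_right 0)"
  proof (rule Lim_null_comparison)
    show "((\<lambda>h. \<epsilon> h * (M * measure lborel (cbox a1 a2) * \<bar>y0\<bar>)) \<longlongrightarrow> 0) (at_right 0)"
      by (rule tendsto_mult_left_zero[OF \<epsilon>])
    have "\<forall>\<^sub>F h::real in at_right 0. 0 < h \<and> h \<le> 1"
      by (auto simp: eventually_at_right_field intro!: exI[of _ 1])
    then show "\<forall>\<^sub>F h in at_right 0. norm (f h) \<le> \<epsilon> h * (M * measure lborel (cbox a1 a2) * \<bar>y0\<bar>)"
      by eventually_elim (use est in auto)
  qed
  ultimately have "c x0 * g [(0, 1)] (x0, y0) = 0"
    using tendsto_unique trivial_limit_at_right_real by blast
  moreover have "c x0 = 1" unfolding c_def using r by (intro ramp_eq_1) simp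
  ultimately show ?thesis by simp
qed

lemma harmonic_Cauchy_unique:
  fixes \<psi> :: "'a::euclidean_space \<times> real \<Rightarrow> real"
  assumes fam: "deriv_family_on UNIV \<psi> g"
    and harmonic: "\<And>z. (\<Sum>b\<in>Basis. g [b, b] z) = 0"
    and g0: "\<And>x. g [(0, 1)] (x, 0) = 0" and \<psi>0: "\<And>x. \<psi> (x, 0) = 0"
  shows "\<psi> (x, y) = 0"
proof -
  have "(\<psi> has_derivative (\<lambda>v. g [v] z)) (at z)" for z
  proof -
    have "\<psi> = g []" using fam by (auto simp: deriv_family_on_def)
    then show ?thesis using fam unfolding deriv_family_on_def by blast
  qed
  then have "((\<lambda>y. \<psi> (x, y)) has_real_derivative g [(0, 1)] (x, y)) (at y)" for y
    using has_derivative_line[of \<psi> "\<lambda>v. g [v] (x, y)" "(x, 0)" y "(0, 1)" UNIV] by simp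
  then have "\<forall>y. DERIV (\<lambda>y. \<psi> (x, y)) y :> 0"
    using harmonic_Cauchy_unique_y[OF assms] by simp
  from DERIV_isconst_all[OF this, of y 0] show ?thesis by (simp add: \<psi>0)
qed

lemma phi_eq_Phi:
  assumes h: "h > 0"
  shows "phi h = (Phi h :: (real^'m::finite) \<times> real \<Rightarrow> real)"
proof -
  let ?Q = "\<lambda>\<phi>. C_inf_on UNIV \<phi> \<and>
      (\<exists>g. deriv_family_on UNIV \<phi> g \<and>
          (\<forall>z. (\<Sum>b\<in>(Basis :: ((real^'m) \<times> real) set). g [b, b] z) = 0) \<and>
          (\<forall>x. g [(0, 1)] (x, 0) = 0)) \<and>
      (\<forall>x. \<phi> (x, 0) = (pi * h) powr (- real CARD('m) / 2) * exp (- (norm x)\<^sup>2 / h))"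
  have Q: "?Q (Phi h)"
    using Phi_deriv_family[OF h] Phi_harmonic[OF h] Phi_deriv_y_zero[of h] Phi_initial[OF h, where 'a="real^'m"]
    unfolding C_inf_on_def by auto
  have "\<phi> = Phi h" if "?Q \<phi>" for \<phi>
  proof -
    from that obtain g where g: "deriv_family_on UNIV \<phi> g" "\<And>z. (\<Sum>b\<in>(Basis :: ((real^'m) \<times> real) set). g [b, b] z) = 0"
      "\<And>x. g [(0, 1)] (x, 0) = 0" by blast
    have "deriv_family_on UNIV (\<lambda>z. \<phi> z + (-1) * Phi h z) (\<lambda>vs z. g vs z + (-1) * Phi_deriv h vs z)"
      by (intro deriv_family_on_add deriv_family_on_cmult g Phi_deriv_family h)
    from harmonic_Cauchy_unique[OF this]
    have "\<phi> (x, y) + (-1) * Phi h (x, y) = 0" for x y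
      using g Phi_harmonic[OF h, where 'a="real^'m"] Q that
      by (simp add: Phi_deriv_y_zero sum_subtractf)
    then show ?thesis by (auto simp: fun_eq_iff)
  qed
  then show ?thesis unfolding phi_def by (rule the_equality[where P="?Q", OF Q])
qed

subsection \<open>The Gaussian beam as a smooth solution of the wave equation\<close>

lemma periodic_integral_shift:
  fixes H :: "complex \<Rightarrow> complex"
  assumes hol: "H holomorphic_on UNIV" and per: "\<And>z. H (z + 2 * of_real pi) = H z"
  shows "integral {-pi..pi} (\<lambda>\<theta>. H (of_real \<theta> + \<sigma>)) = integral {-pi..pi} (\<lambda>\<theta>. H (of_real \<theta> + \<tau>))"
proof -
  have d: "(H has_field_derivative deriv H z) (at z within S)" for z S
    using holomorphic_derivI[OF hol open_UNIV UNIV_I] .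
  have c: "continuous_on S H" "continuous_on S (deriv H)" for S
    using hol holomorphic_deriv[OF hol open_UNIV] holomorphic_on_imp_continuous_on continuous_on_subset subset_UNIV by blast+
  have "((\<lambda>\<sigma>. integral (cbox (-pi) pi) (\<lambda>\<theta>. H (of_real \<theta> + \<sigma>))) has_field_derivative 0) (at \<sigma> within UNIV)" for \<sigma>
  proof -
    have "((\<lambda>\<sigma>. integral (cbox (-pi) pi) (\<lambda>\<theta>. H (of_real \<theta> + \<sigma>))) has_field_derivative integral (cbox (-pi) pi) (\<lambda>\<theta>. deriv H (of_real \<theta> + \<sigma>))) (at \<sigma> within UNIV)"
    proof (rule leibniz_rule_field_derivative[where fx="\<lambda>\<sigma> \<theta>. deriv H (of_real \<theta> + \<sigma>)"])
      show "((\<lambda>\<sigma>. H (of_real \<theta> + \<sigma>)) has_field_derivative deriv H (of_real \<theta> + \<sigma>)) (at \<sigma> within UNIV)" for \<sigma> \<theta>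
        by (rule DERIV_cong[OF DERIV_chain2[where g="\<lambda>\<sigma>. of_real \<theta> + \<sigma>", OF d]]) (auto intro!: derivative_eq_intros)
      show "(\<lambda>\<theta>. H (of_real \<theta> + \<sigma>)) integrable_on cbox (-pi) pi" for \<sigma>
        by (intro integrable_continuous continuous_on_compose2[OF c(1)] continuous_intros) auto
      show "continuous_on (UNIV \<times> cbox (-pi) pi) (\<lambda>(\<sigma>, \<theta>). deriv H (of_real \<theta> + \<sigma>))"
        unfolding split_beta by (intro continuous_on_compose2[OF c(2)] continuous_intros) auto
    qed auto
    moreover have "((\<lambda>\<theta>. deriv H (of_real \<theta> + \<sigma>)) has_integral (H (of_real pi + \<sigma>) - H (of_real (-pi) + \<sigma>))) {-pi..pi}"
    proof (rule fundamental_theorem_of_calculus)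
      fix \<theta> :: real
      have "((\<lambda>z. H (z + \<sigma>)) has_field_derivative deriv H (of_real \<theta> + \<sigma>)) (at (of_real \<theta>))"
        by (rule DERIV_cong[OF DERIV_chain2[where g="\<lambda>z. z + \<sigma>", OF d]]) (auto intro!: derivative_eq_intros)
      from has_vector_derivative_real_field[OF this]
      show "((\<lambda>\<theta>. H (of_real \<theta> + \<sigma>)) has_vector_derivative deriv H (of_real \<theta> + \<sigma>)) (at \<theta> within {-pi..pi})"
        by (simp add: has_vector_derivative_at_within)
    qed simp
    moreover have "H (of_real pi + \<sigma>) = H (of_real (-pi) + \<sigma>)"
      using per[of "of_real (-pi) + \<sigma>"] by (simp add: algebra_simps)
    ultimately show ?thesis by (simp add: integral_unique)
  qed
  from has_field_derivative_zero_constant[OF convex_UNIV this]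
  obtain k where "\<And>\<sigma>. integral (cbox (-pi) pi) (\<lambda>\<theta>. H (of_real \<theta> + \<sigma>)) = k" by blast
  then show ?thesis by simp
qed

lemma integral_sin_symmetric:
  fixes F :: "real \<Rightarrow> real"
  assumes F: "continuous_on UNIV F"
  shows "integral {-pi..pi} (\<lambda>\<theta>. F (sin \<theta>)) = 2 * integral {0..pi/2} (\<lambda>\<theta>. F (sin \<theta>) + F (- sin \<theta>))"
proof -
  define I where "I = integral {0..pi/2} (\<lambda>\<theta>. F (sin \<theta>))"
  define J where "J = integral {0..pi/2} (\<lambda>\<theta>. F (- sin \<theta>))"
  have i: "(\<lambda>\<theta>. F (sin \<theta>)) integrable_on {0..pi/2}" "(\<lambda>\<theta>. F (- sin \<theta>)) integrable_on {0..pi/2}"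
    by (intro integrable_continuous_real continuous_on_compose2[OF F] continuous_intros; simp)+
  have 1: "((\<lambda>\<theta>. F (sin \<theta>)) has_integral I) (cbox 0 (pi/2))" using i by (simp add: I_def integrable_integral)
  have 2: "((\<lambda>\<theta>. F (- sin \<theta>)) has_integral J) (cbox 0 (pi/2))" using i by (simp add: J_def integrable_integral)
  have 3: "((\<lambda>\<theta>. F (sin \<theta>)) has_integral I) {pi/2..pi}"
  proof -
    have "(\<lambda>x::real. (1 / - 1) *\<^sub>R x + - ((1 / - 1) *\<^sub>R pi)) ` cbox 0 (pi / 2) = {pi/2..pi}"
      by (auto simp: image_iff intro!: bexI[where x="pi - x" for x]) 
    then show ?thesis using has_integral_affinity[OF 1, of "-1" pi] by simp
  qed
  have 4: "((\<lambda>\<theta>. F (sin \<theta>)) has_integral J) {-(pi/2)..0}"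
  proof -
    have "(\<lambda>x::real. (1 / - 1) *\<^sub>R x + - ((1 / - 1) *\<^sub>R 0)) ` cbox 0 (pi / 2) = {-(pi/2)..0}"
      by (auto simp: image_iff intro!: bexI[where x="- x" for x])
    then show ?thesis using has_integral_affinity[OF 2, of "-1" 0] by simp
  qed
  have 5: "((\<lambda>\<theta>. F (sin \<theta>)) has_integral J) {-pi..-(pi/2)}"
  proof -
    have "(\<lambda>x::real. (1 / 1) *\<^sub>R x + - ((1 / 1) *\<^sub>R pi)) ` cbox 0 (pi / 2) = {-pi..-(pi/2)}"
      by (auto simp: image_iff intro!: bexI[where x="x + pi" for x])
    then show ?thesis using has_integral_affinity[OF 2, of 1 pi] by simp
  qed
  have "((\<lambda>\<theta>. F (sin \<theta>)) has_integral (((J + J) + I) + I)) {-pi..pi}"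
    using 1 3 4 5
    by (intro has_integral_combine[of "-pi" "pi/2" pi] has_integral_combine[of "-pi" 0 "pi/2"] has_integral_combine[of "-pi" "-(pi/2)" 0]) auto
  moreover have "integral {0..pi/2} (\<lambda>\<theta>. F (sin \<theta>) + F (- sin \<theta>)) = I + J"
    using i by (simp add: I_def J_def Henstock_Kurzweil_Integration.integral_add)
  ultimately show ?thesis by (simp add: integral_unique)
qed

definition wave_exp :: "'a::euclidean_space \<times> real \<Rightarrow> 'a \<times> real \<times> real \<Rightarrow> complex" where
  "wave_exp s z = of_real (norm (fst s) * (fst (snd z) * cos (snd s)))
     + \<i> * of_real (fst s \<bullet> fst z + norm (fst s) * (snd (snd z) * sin (snd s)))"

definition wave_amp :: "real \<Rightarrow> 'a::euclidean_space \<times> real \<Rightarrow> complex" where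
  "wave_amp h s = gauss_amp h (fst s) * of_real (indicator {-pi..pi} (snd s) / (4 * pi))"

interpretation wave: exp_superposition lborel "wave_exp :: 'a::euclidean_space \<times> real \<Rightarrow> _" "\<lambda>s. 3 * norm (fst s)"
proof (rule exp_superposition.intro)
  show "linear (wave_exp s)" for s :: "'a \<times> real"
    by (rule linearI) (simp_all add: wave_exp_def algebra_simps scaleR_conv_of_real inner_add_right)
  show "norm (wave_exp s z) \<le> 3 * norm (fst s) * norm z" for s :: "'a \<times> real" and z
  proof -
    obtain \<xi> \<theta> x y t where sz: "s = (\<xi>, \<theta>)" "z = (x, y, t)" by (metis surj_pair)
    have n: "norm x \<le> norm z" "\<bar>y\<bar> \<le> norm z" "\<bar>t\<bar> \<le> norm z"
      using norm_fst_le[of x "(y, t)"] norm_snd_le[of "(y, t)" x] norm_fst_le[of y t] norm_snd_le[of t y] by (auto simp: sz)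
    have "norm (wave_exp s z) \<le> norm (of_real (norm \<xi> * (y * cos \<theta>)) :: complex) + norm (\<i> * of_real (\<xi> \<bullet> x + norm \<xi> * (t * sin \<theta>)))"
      unfolding wave_exp_def sz fst_conv snd_conv by (rule norm_triangle_ineq)
    also have "\<dots> = \<bar>norm \<xi> * (y * cos \<theta>)\<bar> + \<bar>\<xi> \<bullet> x + norm \<xi> * (t * sin \<theta>)\<bar>"
      by (simp only: norm_mult norm_ii norm_of_real mult_1_left)
    also have "\<dots> \<le> norm \<xi> * (\<bar>y\<bar> * \<bar>cos \<theta>\<bar>) + (\<bar>\<xi> \<bullet> x\<bar> + norm \<xi> * (\<bar>t\<bar> * \<bar>sin \<theta>\<bar>))"
      using abs_triangle_ineq[of "\<xi> \<bullet> x" "norm \<xi> * (t * sin \<theta>)"] by (simp add: abs_mult)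
    also have "\<dots> \<le> norm \<xi> * (norm z * 1) + (norm \<xi> * norm z + norm \<xi> * (norm z * 1))"
      using order_trans[OF Cauchy_Schwarz_ineq2 mult_left_mono[OF n(1) norm_ge_zero], of \<xi>] n
      by (intro add_mono mult_left_mono mult_mono) auto
    finally show ?thesis by (simp add: sz)
  qed
  show "(\<lambda>s. wave_exp s z) \<in> borel_measurable lborel" for z :: "'a \<times> real \<times> real"
  proof -
    have "(\<lambda>s. wave_exp s z) \<in> borel_measurable borel"
      unfolding wave_exp_def by (intro borel_measurable_continuous_onI continuous_intros)
    then show ?thesis by simp
  qed
  show "(\<lambda>s::'a \<times> real. 3 * norm (fst s)) \<in> borel_measurable lborel" 
  proof -
    have "(\<lambda>s::'a \<times> real. 3 * norm (fst s)) \<in> borel_measurable borel"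
      by (intro borel_measurable_continuous_onI continuous_intros)
    then show ?thesis by simp
  qed
qed auto

lemma integrable_lborel_prod_mult:
  fixes f :: "'a::euclidean_space \<Rightarrow> real" and g :: "'b::euclidean_space \<Rightarrow> real"
  assumes f: "integrable lborel f" and g: "integrable lborel g"
  shows "integrable lborel (\<lambda>s. f (fst s) * g (snd s))"
proof -
  have [measurable]: "f \<in> borel_measurable borel" "g \<in> borel_measurable borel" using f g by auto
  have "integrable (lborel \<Otimes>\<^sub>M lborel) (\<lambda>s. f (fst s) * g (snd s))"
  proof (rule lborel_pair.Fubini_integrable)
    show "integrable lborel (\<lambda>x. \<integral>y. norm (f (fst (x, y)) * g (snd (x, y))) \<partial>lborel)"
      using f by (simp add: abs_mult)
    show "AE x in lborel. integrable lborel (\<lambda>y. f (fst (x, y)) * g (snd (x, y)))"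
      using g by simp
  qed measurable
  then show ?thesis by (simp add: lborel_prod)
qed

lemma wave_amp_measurable[measurable]: "(wave_amp h :: 'a::euclidean_space \<times> real \<Rightarrow> _) \<in> borel_measurable borel"
  unfolding wave_amp_def[abs_def] borel_prod[symmetric] by measurable

lemma wave_amp_amplitude:
  assumes h: "h > 0"
  shows "wave.amplitude (wave_amp h :: 'a::euclidean_space \<times> real \<Rightarrow> _)"
  unfolding wave.amplitude_def
proof (intro conjI allI)
  fix N :: nat
  have f: "integrable lborel (\<lambda>\<xi>::'a. (1 / (2 * pi)) ^ DIM('a) * exp (- (h / 4) * (norm \<xi>)\<^sup>2 + real (3 * N) * norm \<xi>))"
    using h by (intro integrable_mult_right integrable_gaussian_exp) simp
  have g: "integrable lborel (\<lambda>\<theta>::real. indicator {-pi..pi} \<theta> / (4 * pi))"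
    by simp
  have "(\<lambda>s. ((1 / (2 * pi)) ^ DIM('a) * exp (- (h / 4) * (norm (fst s))\<^sup>2 + real (3 * N) * norm (fst s))) * (indicator {-pi..pi} (snd s) / (4 * pi)))
      = (\<lambda>s::'a \<times> real. norm (wave_amp h s) * exp (real N * (3 * norm (fst s))))"
    unfolding exp_add by (simp add: wave_amp_def gauss_amp_def fun_eq_iff norm_mult norm_power norm_divide mult_ac)
  then show "integrable lborel (\<lambda>s::'a \<times> real. norm (wave_amp h s) * exp (real N * (3 * norm (fst s))))"
    using integrable_lborel_prod_mult[OF f g] by (simp only:)
qed simp

definition beam_deriv :: "real \<Rightarrow> ('a::euclidean_space \<times> real \<times> real) list \<Rightarrow> 'a \<times> real \<times> real \<Rightarrow> real" where
  "beam_deriv h vs z = Re (wave.superpos (\<lambda>s. wave_amp h s * (\<Prod>v\<leftarrow>vs. wave_exp s v)) z)"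

abbreviation "beam h \<equiv> beam_deriv h []"

lemma beam_deriv_has_derivative:
  "h > 0 \<Longrightarrow> (beam_deriv h vs has_derivative (\<lambda>v. beam_deriv h (v # vs) z)) (at z)"
  using wave.superpos_deriv_family[OF wave_amp_amplitude, of h]
  unfolding deriv_family_on_def beam_deriv_def[abs_def] by blast

lemma beam_deriv_continuous: "h > 0 \<Longrightarrow> continuous_on S (beam_deriv h vs)"
  by (meson beam_deriv_has_derivative continuous_at_imp_continuous_on has_derivative_continuous)

lemma beam_wave_equation:
  assumes h: "h > 0"
  shows "beam_deriv h [(0, 0, 1), (0, 0, 1)] z
    = beam_deriv h [(0, 1, 0), (0, 1, 0)] z + (\<Sum>b\<in>(Basis :: 'a::euclidean_space set). beam_deriv h [(b, 0, 0), (b, 0, 0)] z)"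
proof -
  have amp: "wave.amplitude (\<lambda>s. wave_amp h s * (wave_exp s v * wave_exp s v))" for v :: "'a \<times> real \<times> real"
    using wave.amplitude_prod[OF wave_amp_amplitude[OF h], of "[v, v]"] by simp
  have eq: "wave_exp s (0, 0, 1) * wave_exp s (0, 0, 1)
      = wave_exp s (0, 1, 0) * wave_exp s (0, 1, 0) + (\<Sum>b\<in>Basis. wave_exp s (b, 0, 0) * wave_exp s (b, 0, 0))" for s :: "'a \<times> real"
  proof -
    have n: "(\<Sum>b\<in>Basis. (fst s \<bullet> b) * (fst s \<bullet> b)) = norm (fst s) * norm (fst s)"
      using euclidean_inner[of "fst s" "fst s"] by (simp add: dot_square_norm power2_eq_square)
    have "norm (fst s) * sin (snd s) * (norm (fst s) * sin (snd s)) = norm (fst s) * norm (fst s) - norm (fst s) * cos (snd s) * (norm (fst s) * cos (snd s))"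
    proof -
      have "norm (fst s) * sin (snd s) * (norm (fst s) * sin (snd s)) + norm (fst s) * cos (snd s) * (norm (fst s) * cos (snd s))
         = (norm (fst s))\<^sup>2 * ((sin (snd s))\<^sup>2 + (cos (snd s))\<^sup>2)" by (simp only: power2_eq_square distrib_left mult_ac)
      then show ?thesis unfolding sin_cos_squared_add power2_eq_square[of "norm (fst s)"] by linarith
    qed
    then show ?thesis by (simp add: wave_exp_def complex_eq_iff sum_negf n)
  qed
  have i: "integrable lborel (\<lambda>s. wave_amp h s * (wave_exp s v * wave_exp s v) * exp (wave_exp s z))" for v
    by (rule wave.superpos_integrable[OF amp])
  have i': "integrable lborel (\<lambda>s. wave_amp h s * (\<Sum>b\<in>Basis. wave_exp s (b, 0, 0) * wave_exp s (b, 0, 0)) * exp (wave_exp s z))"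
    using i by (auto simp: sum_distrib_left sum_distrib_right intro!: Bochner_Integration.integrable_sum)
  have "wave.superpos (\<lambda>s. wave_amp h s * (wave_exp s (0, 0, 1) * wave_exp s (0, 0, 1))) z
    = wave.superpos (\<lambda>s. wave_amp h s * (wave_exp s (0, 1, 0) * wave_exp s (0, 1, 0))) z
      + wave.superpos (\<lambda>s. wave_amp h s * (\<Sum>b\<in>Basis. wave_exp s (b, 0, 0) * wave_exp s (b, 0, 0))) z"
    unfolding eq wave.superpos_def using i i' by (simp add: distrib_left distrib_right)
  also have "wave.superpos (\<lambda>s. wave_amp h s * (\<Sum>b\<in>Basis. wave_exp s (b, 0, 0) * wave_exp s (b, 0, 0))) z
    = (\<Sum>b\<in>Basis. wave.superpos (\<lambda>s. wave_amp h s * (wave_exp s (b, 0, 0) * wave_exp s (b, 0, 0))) z)"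
    unfolding sum_distrib_left by (rule wave.superpos_sum[symmetric]) (auto intro: amp)
  finally show ?thesis by (simp add: beam_deriv_def)
qed

definition Phi_complex :: "real \<Rightarrow> 'a::euclidean_space \<Rightarrow> complex \<Rightarrow> complex" where
  "Phi_complex h x \<zeta> = (\<integral>\<xi>. gauss_amp h \<xi> * exp (of_real (norm \<xi>) * \<zeta> + \<i> * of_real (\<xi> \<bullet> x)) \<partial>lborel)"

lemma Phi_complex_holomorphic:
  assumes h: "h > 0"
  shows "Phi_complex h (x :: 'a::euclidean_space) holomorphic_on UNIV"
  unfolding Phi_complex_def[abs_def]
proof (rule holomorphic_integral)
  show "(\<lambda>\<zeta>. gauss_amp h \<xi> * exp (of_real (norm \<xi>) * \<zeta> + \<i> * of_real (\<xi> \<bullet> x))) holomorphic_on UNIV" for \<xi> :: 'a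
    by (intro holomorphic_intros)
  show "(\<lambda>\<xi>. gauss_amp h \<xi> * exp (of_real (norm \<xi>) * \<zeta> + \<i> * of_real (\<xi> \<bullet> x))) \<in> borel_measurable lborel" for \<zeta>
    by measurable
  fix R :: real
  obtain N :: nat where N: "R \<le> N" using real_arch_simple by blast
  have "integrable lborel (\<lambda>\<xi>::'a. norm (gauss_amp h \<xi>) * exp (N * (2 * norm \<xi>)))"
    using gauss_amp_amplitude[OF h] unfolding harm.amplitude_def by blast
  moreover have "norm (gauss_amp h \<xi> * exp (of_real (norm \<xi>) * \<zeta> + \<i> * of_real (\<xi> \<bullet> x))) \<le> norm (gauss_amp h \<xi>) * exp (N * (2 * norm \<xi>))"
    if "norm \<zeta> \<le> R" for \<zeta> and \<xi> :: 'a
  proof -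
    have "Re \<zeta> \<le> 2 * N" using complex_Re_le_cmod[of \<zeta>] norm_ge_zero[of \<zeta>] that N by linarith
    then have "norm \<xi> * Re \<zeta> \<le> norm \<xi> * (2 * N)" by (intro mult_left_mono) auto
    then show ?thesis by (simp add: norm_mult mult_left_mono mult_ac)
  qed
  ultimately show "\<exists>B. integrable lborel B \<and> (\<forall>\<zeta> \<xi>. norm \<zeta> \<le> R \<longrightarrow> norm (gauss_amp h (\<xi>::'a) * exp (of_real (norm \<xi>) * \<zeta> + \<i> * of_real (\<xi> \<bullet> x))) \<le> B \<xi>)"
    by blast
qed

lemma Phi_eq_Phi_complex: "Phi h (x, y) = Re (Phi_complex h x (of_real y) + Phi_complex h x (- of_real y)) / 2"
  by (simp add: Phi_deriv_def harm.superpos_def Phi_complex_def plane_exp_def reflect_def)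

lemma beam_eq_circle_integral:
  assumes h: "h > 0"
  shows "wave.superpos (wave_amp h) (x :: 'a::euclidean_space, y, t)
    = integral {-pi..pi} (\<lambda>\<theta>. Phi_complex h x (of_real (y * cos \<theta>) + \<i> * of_real (t * sin \<theta>))) / (4 * of_real pi)"
proof -
  let ?Z = "\<lambda>\<theta>. of_real (y * cos \<theta>) + \<i> * of_real (t * sin \<theta>) :: complex"
  have int: "integrable (lborel \<Otimes>\<^sub>M lborel) (\<lambda>(\<xi>::'a, \<theta>). wave_amp h (\<xi>, \<theta>) * exp (wave_exp (\<xi>, \<theta>) (x, y, t)))"
    using wave.superpos_integrable[OF wave_amp_amplitude[OF h], of "(x, y, t)"] by (simp add: lborel_prod case_prod_unfold)
  have "wave.superpos (wave_amp h) (x, y, t) = (\<integral>\<theta>. (\<integral>\<xi>. wave_amp h (\<xi>, \<theta>) * exp (wave_exp (\<xi>, \<theta>) (x, y, t)) \<partial>lborel) \<partial>lborel)"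
    using lborel_pair.integral_snd[OF int] unfolding wave.superpos_def by (simp add: lborel_prod case_prod_unfold)
  also have "\<dots> = (\<integral>\<theta>. indicator {-pi..pi} \<theta> *\<^sub>R (Phi_complex h x (?Z \<theta>) / (4 * of_real pi)) \<partial>lborel)"
  proof (intro Bochner_Integration.integral_cong refl)
    fix \<theta> :: real
    have "wave_amp h (\<xi>, \<theta>) * exp (wave_exp (\<xi>, \<theta>) (x, y, t))
       = of_real (indicator {-pi..pi} \<theta> / (4 * pi)) * (gauss_amp h \<xi> * exp (of_real (norm \<xi>) * ?Z \<theta> + \<i> * of_real (\<xi> \<bullet> x)))" for \<xi>
      by (simp add: wave_amp_def wave_exp_def algebra_simps)
    then have "(\<integral>\<xi>. wave_amp h (\<xi>, \<theta>) * exp (wave_exp (\<xi>, \<theta>) (x, y, t)) \<partial>lborel) = of_real (indicator {-pi..pi} \<theta> / (4 * pi)) * Phi_complex h x (?Z \<theta>)"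
      unfolding Phi_complex_def by simp
    then show "(\<integral>\<xi>. wave_amp h (\<xi>, \<theta>) * exp (wave_exp (\<xi>, \<theta>) (x, y, t)) \<partial>lborel) = indicator {-pi..pi} \<theta> *\<^sub>R (Phi_complex h x (?Z \<theta>) / (4 * of_real pi))"
      by (simp add: scaleR_conv_of_real)
  qed
  also have "\<dots> = integral {-pi..pi} (\<lambda>\<theta>. Phi_complex h x (?Z \<theta>) / (4 * of_real pi))"
  proof -
    have "continuous_on {-pi..pi} (\<lambda>\<theta>. Phi_complex h x (?Z \<theta>) / (4 * of_real pi))"
      by (intro continuous_intros continuous_on_compose2[OF holomorphic_on_imp_continuous_on[OF Phi_complex_holomorphic[OF h]]]) auto
    from set_borel_integral_eq_integral(2)[OF borel_integrable_atLeastAtMost'[OF this]]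
    show ?thesis unfolding set_lebesgue_integral_def .
  qed
  finally show ?thesis by simp
qed

lemma beam_average:
  assumes h: "h > 0" and ty: "\<bar>t\<bar> < y"
  shows "beam h (x :: 'a::euclidean_space, y, t) = (1 / pi) * integral {0..pi/2} (\<lambda>s. Phi h (x, sqrt (y\<^sup>2 - t\<^sup>2) * sin s))"
proof -
  define \<rho> where "\<rho> = sqrt (y\<^sup>2 - t\<^sup>2)"
  define \<tau> where "\<tau> = arsinh (t / \<rho>)"
  define H where "H z = Phi_complex h x (of_real \<rho> * cos z)" for z
  have t2: "t\<^sup>2 < y\<^sup>2" using power_strict_mono[OF ty, of 2] by simp
  have \<rho>: "\<rho> > 0" "\<rho>\<^sup>2 = y\<^sup>2 - t\<^sup>2" using t2 by (simp_all add: \<rho>_def)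
  have s: "\<rho> * sinh \<tau> = t" using \<rho> by (simp add: \<tau>_def)
  have "(\<rho> * cosh \<tau>)\<^sup>2 = y\<^sup>2"
  proof -
    have "(\<rho> * cosh \<tau>)\<^sup>2 = \<rho>\<^sup>2 + (\<rho> * sinh \<tau>)\<^sup>2"
      unfolding power_mult_distrib cosh_square_eq by (simp add: distrib_left)
    then show ?thesis using s \<rho> by simp
  qed
  then have c: "\<rho> * cosh \<tau> = y"
  proof (rule power2_eq_imp_eq)
    show "0 \<le> \<rho> * cosh \<tau>" using \<rho>(1) by (intro mult_nonneg_nonneg) auto
    show "0 \<le> y" using ty by linarith
  qed
  have cs: "continuous_on S (Phi_complex h x)" for S
    using holomorphic_on_imp_continuous_on[OF Phi_complex_holomorphic[OF h]] continuous_on_subset by blast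
  have H: "H holomorphic_on UNIV"
  proof -
    have "(\<lambda>z. of_real \<rho> * cos z) holomorphic_on UNIV" by (intro holomorphic_intros)
    from holomorphic_on_compose_gen[OF this Phi_complex_holomorphic[OF h]] show ?thesis
      unfolding H_def[abs_def] by (simp add: o_def)
  qed
  have per: "H (z + 2 * of_real pi) = H z" for z by (simp add: H_def cos_add)
  have "of_real \<rho> * cos (of_real \<theta> + - \<i> * of_real \<tau>) = of_real (y * cos \<theta>) + \<i> * of_real (t * sin \<theta>)" for \<theta>
  proof -
    have ct: "cos (\<i> * of_real \<tau>) = (of_real (cosh \<tau>) :: complex)" and st: "sin (\<i> * of_real \<tau>) = (\<i> * of_real (sinh \<tau>) :: complex)"
      by (simp_all add: cos_exp_eq sin_exp_eq cosh_def sinh_def scaleR_conv_of_real exp_of_real[symmetric] mult.assoc[symmetric] field_simps)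
    have "cos (of_real \<theta> + - \<i> * of_real \<tau>) = cos (of_real \<theta> :: complex) * cos (\<i> * of_real \<tau>) + sin (of_real \<theta>) * sin (\<i> * of_real \<tau>)"
      using cos_diff[of "of_real \<theta> :: complex" "\<i> * of_real \<tau>"] by simp
    then have "of_real \<rho> * cos (of_real \<theta> + - \<i> * of_real \<tau>) = of_real (\<rho> * cosh \<tau>) * of_real (cos \<theta>) + \<i> * (of_real (\<rho> * sinh \<tau>) * of_real (sin \<theta>))"
      unfolding ct st by (simp add: cos_of_real sin_of_real algebra_simps)
    then show ?thesis unfolding c s by simp
  qed
  then have "integral {-pi..pi} (\<lambda>\<theta>. Phi_complex h x (of_real (y * cos \<theta>) + \<i> * of_real (t * sin \<theta>)))
      = integral {-pi..pi} (\<lambda>\<theta>. H (of_real \<theta> + - \<i> * of_real \<tau>))" by (simp add: H_def)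
  also have "\<dots> = integral {-pi..pi} (\<lambda>\<theta>. H (of_real \<theta> + of_real (- (pi / 2))))"
    by (rule periodic_integral_shift[OF H per])
  also have "(\<lambda>\<theta>. H (of_real \<theta> + of_real (- (pi / 2)))) = (\<lambda>\<theta>. Phi_complex h x (of_real (\<rho> * sin \<theta>)))"
  proof
    fix \<theta> :: real
    have "cos (\<theta> + - (pi / 2)) = sin \<theta>" by (simp add: cos_diff)
    then have "cos (of_real \<theta> + of_real (- (pi / 2)) :: complex) = of_real (sin \<theta>)"
      by (metis cos_of_real of_real_add)
    then show "H (of_real \<theta> + of_real (- (pi / 2))) = Phi_complex h x (of_real (\<rho> * sin \<theta>))" by (simp add: H_def)
  qed
  finally have "beam h (x, y, t) = Re (integral {-pi..pi} (\<lambda>\<theta>. Phi_complex h x (of_real (\<rho> * sin \<theta>)))) / (4 * pi)"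
    using beam_eq_circle_integral[OF h, of x y t] by (simp add: beam_deriv_def)
  also have "Re (integral {-pi..pi} (\<lambda>\<theta>. Phi_complex h x (of_real (\<rho> * sin \<theta>)))) = integral {-pi..pi} (\<lambda>\<theta>. Re (Phi_complex h x (of_real (\<rho> * sin \<theta>))))"
    by (rule integral_linear[OF _ bounded_linear_Re, unfolded o_def, symmetric])
      (intro integrable_continuous_real continuous_on_compose2[OF cs[of UNIV]] continuous_intros subset_UNIV)
  also have "\<dots> = 2 * integral {0..pi/2} (\<lambda>\<theta>. Re (Phi_complex h x (of_real (\<rho> * sin \<theta>))) + Re (Phi_complex h x (of_real (\<rho> * - sin \<theta>))))"
    by (rule integral_sin_symmetric[of "\<lambda>s. Re (Phi_complex h x (of_real (\<rho> * s)))"])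
      (intro continuous_intros continuous_on_compose2[OF cs[of UNIV]] subset_UNIV)
  also have "(\<lambda>\<theta>. Re (Phi_complex h x (of_real (\<rho> * sin \<theta>))) + Re (Phi_complex h x (of_real (\<rho> * - sin \<theta>)))) = (\<lambda>\<theta>. 2 * Phi h (x, \<rho> * sin \<theta>))"
    by (simp add: fun_eq_iff Phi_eq_Phi_complex)
  also have "2 * integral {0..pi/2} (\<lambda>\<theta>. 2 * Phi h (x, \<rho> * sin \<theta>)) = 4 * integral {0..pi/2} (\<lambda>\<theta>. Phi h (x, \<rho> * sin \<theta>))" by simp
  finally show ?thesis by (simp add: \<rho>_def)
qed

lemma beam_cone:
  assumes h: "h > 0" and y: "y \<ge> 0"
  shows "beam h (x :: 'a::euclidean_space, y, y) = Phi h (x, 0) / 2"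
proof -
  define f where "f e = beam h (x, y + e, y)" for e
  define k where "k e = (1 / pi) * integral (cbox 0 (pi/2)) (\<lambda>s. Phi h (x, sqrt ((y + e)\<^sup>2 - y\<^sup>2) * sin s))" for e
  have fc: "continuous_on {0..1} f" unfolding f_def[abs_def]
    by (intro continuous_on_compose2[OF beam_deriv_continuous[OF h, of UNIV]] continuous_intros subset_UNIV)
  have kc: "continuous_on {0..1} k" unfolding k_def[abs_def]
    by (intro continuous_on_mult continuous_on_const integral_continuous_on_param, unfold split_beta,
        intro continuous_on_compose2[OF Phi_deriv_continuous[OF h, of UNIV]] continuous_intros subset_UNIV)
  have eq: "f e = k e" if "e > 0" for e
    using beam_average[OF h, of y "y + e" x] that y by (simp add: f_def k_def)
  have f0: "(f \<longlongrightarrow> f 0) (at_right 0)" and k0: "(k \<longlongrightarrow> k 0) (at_right 0)"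
    using fc kc by (auto simp: continuous_on_Icc_at_rightD)
  have "\<forall>\<^sub>F e in at_right 0. f e = k e" using eq by (auto simp: eventually_at_right_less eventually_at_filter)
  then have "(k \<longlongrightarrow> f 0) (at_right 0)" using f0 tendsto_cong by blast
  then have "f 0 = k 0" using k0 tendsto_unique trivial_limit_at_right_real by blast
  then show ?thesis by (simp add: f_def k_def)
qed

lemma beam_deriv_t_zero:
  assumes h: "h > 0" and y: "y > 0"
  shows "beam_deriv h [(0, 0, 1)] (x :: 'a::euclidean_space, y, 0) = 0"
proof -
  let ?D = "beam_deriv h [(0, 0, 1)] (x, y, 0)"
  have d: "((\<lambda>t. beam h (x, y, t)) has_real_derivative ?D) (at 0)"
    using has_derivative_directional[OF beam_deriv_has_derivative[OF h, of "[]" "(x, y, 0)"], of "(0, 0, 1)"] by simp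
  have "((\<lambda>t. beam h (x, y, - t)) has_real_derivative ?D) (at 0)"
  proof (rule has_field_derivative_transform_within_open[OF d, where S="{-y<..<y}"])
    show "beam h (x, y, t) = beam h (x, y, - t)" if "t \<in> {-y<..<y}" for t
      using that by (subst (1 2) beam_average[OF h]) auto
  qed (use y in auto)
  moreover have "((\<lambda>t. beam h (x, y, - t)) has_real_derivative - ?D) (at 0)"
    using DERIV_mirror[of "\<lambda>t. beam h (x, y, t)" ?D 0] d by simp
  ultimately have "?D = - ?D" by (rule DERIV_unique)
  then show ?thesis by simp
qed

lemma DERIV_le_Lipschitz:
  fixes f :: "real \<Rightarrow> real"
  assumes f: "(f has_real_derivative D) (at a)" and e: "e > 0"
    and L: "\<And>s. \<bar>s\<bar> < e \<Longrightarrow> \<bar>f (a + s) - f a\<bar> \<le> L * \<bar>s\<bar>"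
  shows "\<bar>D\<bar> \<le> L"
proof -
  have "((\<lambda>s. (f (a + s) - f a) / s) \<longlongrightarrow> D) (at 0)" using f by (simp add: DERIV_def)
  then have "((\<lambda>s. \<bar>(f (a + s) - f a) / s\<bar>) \<longlongrightarrow> \<bar>D\<bar>) (at 0)" by (rule tendsto_rabs)
  moreover have "\<forall>\<^sub>F s in at 0. \<bar>(f (a + s) - f a) / s\<bar> \<le> L"
    unfolding eventually_at
  proof (intro exI conjI ballI impI)
    fix s :: real assume "s \<noteq> 0 \<and> dist s 0 < e"
    then show "\<bar>(f (a + s) - f a) / s\<bar> \<le> L" using L[of s] by (simp add: abs_divide divide_le_eq)
  qed (use e in auto)
  ultimately show ?thesis by (rule tendsto_upperbound) simp
qed

lemma Phi_y_Lipschitz: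
  assumes h: "h > 0" and M: "\<And>y. \<bar>y\<bar> \<le> r \<Longrightarrow> \<bar>Phi_deriv h [(0, 1), (0, 1)] (x :: 'a::euclidean_space, y)\<bar> \<le> M"
    and y: "0 \<le> y1" "y1 \<le> r" "0 \<le> y2" "y2 \<le> r"
  shows "\<bar>Phi h (x, y1) - Phi h (x, y2)\<bar> \<le> M * \<bar>y1\<^sup>2 - y2\<^sup>2\<bar> / 2"
proof -
  have dy: "((\<lambda>y. Phi_deriv h vs (x, y)) has_real_derivative Phi_deriv h ((0, 1) # vs) (x, y)) (at y within S)" for vs y S
    using has_derivative_line[of "Phi_deriv h vs" "\<lambda>v. Phi_deriv h (v # vs) (x, y)" "(x, 0)" y "(0, 1)" S]
      Phi_deriv_has_derivative[OF h, of vs "(x, y)"] by simp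
  have d1: "\<bar>Phi_deriv h [(0, 1)] (x, y)\<bar> \<le> M * y" if "0 \<le> y" "y \<le> r" for y
  proof -
    have "norm (Phi_deriv h [(0, 1)] (x, y) - Phi_deriv h [(0, 1)] (x, 0)) \<le> M * norm (y - 0)"
      by (rule field_differentiable_bound[where S="{0..r}", OF _ dy]) (use M that in auto)
    then show ?thesis using that by (simp add: Phi_deriv_y_zero)
  qed
  have main: "\<bar>Phi h (x, b) - Phi h (x, a)\<bar> \<le> M * (b\<^sup>2 - a\<^sup>2) / 2" if ab: "0 \<le> a" "a \<le> b" "b \<le> r" for a b
  proof -
    have "(\<lambda>y. M * y\<^sup>2 / 2 + c * Phi h (x, y)) a \<le> (\<lambda>y. M * y\<^sup>2 / 2 + c * Phi h (x, y)) b" if c: "\<bar>c\<bar> = 1" for c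
    proof (rule DERIV_nonneg_imp_nondecreasing[OF ab(2)])
      fix y assume y: "a \<le> y" "y \<le> b"
      have "\<bar>c * Phi_deriv h [(0, 1)] (x, y)\<bar> \<le> M * y" using d1[of y] y ab c by (simp add: abs_mult)
      then have "0 \<le> M * y + c * Phi_deriv h [(0, 1)] (x, y)" by linarith
      moreover have "((\<lambda>y. M * y\<^sup>2 / 2 + c * Phi h (x, y)) has_real_derivative M * y + c * Phi_deriv h [(0, 1)] (x, y)) (at y)"
        by (auto intro!: derivative_eq_intros dy)
      ultimately show "\<exists>D. ((\<lambda>y. M * y\<^sup>2 / 2 + c * Phi h (x, y)) has_real_derivative D) (at y) \<and> 0 \<le> D" by blast
    qed
    from this[of 1] this[of "-1"] show ?thesis by (simp add: abs_le_iff right_diff_distrib diff_divide_distrib)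
  qed
  show ?thesis
  proof (cases "y1 \<le> y2")
    case True
    then have "y1\<^sup>2 \<le> y2\<^sup>2" using y by (intro power_mono) auto
    then show ?thesis using main[of y1 y2] True y by (simp add: abs_minus_commute)
  next
    case False
    then have "y2\<^sup>2 \<le> y1\<^sup>2" using y by (intro power_mono) auto
    then show ?thesis using main[of y2 y1] False y by simp
  qed
qed

lemma beam_decay:
  fixes R \<delta> :: real
  assumes \<delta>: "\<delta> > 0" and R: "R > 0"
  obtains \<epsilon> :: "real \<Rightarrow> real" where "(\<epsilon> \<longlongrightarrow> 0) (at_right 0)"
    and "\<And>h (x::'a::euclidean_space) y t. 0 < h \<Longrightarrow> h \<le> 1 \<Longrightarrow> norm x \<le> R \<Longrightarrow> \<bar>t\<bar> \<le> y \<Longrightarrow> y \<le> norm x - \<delta> \<Longrightarrow> \<bar>beam h (x, y, t)\<bar> \<le> \<epsilon> h"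
    and "\<And>h (x::'a::euclidean_space) y t b. 0 < h \<Longrightarrow> h \<le> 1 \<Longrightarrow> norm x \<le> R \<Longrightarrow> \<bar>t\<bar> \<le> y \<Longrightarrow> y \<le> norm x - \<delta> \<Longrightarrow> b \<in> Basis \<Longrightarrow> \<bar>beam_deriv h [(b, 0, 0)] (x, y, t)\<bar> \<le> \<epsilon> h"
    and "\<And>h (x::'a::euclidean_space) y t. 0 < h \<Longrightarrow> h \<le> 1 \<Longrightarrow> norm x \<le> R \<Longrightarrow> \<bar>t\<bar> \<le> y \<Longrightarrow> y \<le> norm x - \<delta> \<Longrightarrow> \<bar>beam_deriv h [(0, 1, 0)] (x, y, t)\<bar> \<le> \<epsilon> h"
proof -
  define d where "d = \<delta> / 3"
  have d: "d > 0" using \<delta> by (simp add: d_def)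
  obtain \<epsilon> :: "real \<Rightarrow> real" where \<epsilon>: "(\<epsilon> \<longlongrightarrow> 0) (at_right 0)"
    and e1: "\<And>h (x::'a) y. 0 < h \<Longrightarrow> h \<le> 1 \<Longrightarrow> norm x \<le> R + d \<Longrightarrow> \<bar>y\<bar> \<le> norm x - d \<Longrightarrow> \<bar>Phi h (x, y)\<bar> \<le> \<epsilon> h"
    and e2: "\<And>h (x::'a) y b. 0 < h \<Longrightarrow> h \<le> 1 \<Longrightarrow> norm x \<le> R + d \<Longrightarrow> \<bar>y\<bar> \<le> norm x - d \<Longrightarrow> b \<in> Basis \<Longrightarrow> \<bar>Phi_deriv h [(b, 0)] (x, y)\<bar> \<le> \<epsilon> h"
    and e3: "\<And>h (x::'a) y. 0 < h \<Longrightarrow> h \<le> 1 \<Longrightarrow> norm x \<le> R + d \<Longrightarrow> \<bar>y\<bar> \<le> norm x - d \<Longrightarrow> \<bar>Phi_deriv h [(0, 1), (0, 1)] (x, y)\<bar> \<le> \<epsilon> h"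
    by (rule Phi_decay[OF d, of "R + d", where 'a='a]) blast
  define E where "E h = \<epsilon> h * (1 + R)" for h
  have Elim: "(E \<longlongrightarrow> 0) (at_right 0)" unfolding E_def[abs_def] by (rule tendsto_mult_left_zero[OF \<epsilon>])
  have avg: "\<bar>(1 / pi) * integral {0..pi/2} f\<bar> \<le> B" if f: "continuous_on {0..pi/2} f" and B: "\<And>s. s \<in> {0..pi/2} \<Longrightarrow> \<bar>f s\<bar> \<le> B" for f and B :: real
  proof -
    have B0: "0 \<le> B" using order_trans[OF abs_ge_zero B[of 0]] by simp
    have "norm (integral (cbox 0 (pi/2)) f) \<le> B * measure lborel (cbox 0 (pi/2))"
      by (rule has_integral_bound[OF _ integrable_integral]) (use f B B0 in \<open>auto intro!: integrable_continuous_real\<close>)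
    then show ?thesis using B0 by (simp add: abs_mult field_simps)
  qed
  have Pc: "continuous_on S (\<lambda>s. Phi h (x, \<rho> * sin s))" if "h > 0" for S h \<rho> and x :: 'a
    by (intro continuous_on_compose2[OF Phi_deriv_continuous[OF that, of UNIV]] continuous_intros subset_UNIV)
  have sqr: "sqrt (y\<^sup>2 - t\<^sup>2) \<le> y" "0 \<le> sqrt (y\<^sup>2 - t\<^sup>2)" if "\<bar>t\<bar> < y" for t y :: real
  proof -
    have "t\<^sup>2 \<le> y\<^sup>2" using power_mono[of "\<bar>t\<bar>" y 2] that by simp
    then show "0 \<le> sqrt (y\<^sup>2 - t\<^sup>2)" by simp
    show "sqrt (y\<^sup>2 - t\<^sup>2) \<le> y" by (rule real_le_lsqrt) (use that in auto)
  qed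
  have sin_le: "0 \<le> \<rho> * sin s" "\<rho> * sin s \<le> \<rho>" if "0 \<le> \<rho>" "s \<in> {0..pi/2}" for \<rho> s :: real
  proof -
    have "0 \<le> sin s" using that by (intro sin_ge_zero) auto
    then show "0 \<le> \<rho> * sin s" "\<rho> * sin s \<le> \<rho>" using that by (auto intro: mult_left_le)
  qed
  have int_diff: "integral {0..pi/2} f - integral {0..pi/2} g = integral {0..pi/2} (\<lambda>s. f s - g s)"
    if "continuous_on {0..pi/2} f" "continuous_on {0..pi/2} g" for f g :: "real \<Rightarrow> real"
    using that by (intro Henstock_Kurzweil_Integration.integral_diff[symmetric] integrable_continuous_real)
  have strict: "\<bar>beam h (x, y, t)\<bar> \<le> E h \<and> (\<forall>b\<in>Basis. \<bar>beam_deriv h [(b, 0, 0)] (x, y, t)\<bar> \<le> E h) \<and> \<bar>beam_deriv h [(0, 1, 0)] (x, y, t)\<bar> \<le> E h"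
    if h: "0 < h" "h \<le> 1" and x: "norm x \<le> R" and t: "\<bar>t\<bar> < y" and y: "y \<le> norm x - 2 * d" for h y t and x :: 'a
  proof -
    note \<rho> = sqr[OF t]
    have e0: "0 \<le> \<epsilon> h" using e1[of h x 0] h x y d t by force
    have E: "\<epsilon> h \<le> E h" using e0 R mult_nonneg_nonneg[of "\<epsilon> h" R] by (simp add: E_def algebra_simps)
    have 1: "\<bar>beam h (x, y, t)\<bar> \<le> \<epsilon> h"
      unfolding beam_average[OF h(1) t]
      by (rule avg[OF Pc[OF h(1)]], rule e1[OF h]) (use x y d sin_le[OF \<rho>(2)] \<rho>(1) in \<open>force+\<close>)
    have 2: "\<bar>beam_deriv h [(b, 0, 0)] (x, y, t)\<bar> \<le> \<epsilon> h" if b: "b \<in> Basis" for b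
    proof (rule DERIV_le_Lipschitz[OF _ d])
      show "((\<lambda>s. beam h ((x, y, t) + s *\<^sub>R (b, 0, 0))) has_real_derivative beam_deriv h [(b, 0, 0)] (x, y, t)) (at 0)"
        by (rule has_derivative_directional[OF beam_deriv_has_derivative[OF h(1)]])
      fix s :: real assume s: "\<bar>s\<bar> < d"
      have "\<bar>(1 / pi) * integral {0..pi/2} (\<lambda>\<theta>. Phi h (x + s *\<^sub>R b, sqrt (y\<^sup>2 - t\<^sup>2) * sin \<theta>) - Phi h (x, sqrt (y\<^sup>2 - t\<^sup>2) * sin \<theta>))\<bar> \<le> \<epsilon> h * \<bar>s\<bar>"
      proof (rule avg)
        fix \<theta> assume \<theta>: "\<theta> \<in> {0..pi/2}"
        define q where "q = sqrt (y\<^sup>2 - t\<^sup>2) * sin \<theta>"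
        have q: "0 \<le> q" "q \<le> y" using sin_le[OF \<rho>(2) \<theta>] \<rho>(1) by (auto simp: q_def)
        have "norm (Phi h ((x, q) + s *\<^sub>R (b, 0)) - Phi h ((x, q) + 0 *\<^sub>R (b, 0))) \<le> \<epsilon> h * norm (s - 0)"
        proof (rule field_differentiable_bound[where S="{-d<..<d}" and f="\<lambda>s. Phi h ((x, q) + s *\<^sub>R (b, 0))" and f'="\<lambda>s. Phi_deriv h [(b, 0)] ((x, q) + s *\<^sub>R (b, 0))"])
          fix r assume r: "r \<in> {-d<..<d}"
          show "((\<lambda>s. Phi h ((x, q) + s *\<^sub>R (b, 0))) has_real_derivative Phi_deriv h [(b, 0)] ((x, q) + r *\<^sub>R (b, 0))) (at r within {-d<..<d})"
            by (rule has_derivative_line[OF Phi_deriv_has_derivative[OF h(1)]])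
          have "norm (r *\<^sub>R b) < d" using r b by auto
          then have "norm (x + r *\<^sub>R b) \<le> norm x + d" "norm x - d \<le> norm (x + r *\<^sub>R b)"
            using norm_triangle_ineq[of x "r *\<^sub>R b"] norm_diff_ineq[of x "r *\<^sub>R b"] by linarith+
          then have "\<bar>Phi_deriv h [(b, 0)] (x + r *\<^sub>R b, q)\<bar> \<le> \<epsilon> h"
            using q x y d by (intro e2[OF h _ _ b]) auto
          then show "norm (Phi_deriv h [(b, 0)] ((x, q) + r *\<^sub>R (b, 0))) \<le> \<epsilon> h" by simp
        qed (use s d in auto)
        then show "\<bar>Phi h (x + s *\<^sub>R b, sqrt (y\<^sup>2 - t\<^sup>2) * sin \<theta>) - Phi h (x, sqrt (y\<^sup>2 - t\<^sup>2) * sin \<theta>)\<bar> \<le> \<epsilon> h * \<bar>s\<bar>"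
          by (simp add: q_def)
      qed (intro continuous_intros Pc h)
      then show "\<bar>beam h ((x, y, t) + (0 + s) *\<^sub>R (b, 0, 0)) - beam h ((x, y, t) + 0 *\<^sub>R (b, 0, 0))\<bar> \<le> \<epsilon> h * \<bar>s\<bar>"
        by (simp add: beam_average[OF h(1) t] right_diff_distrib[symmetric] diff_divide_distrib[symmetric] int_diff[OF Pc[OF h(1)] Pc[OF h(1)]])
    qed
    have 3: "\<bar>beam_deriv h [(0, 1, 0)] (x, y, t)\<bar> \<le> \<epsilon> h * R"
    proof (rule DERIV_le_Lipschitz[where e="min d (y - \<bar>t\<bar>)"])
      show "((\<lambda>s. beam h ((x, y, t) + s *\<^sub>R (0, 1, 0))) has_real_derivative beam_deriv h [(0, 1, 0)] (x, y, t)) (at 0)"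
        by (rule has_derivative_directional[OF beam_deriv_has_derivative[OF h(1)]])
      fix s assume s: "\<bar>s\<bar> < min d (y - \<bar>t\<bar>)"
      have t': "\<bar>t\<bar> < y + s" using s by linarith
      note \<rho>' = sqr[OF t']
      have yR: "y \<le> R" "y + s \<le> R" using s y x d by auto
      have r: "y \<le> norm x - d" "y + s \<le> norm x - d" using s y d by auto
      have "\<bar>(1 / pi) * integral {0..pi/2} (\<lambda>\<theta>. Phi h (x, sqrt ((y + s)\<^sup>2 - t\<^sup>2) * sin \<theta>) - Phi h (x, sqrt (y\<^sup>2 - t\<^sup>2) * sin \<theta>))\<bar> \<le> \<epsilon> h * R * \<bar>s\<bar>"
      proof (rule avg)
        fix \<theta> assume \<theta>: "\<theta> \<in> {0..pi/2}"
        have a: "\<bar>Phi h (x, sqrt ((y + s)\<^sup>2 - t\<^sup>2) * sin \<theta>) - Phi h (x, sqrt (y\<^sup>2 - t\<^sup>2) * sin \<theta>)\<bar>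
           \<le> \<epsilon> h * \<bar>(sqrt ((y + s)\<^sup>2 - t\<^sup>2) * sin \<theta>)\<^sup>2 - (sqrt (y\<^sup>2 - t\<^sup>2) * sin \<theta>)\<^sup>2\<bar> / 2"
        proof (rule Phi_y_Lipschitz[OF h(1), where r="norm x - d"])
          show "\<bar>Phi_deriv h [(0, 1), (0, 1)] (x, y)\<bar> \<le> \<epsilon> h" if "\<bar>y\<bar> \<le> norm x - d" for y
            using that x d by (intro e3[OF h]) auto
        qed (use sin_le[OF \<rho>(2) \<theta>] sin_le[OF \<rho>'(2) \<theta>] \<rho>(1) \<rho>'(1) r in auto)
        have b: "(sqrt ((y + s)\<^sup>2 - t\<^sup>2) * sin \<theta>)\<^sup>2 - (sqrt (y\<^sup>2 - t\<^sup>2) * sin \<theta>)\<^sup>2 = ((y + s)\<^sup>2 - y\<^sup>2) * (sin \<theta>)\<^sup>2"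
        proof -
          have "(sqrt ((y + s)\<^sup>2 - t\<^sup>2))\<^sup>2 = (y + s)\<^sup>2 - t\<^sup>2" "(sqrt (y\<^sup>2 - t\<^sup>2))\<^sup>2 = y\<^sup>2 - t\<^sup>2"
            using \<rho>(2) \<rho>'(2) by simp_all
          then show ?thesis by (simp only: power_mult_distrib) (simp add: algebra_simps)
        qed
        have c: "\<bar>((y + s)\<^sup>2 - y\<^sup>2) * (sin \<theta>)\<^sup>2\<bar> \<le> \<bar>s\<bar> * (2 * R)"
        proof -
          have "(y + s)\<^sup>2 - y\<^sup>2 = s * (y + (y + s))" by (simp add: power2_eq_square algebra_simps)
          then have "\<bar>((y + s)\<^sup>2 - y\<^sup>2) * (sin \<theta>)\<^sup>2\<bar> = \<bar>s\<bar> * (y + (y + s)) * (sin \<theta>)\<^sup>2"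
            using t t' by (simp add: abs_mult)
          also have "\<dots> \<le> \<bar>s\<bar> * (y + (y + s)) * 1"
            using t t' by (intro mult_left_mono) (auto simp: abs_square_le_1 power_le_one_iff)
          also have "\<dots> \<le> \<bar>s\<bar> * (2 * R)" using yR by (simp add: mult_left_mono)
          finally show ?thesis .
        qed
        show "\<bar>Phi h (x, sqrt ((y + s)\<^sup>2 - t\<^sup>2) * sin \<theta>) - Phi h (x, sqrt (y\<^sup>2 - t\<^sup>2) * sin \<theta>)\<bar> \<le> \<epsilon> h * R * \<bar>s\<bar>"
          using a[unfolded b] mult_left_mono[OF c e0] by (simp add: mult_ac)
      qed (intro continuous_intros Pc h)
      then show "\<bar>beam h ((x, y, t) + (0 + s) *\<^sub>R (0, 1, 0)) - beam h ((x, y, t) + 0 *\<^sub>R (0, 1, 0))\<bar> \<le> \<epsilon> h * R * \<bar>s\<bar>"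
        by (simp add: beam_average[OF h(1) t] beam_average[OF h(1) t'] right_diff_distrib[symmetric] diff_divide_distrib[symmetric] int_diff[OF Pc[OF h(1)] Pc[OF h(1)]])
    qed (use d t in auto)
    show ?thesis using 1 2 3 E e0 by (force simp: E_def algebra_simps)
  qed
  have closed: "\<bar>beam_deriv h vs (x, y, t)\<bar> \<le> E h"
    if h: "0 < h" and ty: "\<bar>t\<bar> \<le> y" and B: "\<And>y'. y < y' \<Longrightarrow> y' \<le> y + d \<Longrightarrow> \<bar>beam_deriv h vs (x, y', t)\<bar> \<le> E h"
    for h y t vs and x :: 'a
  proof -
    have "continuous_on {y..y+d} (\<lambda>y. \<bar>beam_deriv h vs (x, y, t)\<bar>)"
      by (intro continuous_intros continuous_on_compose2[OF beam_deriv_continuous[OF h, of UNIV]] subset_UNIV)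
    then have "((\<lambda>y. \<bar>beam_deriv h vs (x, y, t)\<bar>) \<longlongrightarrow> \<bar>beam_deriv h vs (x, y, t)\<bar>) (at_right y)"
      using d by (intro continuous_on_Icc_at_rightD) auto
    moreover have "\<forall>\<^sub>F y' in at_right y. \<bar>beam_deriv h vs (x, y', t)\<bar> \<le> E h"
      using d B by (auto simp: eventually_at_right_field intro!: exI[of _ "y + d"])
    ultimately show ?thesis by (rule tendsto_upperbound) simp
  qed
  show thesis
  proof (rule that[OF Elim])
    fix h y t :: real and x :: 'a
    assume a: "0 < h" "h \<le> 1" "norm x \<le> R" "\<bar>t\<bar> \<le> y" "y \<le> norm x - \<delta>"
    have s: "\<bar>t\<bar> < y'" "y' \<le> norm x - 2 * d" if "y < y'" "y' \<le> y + d" for y'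
      using a that by (auto simp: d_def)
    show "\<bar>beam h (x, y, t)\<bar> \<le> E h" by (rule closed[OF a(1,4)]) (use strict[OF a(1-3)] s in blast)
    show "\<bar>beam_deriv h [(0, 1, 0)] (x, y, t)\<bar> \<le> E h" by (rule closed[OF a(1,4)]) (use strict[OF a(1-3)] s in blast)
    show "\<bar>beam_deriv h [(b, 0, 0)] (x, y, t)\<bar> \<le> E h" if "b \<in> Basis" for b
      by (rule closed[OF a(1,4)]) (use strict[OF a(1-3)] s that in blast)
  qed
qed

subsection \<open>Green's formula over a cone truncated by a graph\<close>

definition C2_family :: "'z::real_normed_vector set \<Rightarrow> ('z list \<Rightarrow> 'z \<Rightarrow> real) \<Rightarrow> bool" where
  "C2_family U g \<longleftrightarrow> open U
    \<and> (\<forall>vs. length vs < 2 \<longrightarrow> (\<forall>z\<in>U. (g vs has_derivative (\<lambda>v. g (v # vs) z)) (at z)))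
    \<and> (\<forall>vs. length vs \<le> 2 \<longrightarrow> continuous_on U (g vs))"

lemma C2_familyD:
  assumes "C2_family U g"
  shows "open U"
    and "length vs < 2 \<Longrightarrow> z \<in> U \<Longrightarrow> (g vs has_derivative (\<lambda>v. g (v # vs) z)) (at z)"
    and "length vs \<le> 2 \<Longrightarrow> continuous_on U (g vs)"
  using assms unfolding C2_family_def by blast+

lemma has_derivative_path:
  fixes F :: "'z::real_normed_vector \<Rightarrow> real"
  assumes "(F has_derivative D) (at (p s))" "(p has_vector_derivative p') (at s within S)"
  shows "((\<lambda>s. F (p s)) has_real_derivative D p') (at s within S)"
proof -
  have "((\<lambda>s. F (p s)) has_derivative (\<lambda>r. D (r *\<^sub>R p'))) (at s within S)"
    using has_derivative_compose[OF assms(2)[unfolded has_vector_derivative_def] assms(1)] .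
  then show ?thesis
    unfolding has_field_derivative_def
    by (rule has_derivative_eq_rhs) (simp add: fun_eq_iff linear_scale[OF has_derivative_linear[OF assms(1)]])
qed

lemma linear_coords:
  fixes D :: "'a::real_vector \<times> real \<times> real \<Rightarrow> real"
  assumes "linear D"
  shows "D (b, p, q) = D (b, 0, 0) + p * D (0, 1, 0) + q * D (0, 0, 1)"
proof -
  have "(b, p, q) = (b, 0, 0) + p *\<^sub>R (0, 1, 0) + q *\<^sub>R (0, 0, 1)" by simp
  then have "D (b, p, q) = D ((b, 0, 0) + p *\<^sub>R (0, 1, 0) + q *\<^sub>R (0, 0, 1))" by simp
  then show ?thesis by (simp only: linear_add[OF assms] linear_scale[OF assms] real_scaleR_def)
qed

abbreviation ey :: "'a::real_normed_vector \<times> real \<times> real" where "ey \<equiv> (0, 1, 0)"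
abbreviation et :: "'a::real_normed_vector \<times> real \<times> real" where "et \<equiv> (0, 0, 1)"

definition wronsk :: "('z list \<Rightarrow> 'z \<Rightarrow> real) \<Rightarrow> ('z list \<Rightarrow> 'z \<Rightarrow> real) \<Rightarrow> 'z \<Rightarrow> 'z \<Rightarrow> real" where
  "wronsk v W e z = v [] z * W [e] z - W [] z * v [e] z"

definition wronsk_deriv :: "('z list \<Rightarrow> 'z \<Rightarrow> real) \<Rightarrow> ('z list \<Rightarrow> 'z \<Rightarrow> real) \<Rightarrow> 'z \<Rightarrow> 'z \<Rightarrow> 'z \<Rightarrow> real" where
  "wronsk_deriv v W e d z = v [d] z * W [e] z + v [] z * W [d, e] z - (W [d] z * v [e] z + W [] z * v [d, e] z)"

lemma wronsk_deriv_same: "wronsk_deriv v W e e z = v [] z * W [e, e] z - W [] z * v [e, e] z"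
  by (simp add: wronsk_deriv_def)

lemma wronsk_has_derivative:
  assumes v: "C2_family U v" and W: "C2_family U W" and z: "z \<in> U"
  shows "(wronsk v W e has_derivative (\<lambda>d. wronsk_deriv v W e d z)) (at z)"
  unfolding wronsk_def[abs_def] wronsk_deriv_def
  by (rule has_derivative_eq_rhs[OF has_derivative_diff[OF
        has_derivative_mult[OF C2_familyD(2)[OF v _ z] C2_familyD(2)[OF W _ z]]
        has_derivative_mult[OF C2_familyD(2)[OF W _ z] C2_familyD(2)[OF v _ z]]]])
    (auto simp: fun_eq_iff algebra_simps)

lemma wronsk_continuous:
  assumes v: "C2_family U v" and W: "C2_family U W"
  shows "continuous_on U (wronsk v W e)" "continuous_on U (wronsk_deriv v W e d)"
proof -
  note c = C2_familyD(3)[OF v] C2_familyD(3)[OF W]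
  show "continuous_on U (wronsk v W e)"
    unfolding wronsk_def[abs_def] by (intro continuous_intros c) auto
  show "continuous_on U (wronsk_deriv v W e d)"
    unfolding wronsk_deriv_def[abs_def] by (intro continuous_intros c) auto
qed

text \<open>The triangle \<open>0 \<le> t \<le> y \<le> Y\<close> is parametrised by \<open>y = Y \<eta>\<close>, \<open>t = Y \<eta> \<tau>\<close> with
  \<open>\<eta>, \<tau> \<in> [0, 1]\<close>; this keeps the domain of integration fixed when \<open>Y\<close> varies.\<close>

lemma triangle_path_derivatives:
  fixes F :: "'a::real_normed_vector \<times> real \<times> real \<Rightarrow> real"
  assumes F: "(F has_derivative D) (at (x, Y * \<eta>, Y * \<eta> * \<tau>))"
  shows "((\<lambda>\<eta>. F (x, Y * \<eta>, Y * \<eta> * \<tau>)) has_real_derivative Y * D ey + Y * \<tau> * D et) (at \<eta> within S)"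
    and "((\<lambda>\<tau>. F (x, Y * \<eta>, Y * \<eta> * \<tau>)) has_real_derivative Y * \<eta> * D et) (at \<tau> within S)"
proof -
  note l = linear_coords[OF has_derivative_linear[OF F], of 0] linear_0[OF has_derivative_linear[OF F]]
  have "((\<lambda>\<eta>. (x, Y * \<eta>, Y * \<eta> * \<tau>)) has_vector_derivative (0, Y, Y * \<tau>)) (at \<eta> within S)"
    unfolding has_vector_derivative_def by (auto intro!: derivative_eq_intros simp: fun_eq_iff)
  then have "((\<lambda>\<eta>. F (x, Y * \<eta>, Y * \<eta> * \<tau>)) has_real_derivative D (0, Y, Y * \<tau>)) (at \<eta> within S)"
    by (rule has_derivative_path[where p="\<lambda>\<eta>. (x, Y * \<eta>, Y * \<eta> * \<tau>)", OF F])
  then show "((\<lambda>\<eta>. F (x, Y * \<eta>, Y * \<eta> * \<tau>)) has_real_derivative Y * D ey + Y * \<tau> * D et) (at \<eta> within S)"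
    using l(1)[of Y "Y * \<tau>"] l(2) by (simp add: zero_prod_def)
  have "((\<lambda>\<tau>. (x, Y * \<eta>, Y * \<eta> * \<tau>)) has_vector_derivative (0, 0, Y * \<eta>)) (at \<tau> within S)"
    unfolding has_vector_derivative_def by (auto intro!: derivative_eq_intros simp: fun_eq_iff)
  then have "((\<lambda>\<tau>. F (x, Y * \<eta>, Y * \<eta> * \<tau>)) has_real_derivative D (0, 0, Y * \<eta>)) (at \<tau> within S)"
    by (rule has_derivative_path[where p="\<lambda>\<tau>. (x, Y * \<eta>, Y * \<eta> * \<tau>)", OF F])
  then show "((\<lambda>\<tau>. F (x, Y * \<eta>, Y * \<eta> * \<tau>)) has_real_derivative Y * \<eta> * D et) (at \<tau> within S)"
    using l(1)[of 0 "Y * \<eta>"] l(2) by (simp add: zero_prod_def)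
qed

lemma continuous_on_triangle:
  fixes F :: "'a::real_normed_vector \<times> real \<times> real \<Rightarrow> real"
  assumes F: "continuous_on U F" and f: "continuous_on A f" "continuous_on A \<eta>" "continuous_on A \<tau>" "continuous_on A k"
    and sub: "\<And>a. a \<in> A \<Longrightarrow> (k a, f a * \<eta> a, f a * \<eta> a * \<tau> a) \<in> U"
  shows "continuous_on A (\<lambda>a. F (k a, f a * \<eta> a, f a * \<eta> a * \<tau> a))"
  by (rule continuous_on_compose2[OF F]) (use sub in \<open>auto intro!: continuous_intros f\<close>)

lemma green_triangle:
  fixes v W :: "('a::euclidean_space \<times> real \<times> real) list \<Rightarrow> 'a \<times> real \<times> real \<Rightarrow> real"
  assumes v: "C2_family U v" and W: "C2_family U W" and Y: "Y > 0"
    and sub: "\<And>\<eta> \<tau>. \<eta> \<in> {0..1} \<Longrightarrow> \<tau> \<in> {0..1} \<Longrightarrow> (x, Y * \<eta>, Y * \<eta> * \<tau>) \<in> U"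
    and wave_v: "\<And>z. z \<in> U \<Longrightarrow> v [et, et] z = v [ey, ey] z + (\<Sum>b\<in>Basis. v [(b, 0, 0), (b, 0, 0)] z)"
    and wave_W: "\<And>z. z \<in> U \<Longrightarrow> W [et, et] z = W [ey, ey] z + (\<Sum>b\<in>Basis. W [(b, 0, 0), (b, 0, 0)] z)"
    and vt0: "\<And>\<eta>. 0 < \<eta> \<Longrightarrow> \<eta> < 1 \<Longrightarrow> v [et] (x, Y * \<eta>, 0) = 0"
    and Wt0: "\<And>\<eta>. 0 < \<eta> \<Longrightarrow> \<eta> < 1 \<Longrightarrow> W [et] (x, Y * \<eta>, 0) = 0"
    and cone: "\<And>\<eta>. \<eta> \<in> {0..1} \<Longrightarrow> W [] (x, Y * \<eta>, Y * \<eta>) = \<gamma>"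
  shows "integral {0..1} (\<lambda>\<tau>. Y * wronsk v W ey (x, Y, Y * \<tau>))
    = \<gamma> * (v [] (x, 0, 0) - v [] (x, Y, Y))
      - integral {0..1} (\<lambda>\<eta>. integral {0..1} (\<lambda>\<tau>. Y\<^sup>2 * \<eta> * (\<Sum>b\<in>Basis. wronsk_deriv v W (b, 0, 0) (b, 0, 0) (x, Y * \<eta>, Y * \<eta> * \<tau>))))"
proof -
  define z where "z \<eta> \<tau> = (x, Y * \<eta>, Y * \<eta> * \<tau>)" for \<eta> \<tau>
  have zU: "z \<eta> \<tau> \<in> U" if "\<eta> \<in> {0..1}" "\<tau> \<in> {0..1}" for \<eta> \<tau> using sub that by (simp add: z_def)
  define X where "X = wronsk v W"
  define Xd where "Xd = wronsk_deriv v W"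
  have Xder: "(X e has_derivative (\<lambda>d. Xd e d (z \<eta> \<tau>))) (at (z \<eta> \<tau>))" if "\<eta> \<in> {0..1}" "\<tau> \<in> {0..1}" for e \<eta> \<tau>
    unfolding X_def Xd_def by (rule wronsk_has_derivative[OF v W zU[OF that]])
  have Xc: "continuous_on U (X e)" "continuous_on U (Xd e d)" for e d
    unfolding X_def Xd_def by (rule wronsk_continuous[OF v W])+
  have ct: "continuous_on {0..1} (\<lambda>\<tau>. F (z \<eta> \<tau>))" if "continuous_on U F" "\<eta> \<in> {0..1}" for F :: "'a \<times> real \<times> real \<Rightarrow> real" and \<eta>
    unfolding z_def by (rule continuous_on_triangle[OF that(1)]) (use that sub in \<open>auto intro!: continuous_intros\<close>)
  have ct2: "continuous_on ({0..1} \<times> {0..1}) (\<lambda>p. F (z (fst p) (snd p)))" if "continuous_on U F" for F :: "'a \<times> real \<times> real \<Rightarrow> real"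
    unfolding z_def by (rule continuous_on_triangle[OF that(1)]) (use that sub in \<open>auto intro!: continuous_intros\<close>)
  define B where "B \<eta> = integral (cbox 0 1) (\<lambda>\<tau>. Y * \<eta> * X ey (z \<eta> \<tau>))" for \<eta>
  define S where "S z = (\<Sum>b\<in>Basis. Xd (b, 0, 0) (b, 0, 0) z)" for z
  have Sc: "continuous_on U S" unfolding S_def[abs_def] by (intro continuous_intros Xc)
  define T where "T \<eta> = integral {0..1} (\<lambda>\<tau>. Y\<^sup>2 * \<eta> * S (z \<eta> \<tau>))" for \<eta>
  have Tc: "continuous_on {0..1} T"
  proof -
    have "continuous_on {0..1} (\<lambda>\<eta>. integral (cbox 0 1) (\<lambda>\<tau>. Y\<^sup>2 * \<eta> * S (z \<eta> \<tau>)))"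
      by (rule integral_continuous_on_param) (unfold split_beta, intro continuous_intros ct2[OF Sc, simplified], auto intro: ct2[OF Sc] simp: cbox_interval)
    then show ?thesis by (simp add: T_def[abs_def])
  qed
  have Bd: "(B has_real_derivative integral (cbox 0 1) (\<lambda>\<tau>. Y * X ey (z \<eta> \<tau>) + Y * \<eta> * (Y * Xd ey ey (z \<eta> \<tau>) + Y * \<tau> * Xd ey et (z \<eta> \<tau>)))) (at \<eta> within {0..1})"
    if \<eta>: "\<eta> \<in> {0..1}" for \<eta>
    unfolding B_def[abs_def]
  proof (rule leibniz_rule_field_derivative[where fx="\<lambda>\<eta> \<tau>. Y * X ey (z \<eta> \<tau>) + Y * \<eta> * (Y * Xd ey ey (z \<eta> \<tau>) + Y * \<tau> * Xd ey et (z \<eta> \<tau>))"])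
    fix \<eta> \<tau> :: real assume a: "\<eta> \<in> {0..1}" "\<tau> \<in> cbox 0 1"
    have "((\<lambda>\<eta>. X ey (z \<eta> \<tau>)) has_real_derivative Y * Xd ey ey (z \<eta> \<tau>) + Y * \<tau> * Xd ey et (z \<eta> \<tau>)) (at \<eta> within {0..1})"
      using triangle_path_derivatives(1)[OF Xder[of \<eta> \<tau> ey, unfolded z_def]] a by (simp add: z_def)
    from DERIV_mult[OF DERIV_cmult[OF DERIV_ident, of Y] this]
    show "((\<lambda>\<eta>. Y * \<eta> * X ey (z \<eta> \<tau>)) has_real_derivative Y * X ey (z \<eta> \<tau>) + Y * \<eta> * (Y * Xd ey ey (z \<eta> \<tau>) + Y * \<tau> * Xd ey et (z \<eta> \<tau>))) (at \<eta> within {0..1})"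
      by (simp add: algebra_simps)
  next
    show "(\<lambda>\<tau>. Y * \<eta> * X ey (z \<eta> \<tau>)) integrable_on cbox 0 1" if "\<eta> \<in> {0..1}" for \<eta>
      using that by (intro integrable_continuous continuous_intros) (auto intro!: ct Xc)
    show "continuous_on ({0..1} \<times> cbox 0 1) (\<lambda>(\<eta>, \<tau>). Y * X ey (z \<eta> \<tau>) + Y * \<eta> * (Y * Xd ey ey (z \<eta> \<tau>) + Y * \<tau> * Xd ey et (z \<eta> \<tau>)))"
      unfolding split_beta by (intro continuous_intros) (auto intro!: ct2 Xc)
  qed (use \<eta> in auto)
  have ftc: "integral {0..1} f' = f 1 - f 0" if "\<And>\<tau>. \<tau> \<in> {0..1} \<Longrightarrow> (f has_real_derivative f' \<tau>) (at \<tau> within {0..1})" for f f' :: "real \<Rightarrow> real"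
    using that by (intro integral_unique fundamental_theorem_of_calculus) (auto simp: has_real_derivative_iff_has_vector_derivative)
  have B': "integral (cbox 0 1) (\<lambda>\<tau>. Y * X ey (z \<eta> \<tau>) + Y * \<eta> * (Y * Xd ey ey (z \<eta> \<tau>) + Y * \<tau> * Xd ey et (z \<eta> \<tau>)))
     = - \<gamma> * (Y * (v [ey] (z \<eta> 1) + v [et] (z \<eta> 1))) - T \<eta>" if \<eta>: "0 < \<eta>" "\<eta> < 1" for \<eta>
  proof -
    have \<eta>': "\<eta> \<in> {0..1}" using \<eta> by simp
    have 1: "integral {0..1} (\<lambda>\<tau>. Y * X ey (z \<eta> \<tau>) + Y * \<tau> * (Y * \<eta> * Xd ey et (z \<eta> \<tau>))) = Y * X ey (z \<eta> 1)"
    proof -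
      have "((\<lambda>\<tau>. Y * \<tau> * X ey (z \<eta> \<tau>)) has_real_derivative Y * X ey (z \<eta> \<tau>) + Y * \<tau> * (Y * \<eta> * Xd ey et (z \<eta> \<tau>))) (at \<tau> within {0..1})" if "\<tau> \<in> {0..1}" for \<tau>
      proof -
        have "((\<lambda>\<tau>. X ey (z \<eta> \<tau>)) has_real_derivative Y * \<eta> * Xd ey et (z \<eta> \<tau>)) (at \<tau> within {0..1})"
          using triangle_path_derivatives(2)[OF Xder[OF \<eta>' that, of ey, unfolded z_def]] by (simp add: z_def)
        from DERIV_mult[OF DERIV_cmult[OF DERIV_ident, of Y] this] show ?thesis by (simp add: algebra_simps)
      qed
      from ftc[OF this] show ?thesis by simp
    qed
    have 2: "integral {0..1} (\<lambda>\<tau>. Y\<^sup>2 * \<eta> * Xd et et (z \<eta> \<tau>)) = Y * X et (z \<eta> 1)"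
    proof -
      have "((\<lambda>\<tau>. Y * X et (z \<eta> \<tau>)) has_real_derivative Y\<^sup>2 * \<eta> * Xd et et (z \<eta> \<tau>)) (at \<tau> within {0..1})" if "\<tau> \<in> {0..1}" for \<tau>
      proof -
        have "((\<lambda>\<tau>. X et (z \<eta> \<tau>)) has_real_derivative Y * \<eta> * Xd et et (z \<eta> \<tau>)) (at \<tau> within {0..1})"
          using triangle_path_derivatives(2)[OF Xder[OF \<eta>' that, of et, unfolded z_def]] by (simp add: z_def)
        from DERIV_cmult[OF this, of Y] show ?thesis by (simp add: power2_eq_square mult.assoc)
      qed
      from ftc[OF this] have "integral {0..1} (\<lambda>\<tau>. Y\<^sup>2 * \<eta> * Xd et et (z \<eta> \<tau>)) = Y * X et (z \<eta> 1) - Y * X et (z \<eta> 0)" .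
      moreover have "X et (z \<eta> 0) = 0" using vt0[OF \<eta>] Wt0[OF \<eta>] by (simp add: X_def wronsk_def z_def)
      ultimately show ?thesis by simp
    qed
    have 3: "Xd ey ey (z \<eta> \<tau>) = Xd et et (z \<eta> \<tau>) - S (z \<eta> \<tau>)" if "\<tau> \<in> {0..1}" for \<tau>
      using wave_v[OF zU[OF \<eta>' that]] wave_W[OF zU[OF \<eta>' that]]
      by (simp add: Xd_def wronsk_deriv_same S_def sum_subtractf distrib_left sum_distrib_left)
    have "integral (cbox 0 1) (\<lambda>\<tau>. Y * X ey (z \<eta> \<tau>) + Y * \<eta> * (Y * Xd ey ey (z \<eta> \<tau>) + Y * \<tau> * Xd ey et (z \<eta> \<tau>)))
       = integral {0..1} (\<lambda>\<tau>. (Y * X ey (z \<eta> \<tau>) + Y * \<tau> * (Y * \<eta> * Xd ey et (z \<eta> \<tau>))) + (Y\<^sup>2 * \<eta> * Xd et et (z \<eta> \<tau>) - Y\<^sup>2 * \<eta> * S (z \<eta> \<tau>)))"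
      unfolding cbox_interval by (rule Henstock_Kurzweil_Integration.integral_cong) (simp add: 3 power2_eq_square algebra_simps)
    also have "\<dots> = integral {0..1} (\<lambda>\<tau>. Y * X ey (z \<eta> \<tau>) + Y * \<tau> * (Y * \<eta> * Xd ey et (z \<eta> \<tau>)))
        + (integral {0..1} (\<lambda>\<tau>. Y\<^sup>2 * \<eta> * Xd et et (z \<eta> \<tau>)) - T \<eta>)"
    proof -
      have i1: "(\<lambda>\<tau>. Y * X ey (z \<eta> \<tau>) + Y * \<tau> * (Y * \<eta> * Xd ey et (z \<eta> \<tau>))) integrable_on {0..1}"
        by (intro integrable_continuous_real continuous_intros ct[OF _ \<eta>'] Xc)
      have i2: "(\<lambda>\<tau>. Y\<^sup>2 * \<eta> * Xd et et (z \<eta> \<tau>)) integrable_on {0..1}"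
        by (intro integrable_continuous_real continuous_intros ct[OF _ \<eta>'] Xc)
      have i3: "(\<lambda>\<tau>. Y\<^sup>2 * \<eta> * S (z \<eta> \<tau>)) integrable_on {0..1}"
        by (intro integrable_continuous_real continuous_intros ct[OF _ \<eta>'] Sc)
      show ?thesis unfolding T_def
        using Henstock_Kurzweil_Integration.integral_add[OF i1 integrable_diff[OF i2 i3]] Henstock_Kurzweil_Integration.integral_diff[OF i2 i3] by simp
    qed
    also have "\<dots> = Y * (X ey (z \<eta> 1) + X et (z \<eta> 1)) - T \<eta>" unfolding 1 2 by (simp add: algebra_simps)
    also have "X ey (z \<eta> 1) + X et (z \<eta> 1) = - \<gamma> * (v [ey] (z \<eta> 1) + v [et] (z \<eta> 1))"
    proof -
      have zu: "z \<eta> 1 \<in> U" using zU[OF \<eta>'] by simp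
      have "((\<lambda>\<eta>. W [] (z \<eta> 1)) has_real_derivative Y * W [ey] (z \<eta> 1) + Y * W [et] (z \<eta> 1)) (at \<eta>)"
        using triangle_path_derivatives(1)[OF C2_familyD(2)[OF W, of "[]" "z \<eta> 1", unfolded z_def]] zu by (simp add: z_def)
      moreover have "((\<lambda>\<eta>. W [] (z \<eta> 1)) has_real_derivative 0) (at \<eta>)"
        by (rule has_field_derivative_transform_within_open[OF DERIV_const[of \<gamma>], where S="{0<..<1}"]) (use \<eta> cone in \<open>auto simp: z_def\<close>)
      ultimately have "Y * W [ey] (z \<eta> 1) + Y * W [et] (z \<eta> 1) = 0" by (rule DERIV_unique)
      then have "Y * (W [ey] (z \<eta> 1) + W [et] (z \<eta> 1)) = 0" by (simp add: algebra_simps)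
      then have "W [ey] (z \<eta> 1) = - W [et] (z \<eta> 1)" using Y by simp
      then show ?thesis using cone[OF \<eta>'] by (simp add: X_def wronsk_def z_def algebra_simps)
    qed
    finally show ?thesis by (simp add: algebra_simps)
  qed
  have "((\<lambda>\<eta>. - \<gamma> * (Y * (v [ey] (z \<eta> 1) + v [et] (z \<eta> 1))) - T \<eta>) has_integral (B 1 - B 0)) {0..1}"
  proof (rule fundamental_theorem_of_calculus_interior)
    show "continuous_on {0..1} B"
      using Bd by (meson DERIV_continuous continuous_on_eq_continuous_within)
    show "(B has_vector_derivative - \<gamma> * (Y * (v [ey] (z \<eta> 1) + v [et] (z \<eta> 1))) - T \<eta>) (at \<eta>)" if "\<eta> \<in> {0<..<1}" for \<eta>
    proof -
      have "at \<eta> within {0..1} = at \<eta>" using that by (intro at_within_interior) (auto simp: interior_atLeastAtMost_real)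
      then show ?thesis using Bd[of \<eta>] B'[of \<eta>] that by (simp add: has_real_derivative_iff_has_vector_derivative)
    qed
  qed simp
  moreover have "((\<lambda>\<eta>. - \<gamma> * (Y * (v [ey] (z \<eta> 1) + v [et] (z \<eta> 1))) - T \<eta>) has_integral (- \<gamma> * (v [] (z 1 1) - v [] (z 0 1)) - integral {0..1} T)) {0..1}"
  proof (intro has_integral_diff has_integral_mult_right)
    show "((\<lambda>\<eta>. Y * (v [ey] (z \<eta> 1) + v [et] (z \<eta> 1))) has_integral (v [] (z 1 1) - v [] (z 0 1))) {0..1}"
    proof (rule fundamental_theorem_of_calculus)
      fix \<eta> :: real assume "\<eta> \<in> {0..1}"
      then have zu: "z \<eta> 1 \<in> U" using zU by simp
      have "((\<lambda>\<eta>. v [] (z \<eta> 1)) has_real_derivative Y * v [ey] (z \<eta> 1) + Y * v [et] (z \<eta> 1)) (at \<eta> within {0..1})"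
        using triangle_path_derivatives(1)[OF C2_familyD(2)[OF v, of "[]" "z \<eta> 1", unfolded z_def]] zu by (simp add: z_def)
      then show "((\<lambda>\<eta>. v [] (z \<eta> 1)) has_vector_derivative Y * (v [ey] (z \<eta> 1) + v [et] (z \<eta> 1))) (at \<eta> within {0..1})"
        by (simp add: has_real_derivative_iff_has_vector_derivative distrib_left)
    qed simp
    show "(T has_integral integral {0..1} T) {0..1}" using Tc by (intro integrable_integral integrable_continuous_real)
  qed
  ultimately have "B 1 - B 0 = - \<gamma> * (v [] (z 1 1) - v [] (z 0 1)) - integral {0..1} T"
    by (rule has_integral_unique)
  moreover have "B 0 = 0" by (simp add: B_def)
  moreover have "B 1 = integral {0..1} (\<lambda>\<tau>. Y * X ey (x, Y, Y * \<tau>))" by (simp add: B_def z_def)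
  ultimately have "integral {0..1} (\<lambda>\<tau>. Y * X ey (x, Y, Y * \<tau>)) = \<gamma> * (v [] (x, 0, 0) - v [] (x, Y, Y)) - integral {0..1} T"
    by (simp add: z_def algebra_simps)
  then show ?thesis unfolding X_def T_def[abs_def] S_def Xd_def z_def .
qed

lemma has_derivative_cone_flux:
  fixes F :: "'a::euclidean_space \<times> real \<times> real \<Rightarrow> real" and Y Yd :: "'a \<Rightarrow> real"
  assumes F: "\<And>z. z \<in> U \<Longrightarrow> (F has_derivative (\<lambda>d. DF d z)) (at z)"
    and Fc: "continuous_on U F" "\<And>d. continuous_on U (DF d)"
    and P: "open P" "x \<in> P" and Yc: "continuous_on P Y" "continuous_on P Yd"
    and Yd: "\<And>x. x \<in> P \<Longrightarrow> ((\<lambda>s. Y (x + s *\<^sub>R b)) has_real_derivative Yd x) (at 0)"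
    and sub: "\<And>x \<eta> \<tau>. x \<in> P \<Longrightarrow> \<eta> \<in> {0..1} \<Longrightarrow> \<tau> \<in> {0..1} \<Longrightarrow> (x, Y x * \<eta>, Y x * \<eta> * \<tau>) \<in> U"
  shows "((\<lambda>s. integral {0..1} (\<lambda>\<eta>. integral {0..1} (\<lambda>\<tau>. (Y (x + s *\<^sub>R b))\<^sup>2 * \<eta> * F (x + s *\<^sub>R b, Y (x + s *\<^sub>R b) * \<eta>, Y (x + s *\<^sub>R b) * \<eta> * \<tau>))))
     has_real_derivative
       Yd x * integral {0..1} (\<lambda>\<tau>. Y x * F (x, Y x, Y x * \<tau>))
       + integral {0..1} (\<lambda>\<eta>. integral {0..1} (\<lambda>\<tau>. (Y x)\<^sup>2 * \<eta> * DF (b, 0, 0) (x, Y x * \<eta>, Y x * \<eta> * \<tau>)))) (at 0)"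
proof -
  obtain r where r: "r > 0" "\<And>s. s \<in> {-r..r} \<Longrightarrow> x + s *\<^sub>R b \<in> P"
  proof -
    have "((\<lambda>s. x + s *\<^sub>R b) \<longlongrightarrow> x + 0 *\<^sub>R b) (nhds 0)" by (intro tendsto_intros filterlim_ident)
    then have "\<forall>\<^sub>F s in nhds (0::real). x + s *\<^sub>R b \<in> P" using P topological_tendstoD by fastforce
    then obtain d where "d > 0" "\<And>s. dist s 0 < d \<Longrightarrow> x + s *\<^sub>R b \<in> P" unfolding eventually_nhds_metric by blast
    then show thesis by (intro that[of "d / 2"]) auto
  qed
  define I where "I = {-r..r}"
  define Q where "Q = cbox (0::real, 0::real) (1, 1)"
  have Q: "Q = {0..1} \<times> {0..1}" by (auto simp: Q_def cbox_Pair_eq)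
  define y where "y s = Y (x + s *\<^sub>R b)" for s
  define yd where "yd s = Yd (x + s *\<^sub>R b)" for s
  have yder: "(y has_real_derivative yd s) (at s within I)" if "s \<in> I" for s
  proof -
    have "((\<lambda>t. Y (x + s *\<^sub>R b + (t + - s) *\<^sub>R b)) has_real_derivative yd s) (at s)"
      using DERIV_shift[of "\<lambda>t. Y (x + s *\<^sub>R b + t *\<^sub>R b)" "yd s" s "- s"] Yd[of "x + s *\<^sub>R b"] r(2) that by (simp add: I_def yd_def)
    then show ?thesis by (simp add: algebra_simps y_def[abs_def] has_field_derivative_at_within)
  qed
  have yc: "continuous_on I y" "continuous_on I yd"
    unfolding y_def[abs_def] yd_def[abs_def] using r(2)
    by (auto intro!: continuous_on_compose2[OF Yc(1)] continuous_on_compose2[OF Yc(2)] continuous_intros simp: I_def)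
  define z where "z s p = (x + s *\<^sub>R b, y s * fst p, y s * fst p * snd p)" for s and p :: "real \<times> real"
  have zU: "z s p \<in> U" if "s \<in> I" "p \<in> Q" for s p
    using sub[OF r(2), of s "fst p" "snd p"] that by (auto simp: z_def y_def Q I_def)
  have zc: "continuous_on (I \<times> Q) (\<lambda>q. H (z (fst q) (snd q)))" if "continuous_on U H" for H :: "'a \<times> real \<times> real \<Rightarrow> real"
    unfolding z_def
    by (rule continuous_on_triangle[OF that])
      (use zU in \<open>auto intro!: continuous_intros continuous_on_compose2[OF yc(1)] simp: z_def\<close>)
  have zcQ: "continuous_on Q (\<lambda>p. H (z s p))" if "continuous_on U H" "s \<in> I" for H :: "'a \<times> real \<times> real \<Rightarrow> real" and s
    unfolding z_def
    by (rule continuous_on_triangle[OF that(1)])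
      (use zU that in \<open>auto intro!: continuous_intros simp: z_def\<close>)
  define G where "G s p = (y s)\<^sup>2 * fst p * F (z s p)" for s p
  define Gd where "Gd s p = 2 * y s * yd s * fst p * F (z s p) + (y s)\<^sup>2 * fst p * (DF (b, 0, 0) (z s p) + yd s * fst p * DF ey (z s p) + yd s * fst p * snd p * DF et (z s p))" for s p
  have "0 \<in> I" using r by (simp add: I_def)
  have "((\<lambda>s. integral Q (G s)) has_real_derivative integral Q (Gd 0)) (at 0 within I)"
    unfolding Q_def
  proof (rule leibniz_rule_field_derivative[where fx=Gd], unfold Q_def[symmetric])
    fix s p assume s: "s \<in> I" and p: "p \<in> Q"
    have pd: "((\<lambda>s. z s p) has_vector_derivative (b, yd s * fst p, yd s * fst p * snd p)) (at s within I)"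
    proof -
      have "((\<lambda>s. y s * fst p) has_vector_derivative yd s * fst p) (at s within I)"
        "((\<lambda>s. y s * fst p * snd p) has_vector_derivative yd s * fst p * snd p) (at s within I)"
        using yder[OF s] unfolding has_real_derivative_iff_has_vector_derivative[symmetric]
        by (auto intro!: derivative_eq_intros)
      moreover have "((\<lambda>s. x + s *\<^sub>R b) has_vector_derivative b) (at s within I)"
        unfolding has_vector_derivative_def by (auto intro!: derivative_eq_intros)
      ultimately show ?thesis unfolding z_def[abs_def] by (intro has_vector_derivative_Pair)
    qed
    note FU = F[OF zU[OF s p]]
    have "((\<lambda>s. F (z s p)) has_real_derivative DF (b, yd s * fst p, yd s * fst p * snd p) (z s p)) (at s within I)"
      by (rule has_derivative_path[where p="\<lambda>s. z s p", OF FU pd])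
    also have "DF (b, yd s * fst p, yd s * fst p * snd p) (z s p) = DF (b, 0, 0) (z s p) + yd s * fst p * DF ey (z s p) + yd s * fst p * snd p * DF et (z s p)"
      by (rule linear_coords[OF has_derivative_linear[OF FU]])
    finally have Fd: "((\<lambda>s. F (z s p)) has_real_derivative DF (b, 0, 0) (z s p) + yd s * fst p * DF ey (z s p) + yd s * fst p * snd p * DF et (z s p)) (at s within I)" .
    show "((\<lambda>s. G s p) has_real_derivative Gd s p) (at s within I)"
      unfolding G_def[abs_def] Gd_def
      by (rule DERIV_cong[OF DERIV_mult[OF DERIV_cmult_right[OF DERIV_power[OF yder[OF s]]] Fd]])
        (simp add: algebra_simps)
  next
    show "G s integrable_on Q" if "s \<in> I" for s
      unfolding Q_def by (rule integrable_continuous, unfold Q_def[symmetric] G_def[abs_def]) (intro continuous_intros zcQ that Fc)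
    show "continuous_on (I \<times> Q) (\<lambda>(s, p). Gd s p)"
      unfolding Gd_def split_beta
      by (intro continuous_intros zc Fc continuous_on_compose2[OF yc(1)] continuous_on_compose2[OF yc(2)]) auto
  qed (use r in \<open>auto simp: I_def\<close>)
  moreover have "at (0::real) within I = at 0"
    unfolding I_def using r by (intro at_within_interior) (auto simp: interior_atLeastAtMost_real)
  ultimately have 1: "((\<lambda>s. integral Q (G s)) has_real_derivative integral Q (Gd 0)) (at 0)" by simp
  have 2: "integral Q (G s) = integral {0..1} (\<lambda>\<eta>. integral {0..1} (\<lambda>\<tau>. (Y (x + s *\<^sub>R b))\<^sup>2 * \<eta> * F (x + s *\<^sub>R b, Y (x + s *\<^sub>R b) * \<eta>, Y (x + s *\<^sub>R b) * \<eta> * \<tau>)))"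
    if s: "s \<in> I" for s
  proof -
    have "continuous_on (cbox (0, 0) (1, 1)) (G s)"
      unfolding Q_def[symmetric] G_def[abs_def] by (intro continuous_intros zcQ s Fc)
    from integral_prod_continuous[OF this] show ?thesis by (simp add: Q_def G_def z_def y_def)
  qed
  define G1 where "G1 p = 2 * y 0 * fst p * F (z 0 p) + (y 0)\<^sup>2 * fst p * fst p * (DF ey (z 0 p) + snd p * DF et (z 0 p))" for p
  define G2 where "G2 p = (y 0)\<^sup>2 * fst p * DF (b, 0, 0) (z 0 p)" for p
  have G1c: "continuous_on (cbox (0, 0) (1, 1)) G1" and G2c: "continuous_on (cbox (0, 0) (1, 1)) G2"
    unfolding Q_def[symmetric] G1_def[abs_def] G2_def[abs_def]
    using \<open>0 \<in> I\<close> by (auto intro!: continuous_intros zcQ Fc)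
  have "integral Q (Gd 0) = integral Q (\<lambda>p. yd 0 * G1 p + G2 p)"
    by (rule Henstock_Kurzweil_Integration.integral_cong) (simp add: Gd_def G1_def G2_def algebra_simps)
  also have "\<dots> = yd 0 * integral Q G1 + integral Q G2"
    unfolding Q_def
    using integrable_continuous[OF G1c] integrable_continuous[OF G2c]
    by (simp add: Henstock_Kurzweil_Integration.integral_add integrable_on_mult_right)
  also have "integral Q G1 = integral {0..1} (\<lambda>\<tau>. y 0 * F (x, y 0, y 0 * \<tau>))"
  proof -
    have "integral Q G1 = integral (cbox 0 1) (\<lambda>\<eta>. integral (cbox 0 1) (\<lambda>\<tau>. G1 (\<eta>, \<tau>)))"
      unfolding Q_def by (rule integral_prod_continuous[OF G1c])
    also have "\<dots> = integral (cbox 0 1) (\<lambda>\<tau>. integral (cbox 0 1) (\<lambda>\<eta>. G1 (\<eta>, \<tau>)))"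
      by (rule integral_swap_continuous) (use G1c in simp)
    also have "\<dots> = integral (cbox 0 1) (\<lambda>\<tau>. y 0 * F (x, y 0, y 0 * \<tau>))"
    proof (rule Henstock_Kurzweil_Integration.integral_cong)
      fix \<tau> :: real assume \<tau>: "\<tau> \<in> cbox 0 1"
      have "((\<lambda>\<eta>. G1 (\<eta>, \<tau>)) has_integral (y 0 * 1\<^sup>2 * F (x, y 0 * 1, y 0 * 1 * \<tau>) - y 0 * 0\<^sup>2 * F (x, y 0 * 0, y 0 * 0 * \<tau>))) {0..1}"
      proof (rule fundamental_theorem_of_calculus)
        fix \<eta> :: real assume \<eta>: "\<eta> \<in> {0..1}"
        have zU0: "(x, y 0 * \<eta>, y 0 * \<eta> * \<tau>) \<in> U" using zU[OF \<open>0 \<in> I\<close>, of "(\<eta>, \<tau>)"] \<eta> \<tau> by (simp add: z_def Q)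
        have "((\<lambda>\<eta>. F (x, y 0 * \<eta>, y 0 * \<eta> * \<tau>)) has_real_derivative y 0 * DF ey (x, y 0 * \<eta>, y 0 * \<eta> * \<tau>) + y 0 * \<tau> * DF et (x, y 0 * \<eta>, y 0 * \<eta> * \<tau>)) (at \<eta> within {0..1})"
          by (rule triangle_path_derivatives(1)[OF F[OF zU0]])
        from DERIV_mult[OF DERIV_cmult[OF DERIV_power[OF DERIV_ident, of 2], of "y 0"] this]
        show "((\<lambda>\<eta>. y 0 * \<eta>\<^sup>2 * F (x, y 0 * \<eta>, y 0 * \<eta> * \<tau>)) has_vector_derivative G1 (\<eta>, \<tau>)) (at \<eta> within {0..1})"
          unfolding has_real_derivative_iff_has_vector_derivative[symmetric]
          by (rule DERIV_cong) (simp add: G1_def z_def power2_eq_square algebra_simps)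
      qed simp
      then show "integral (cbox 0 1) (\<lambda>\<eta>. G1 (\<eta>, \<tau>)) = y 0 * F (x, y 0, y 0 * \<tau>)" by (simp add: integral_unique)
    qed
    finally show ?thesis by simp
  qed
  also have "integral Q G2 = integral {0..1} (\<lambda>\<eta>. integral {0..1} (\<lambda>\<tau>. G2 (\<eta>, \<tau>)))"
    unfolding Q_def using integral_prod_continuous[OF G2c] by simp
  finally have 3: "integral Q (Gd 0) = Yd x * integral {0..1} (\<lambda>\<tau>. Y x * F (x, Y x, Y x * \<tau>))
       + integral {0..1} (\<lambda>\<eta>. integral {0..1} (\<lambda>\<tau>. (Y x)\<^sup>2 * \<eta> * DF (b, 0, 0) (x, Y x * \<eta>, Y x * \<eta> * \<tau>)))"
    by (simp add: yd_def y_def G2_def z_def)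
  show ?thesis
    unfolding 3[symmetric]
    by (rule has_field_derivative_transform_within_open[OF 1, where S="{-r<..<r}"])
      (use r 2 in \<open>auto simp: I_def\<close>)
qed

lemma continuous_on_integral_triangle:
  fixes F :: "'a::euclidean_space \<times> real \<times> real \<Rightarrow> real" and k :: "'p::topological_space \<Rightarrow> 'a"
  assumes Fc: "continuous_on U F" and Yc: "continuous_on P Y" and kc: "continuous_on P k"
    and sub: "\<And>x \<eta> \<tau>. x \<in> P \<Longrightarrow> \<eta> \<in> {0..1} \<Longrightarrow> \<tau> \<in> {0..1} \<Longrightarrow> (k x, Y x * \<eta>, Y x * \<eta> * \<tau>) \<in> U"
  shows "continuous_on P (\<lambda>x. integral {0..1} (\<lambda>\<eta>. integral {0..1} (\<lambda>\<tau>. (Y x)\<^sup>2 * \<eta> * F (k x, Y x * \<eta>, Y x * \<eta> * \<tau>))))"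
    and "continuous_on P (\<lambda>x. integral {0..1} (\<lambda>\<tau>. Y x * F (k x, Y x, Y x * \<tau>)))"
proof -
  have "continuous_on ((P \<times> {0..1}) \<times> cbox 0 1) (\<lambda>q. (Y (fst (fst q)))\<^sup>2 * snd (fst q) * F (k (fst (fst q)), Y (fst (fst q)) * snd (fst q), Y (fst (fst q)) * snd (fst q) * snd q))"
    by (intro continuous_intros continuous_on_compose2[OF Yc] continuous_on_compose2[OF kc] continuous_on_triangle[OF Fc]) (use sub in auto)
  then have "continuous_on (P \<times> {0..1}) (\<lambda>q. integral (cbox 0 1) (\<lambda>\<tau>. (Y (fst q))\<^sup>2 * snd q * F (k (fst q), Y (fst q) * snd q, Y (fst q) * snd q * \<tau>)))"
    by (intro integral_continuous_on_param) (simp add: split_beta)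
  then have "continuous_on P (\<lambda>x. integral (cbox 0 1) (\<lambda>\<eta>. integral (cbox 0 1) (\<lambda>\<tau>. (Y x)\<^sup>2 * \<eta> * F (k x, Y x * \<eta>, Y x * \<eta> * \<tau>))))"
    by (intro integral_continuous_on_param) (simp add: split_beta)
  then show "continuous_on P (\<lambda>x. integral {0..1} (\<lambda>\<eta>. integral {0..1} (\<lambda>\<tau>. (Y x)\<^sup>2 * \<eta> * F (k x, Y x * \<eta>, Y x * \<eta> * \<tau>))))"
    by simp
  have "continuous_on (P \<times> cbox 0 1) (\<lambda>q. Y (fst q) * F (k (fst q), Y (fst q) * 1, Y (fst q) * 1 * snd q))"
    by (intro continuous_intros continuous_on_compose2[OF Yc] continuous_on_compose2[OF kc] continuous_on_triangle[OF Fc]) (use sub[of _ 1] in auto)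
  then have "continuous_on P (\<lambda>x. integral (cbox 0 1) (\<lambda>\<tau>. Y x * F (k x, Y x, Y x * \<tau>)))"
    by (intro integral_continuous_on_param) (simp add: split_beta)
  then show "continuous_on P (\<lambda>x. integral {0..1} (\<lambda>\<tau>. Y x * F (k x, Y x, Y x * \<tau>)))" by simp
qed

text \<open>Here \<open>Yd b\<close> stands for \<open>\<partial>\<^sub>b Y\<close>. Up to the normalisation of the normal vector,
  \<open>lateral_flux\<close> is the density with respect to \<open>dx\<close> of the flux through the graph of \<open>Y\<close>, restricted
  to \<open>t \<ge> 0\<close>, and \<open>cone_flux b\<close> is the flux in the horizontal direction \<open>b\<close> over the triangle above \<open>x\<close>.\<close>

definition lateral_flux where
  "lateral_flux v W Y Yd x = integral {0..1} (\<lambda>\<tau>. Y x * wronsk v W ey (x, Y x, Y x * \<tau>))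
     - (\<Sum>b\<in>Basis. Yd b x * integral {0..1} (\<lambda>\<tau>. Y x * wronsk v W (b, 0, 0) (x, Y x, Y x * \<tau>)))"

definition cone_flux where
  "cone_flux v W Y b x = integral {0..1} (\<lambda>\<eta>. integral {0..1} (\<lambda>\<tau>. (Y x)\<^sup>2 * \<eta> * wronsk v W (b, 0, 0) (x, Y x * \<eta>, Y x * \<eta> * \<tau>)))"

lemma green_cone_cutoff:
  fixes v W :: "('a::euclidean_space \<times> real \<times> real) list \<Rightarrow> 'a \<times> real \<times> real \<Rightarrow> real"
  assumes v: "C2_family U v" and W: "C2_family U W"
    and P: "open P" "compact K" "K \<subseteq> P"
    and Y: "\<And>x. x \<in> P \<Longrightarrow> Y x > 0" and Yc: "continuous_on P Y" "\<And>b. b \<in> Basis \<Longrightarrow> continuous_on P (Yd b)"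
    and Yd: "\<And>b x. b \<in> Basis \<Longrightarrow> x \<in> P \<Longrightarrow> ((\<lambda>s. Y (x + s *\<^sub>R b)) has_real_derivative Yd b x) (at 0)"
    and sub: "\<And>x \<eta> \<tau>. x \<in> P \<Longrightarrow> \<eta> \<in> {0..1} \<Longrightarrow> \<tau> \<in> {0..1} \<Longrightarrow> (x, Y x * \<eta>, Y x * \<eta> * \<tau>) \<in> U"
    and wave_v: "\<And>z. z \<in> U \<Longrightarrow> v [et, et] z = v [ey, ey] z + (\<Sum>b\<in>Basis. v [(b, 0, 0), (b, 0, 0)] z)"
    and wave_W: "\<And>z. z \<in> U \<Longrightarrow> W [et, et] z = W [ey, ey] z + (\<Sum>b\<in>Basis. W [(b, 0, 0), (b, 0, 0)] z)"
    and vt0: "\<And>x y. x \<in> P \<Longrightarrow> 0 < y \<Longrightarrow> y < Y x \<Longrightarrow> v [et] (x, y, 0) = 0"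
    and Wt0: "\<And>x y. x \<in> P \<Longrightarrow> 0 < y \<Longrightarrow> y < Y x \<Longrightarrow> W [et] (x, y, 0) = 0"
    and cone: "\<And>x y. x \<in> P \<Longrightarrow> 0 \<le> y \<Longrightarrow> y \<le> Y x \<Longrightarrow> W [] (x, y, y) = \<gamma> x" and \<gamma>: "continuous_on P \<gamma>"
    and c: "continuous_on UNIV c" "\<And>b. b \<in> Basis \<Longrightarrow> continuous_on UNIV (c' b)" "\<And>x. x \<notin> K \<Longrightarrow> c x = 0"
    and dc: "\<And>b x. b \<in> Basis \<Longrightarrow> ((\<lambda>s. c (x + s *\<^sub>R b)) has_real_derivative c' b x) (at 0)"
  shows "integral UNIV (\<lambda>x. c x * lateral_flux v W Y Yd x)
    = integral UNIV (\<lambda>x. c x * (\<gamma> x * (v [] (x, 0, 0) - v [] (x, Y x, Y x))))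
      + (\<Sum>b\<in>Basis. integral UNIV (\<lambda>x. c' b x * cone_flux v W Y b x))"
proof -
  define D where "D b x = Yd b x * integral {0..1} (\<lambda>\<tau>. Y x * wronsk v W (b, 0, 0) (x, Y x, Y x * \<tau>))
       + integral {0..1} (\<lambda>\<eta>. integral {0..1} (\<lambda>\<tau>. (Y x)\<^sup>2 * \<eta> * wronsk_deriv v W (b, 0, 0) (b, 0, 0) (x, Y x * \<eta>, Y x * \<eta> * \<tau>)))" for b x
  note wc = wronsk_continuous[OF v W]
  have der: "((\<lambda>s. cone_flux v W Y b (x + s *\<^sub>R b)) has_real_derivative D b x) (at 0)" if "x \<in> P" "b \<in> Basis" for x b
    unfolding cone_flux_def D_def
    by (rule has_derivative_cone_flux[where F="wronsk v W (b, 0, 0)" and DF="wronsk_deriv v W (b, 0, 0)" and U=U and P=P])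
      (use that in \<open>auto intro!: wronsk_has_derivative[OF v W] wc P Yc Yd sub\<close>)
  have cf: "continuous_on P (cone_flux v W Y b)" for b
    unfolding cone_flux_def[abs_def] by (rule continuous_on_integral_triangle(1)[OF wc(1) Yc(1) continuous_on_id sub])
  have Dc: "continuous_on P (D b)" if "b \<in> Basis" for b
    unfolding D_def[abs_def]
    by (intro continuous_intros Yc(2)[OF that] continuous_on_integral_triangle(2)[OF wc(1) Yc(1) continuous_on_id sub] continuous_on_integral_triangle(1)[OF wc(2) Yc(1) continuous_on_id sub])
  have u: "continuous_on P (\<lambda>x. \<gamma> x * (v [] (x, 0, 0) - v [] (x, Y x, Y x)))"
  proof -
    have "continuous_on P (\<lambda>x. v [] (x, 0, 0))" "continuous_on P (\<lambda>x. v [] (x, Y x, Y x))"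
      using sub[of _ 0 0] sub[of _ 1 1]
      by (auto intro!: continuous_on_compose2[OF C2_familyD(3)[OF v, of "[]"]] continuous_intros Yc(1))
    then show ?thesis by (intro continuous_intros \<gamma>)
  qed
  have pointwise: "lateral_flux v W Y Yd x = \<gamma> x * (v [] (x, 0, 0) - v [] (x, Y x, Y x)) - (\<Sum>b\<in>Basis. D b x)" if x: "x \<in> P" for x
  proof -
    have "integral {0..1} (\<lambda>\<tau>. Y x * wronsk v W ey (x, Y x, Y x * \<tau>))
      = \<gamma> x * (v [] (x, 0, 0) - v [] (x, Y x, Y x))
      - integral {0..1} (\<lambda>\<eta>. integral {0..1} (\<lambda>\<tau>. (Y x)\<^sup>2 * \<eta> * (\<Sum>b\<in>Basis. wronsk_deriv v W (b, 0, 0) (b, 0, 0) (x, Y x * \<eta>, Y x * \<eta> * \<tau>))))"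
      by (rule green_triangle[OF v W Y[OF x] sub[OF x] wave_v wave_W])
        (use Y[OF x] in \<open>auto intro!: vt0[OF x] Wt0[OF x] cone[OF x] mult_left_le\<close>)
    also have "integral {0..1} (\<lambda>\<eta>. integral {0..1} (\<lambda>\<tau>. (Y x)\<^sup>2 * \<eta> * (\<Sum>b\<in>Basis. wronsk_deriv v W (b, 0, 0) (b, 0, 0) (x, Y x * \<eta>, Y x * \<eta> * \<tau>))))
      = (\<Sum>b\<in>Basis. integral {0..1} (\<lambda>\<eta>. integral {0..1} (\<lambda>\<tau>. (Y x)\<^sup>2 * \<eta> * wronsk_deriv v W (b, 0, 0) (b, 0, 0) (x, Y x * \<eta>, Y x * \<eta> * \<tau>))))"
    proof -
      have c2: "continuous_on ({0..1} \<times> cbox 0 1) (\<lambda>p. (Y x)\<^sup>2 * fst p * wronsk_deriv v W (b, 0, 0) (b, 0, 0) (x, Y x * fst p, Y x * fst p * snd p))" for b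
        by (intro continuous_intros continuous_on_triangle[OF wc(2)]) (use sub[OF x] in auto)
      have i: "(\<lambda>\<tau>. (Y x)\<^sup>2 * \<eta> * wronsk_deriv v W (b, 0, 0) (b, 0, 0) (x, Y x * \<eta>, Y x * \<eta> * \<tau>)) integrable_on {0..1}" if "\<eta> \<in> {0..1}" for b \<eta>
        by (intro integrable_continuous_real continuous_intros continuous_on_triangle[OF wc(2)]) (use sub[OF x] that in auto)
      have o: "(\<lambda>\<eta>. integral {0..1} (\<lambda>\<tau>. (Y x)\<^sup>2 * \<eta> * wronsk_deriv v W (b, 0, 0) (b, 0, 0) (x, Y x * \<eta>, Y x * \<eta> * \<tau>))) integrable_on {0..1}" for b
        using integral_continuous_on_param[of "{0..1}" 0 1 "\<lambda>\<eta> \<tau>. (Y x)\<^sup>2 * \<eta> * wronsk_deriv v W (b, 0, 0) (b, 0, 0) (x, Y x * \<eta>, Y x * \<eta> * \<tau>)"] c2[of b]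
        by (intro integrable_continuous_real) (simp add: split_beta)
      have "integral {0..1} (\<lambda>\<eta>. integral {0..1} (\<lambda>\<tau>. (Y x)\<^sup>2 * \<eta> * (\<Sum>b\<in>Basis. wronsk_deriv v W (b, 0, 0) (b, 0, 0) (x, Y x * \<eta>, Y x * \<eta> * \<tau>))))
        = integral {0..1} (\<lambda>\<eta>. \<Sum>b\<in>Basis. integral {0..1} (\<lambda>\<tau>. (Y x)\<^sup>2 * \<eta> * wronsk_deriv v W (b, 0, 0) (b, 0, 0) (x, Y x * \<eta>, Y x * \<eta> * \<tau>)))"
        by (intro Henstock_Kurzweil_Integration.integral_cong, unfold sum_distrib_left)
          (intro Henstock_Kurzweil_Integration.integral_sum i finite_Basis)
      also have "\<dots> = (\<Sum>b\<in>Basis. integral {0..1} (\<lambda>\<eta>. integral {0..1} (\<lambda>\<tau>. (Y x)\<^sup>2 * \<eta> * wronsk_deriv v W (b, 0, 0) (b, 0, 0) (x, Y x * \<eta>, Y x * \<eta> * \<tau>))))"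
        by (intro Henstock_Kurzweil_Integration.integral_sum o finite_Basis)
      finally show ?thesis .
    qed
    finally show ?thesis by (simp add: lateral_flux_def D_def sum.distrib)
  qed
  have cP: "continuous_on P c" using c(1) continuous_on_subset by blast
  obtain a1 a2 where box: "K \<subseteq> cbox a1 a2" using compact_subset_cbox[OF P(2)] by blast
  have int: "(\<lambda>x. c x * f x) integrable_on UNIV" if "continuous_on P f" for f
    by (rule integral_compact_support(1)[OF continuous_on_cutoff_mult[OF P cP that c(3)] _ refl, of a1 a2]) (use box c(3) in auto)
  have "integral UNIV (\<lambda>x. c x * lateral_flux v W Y Yd x)
    = integral UNIV (\<lambda>x. c x * (\<gamma> x * (v [] (x, 0, 0) - v [] (x, Y x, Y x))) - (\<Sum>b\<in>Basis. c x * D b x))"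
  proof (rule Henstock_Kurzweil_Integration.integral_cong)
    show "c x * lateral_flux v W Y Yd x = c x * (\<gamma> x * (v [] (x, 0, 0) - v [] (x, Y x, Y x))) - (\<Sum>b\<in>Basis. c x * D b x)" for x
    proof (cases "x \<in> P")
      case True
      then show ?thesis by (simp add: pointwise right_diff_distrib sum_distrib_left)
    next
      case False
      then have "c x = 0" using c(3) P(3) by blast
      then show ?thesis by simp
    qed
  qed
  also have "\<dots> = integral UNIV (\<lambda>x. c x * (\<gamma> x * (v [] (x, 0, 0) - v [] (x, Y x, Y x)))) - (\<Sum>b\<in>Basis. integral UNIV (\<lambda>x. c x * D b x))"
    using int[OF u] int[OF Dc]
    by (simp add: Henstock_Kurzweil_Integration.integral_diff Henstock_Kurzweil_Integration.integral_sum integrable_sum)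
  also have "(\<Sum>b\<in>Basis. integral UNIV (\<lambda>x. c x * D b x)) = (\<Sum>b\<in>Basis. - integral UNIV (\<lambda>x. c' b x * cone_flux v W Y b x))"
    by (intro sum.cong refl integration_by_parts_cutoff(1)[OF P c(1) c(2) c(3) dc cf Dc der]) auto
  finally show ?thesis by (simp add: sum_negf)
qed

lemma tendsto_integral_cutoff:
  fixes f :: "real \<Rightarrow> 'a::euclidean_space \<Rightarrow> real"
  assumes P: "open P" "compact K" "K \<subseteq> P"
    and c: "continuous_on UNIV c" "\<And>x. x \<notin> K \<Longrightarrow> c x = 0"
    and f: "continuous_on ({1/2..1} \<times> P) (\<lambda>q. f (fst q) (snd q))"
  shows "((\<lambda>r. integral UNIV (\<lambda>x. c x * f r x)) \<longlongrightarrow> integral UNIV (\<lambda>x. c x * f 1 x)) (at_left 1)"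
proof -
  obtain a1 a2 where box: "K \<subseteq> cbox a1 a2" using compact_subset_cbox[OF P(2)] by blast
  have fr: "continuous_on P (f r)" if "r \<in> {1/2..1}" for r
  proof -
    have "continuous_on P (\<lambda>x. f (fst (r, x)) (snd (r, x)))"
      by (rule continuous_on_compose2[OF f, where f="\<lambda>x. (r, x)"]) (use that in \<open>auto intro!: continuous_on_Pair continuous_on_const continuous_on_id\<close>)
    then show ?thesis by simp
  qed
  have cf: "continuous_on UNIV (\<lambda>x. c x * f r x)" if "r \<in> {1/2..1}" for r
    by (rule continuous_on_cutoff_mult[OF P continuous_on_subset[OF c(1)] fr[OF that] c(2)]) simp
  have int: "integral UNIV (\<lambda>x. c x * f r x) = integral (cbox a1 a2) (\<lambda>x. c x * f r x)" if "r \<in> {1/2..1}" for r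
    by (rule integral_compact_support(2)[OF cf[OF that] _ refl]) (use c(2) box in auto)
  have "bounded (c ` K)"
    by (rule compact_imp_bounded, rule compact_continuous_image[OF continuous_on_subset[OF c(1)] P(2)]) simp
  then obtain B where B: "\<And>x. x \<in> K \<Longrightarrow> \<bar>c x\<bar> \<le> B" unfolding bounded_iff by fastforce
  define B' where "B' = \<bar>B\<bar> + 1"
  define m where "m = measure lborel (cbox a1 a2) + 1"
  have B': "B' > 0" "\<And>x. x \<in> K \<Longrightarrow> \<bar>c x\<bar> \<le> B'" using B by (fastforce simp: B'_def)+
  have m: "m > 0" by (simp add: m_def add_nonneg_pos)
  have "uniformly_continuous_on ({1/2..1} \<times> K) (\<lambda>q. f (fst q) (snd q))"
    by (rule compact_uniformly_continuous[OF continuous_on_subset[OF f]]) (use P in \<open>auto intro: compact_Times\<close>)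
  note uc = this[unfolded uniformly_continuous_on_def]
  show ?thesis
  proof (rule tendstoI)
    fix e :: real assume e: "e > 0"
    define e' where "e' = e / (B' * m)"
    have "e' > 0" using e B' m by (simp add: e'_def)
    then obtain d where d: "d > 0" "\<And>q q'. q \<in> {1/2..1} \<times> K \<Longrightarrow> q' \<in> {1/2..1} \<times> K \<Longrightarrow> dist q' q < d \<Longrightarrow> dist (f (fst q') (snd q')) (f (fst q) (snd q)) < e'"
      using uc by meson
    have "dist (integral UNIV (\<lambda>x. c x * f r x)) (integral UNIV (\<lambda>x. c x * f 1 x)) < e" if r: "r \<in> {1/2..1}" "\<bar>r - 1\<bar> < d" for r
    proof -
      have 1: "(1::real) \<in> {1/2..1}" by simp
      have i: "(\<lambda>x. c x * f r x) integrable_on cbox a1 a2" "(\<lambda>x. c x * f 1 x) integrable_on cbox a1 a2"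
        using cf[OF r(1)] cf[OF 1] by (auto intro!: integrable_continuous intro: continuous_on_subset)
      have "norm (integral (cbox a1 a2) (\<lambda>x. c x * f r x - c x * f 1 x)) \<le> (B' * e') * measure lborel (cbox a1 a2)"
      proof (rule has_integral_bound[OF _ integrable_integral[OF integrable_diff[OF i]]])
        show "norm (c x * f r x - c x * f 1 x) \<le> B' * e'" for x
        proof (cases "x \<in> K")
          case True
          have "dist (f r x) (f 1 x) < e'" using d(2)[of "(1, x)" "(r, x)"] True r by (auto simp: dist_Pair_Pair dist_real_def)
          then have "\<bar>c x\<bar> * \<bar>f r x - f 1 x\<bar> \<le> B' * e'" using B' True by (intro mult_mono) (auto simp: dist_real_def)
          then show ?thesis by (simp add: right_diff_distrib[symmetric] abs_mult)
        qed (use c(2) B' \<open>e' > 0\<close> in auto)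
      qed (use B' \<open>e' > 0\<close> in auto)
      also have "\<dots> < (B' * e') * m" using B' \<open>e' > 0\<close> by (simp add: m_def)
      also have "\<dots> = e" using B' m by (simp add: e'_def)
      finally have "norm (integral (cbox a1 a2) (\<lambda>x. c x * f r x - c x * f 1 x)) < e" .
      then show ?thesis
        using i by (simp add: int[OF r(1)] int[OF 1] dist_real_def Henstock_Kurzweil_Integration.integral_diff)
    qed
    moreover have "\<forall>\<^sub>F r in at_left (1::real). r \<in> {1/2..1} \<and> \<bar>r - 1\<bar> < d"
      unfolding eventually_at_left_field using d by (intro exI[of _ "max (1/2) (1 - d)"]) auto
    ultimately show "\<forall>\<^sub>F r in at_left 1. dist (integral UNIV (\<lambda>x. c x * f r x)) (integral UNIV (\<lambda>x. c x * f 1 x)) < e"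
      by (auto elim!: eventually_mono)
  qed
qed

locale cone_problem =
  fixes Y :: "'a::euclidean_space \<Rightarrow> real" and Yd :: "'a \<Rightarrow> 'a \<Rightarrow> real"
    and v :: "('a \<times> real \<times> real) list \<Rightarrow> 'a \<times> real \<times> real \<Rightarrow> real" and P :: "'a set" and xs :: 'a
  assumes Yc: "continuous_on UNIV Y" and Ydc: "b \<in> Basis \<Longrightarrow> continuous_on UNIV (Yd b)"
    and Yd: "b \<in> Basis \<Longrightarrow> ((\<lambda>s. Y (x + s *\<^sub>R b)) has_real_derivative Yd b x) (at 0)"
    and v: "C2_family {z. fst (snd z) < Y (fst z)} v"
    and vc: "length vs \<le> 1 \<Longrightarrow> continuous_on {z. fst (snd z) \<le> Y (fst z)} (v vs)"
    and wave_v: "fst (snd z) < Y (fst z) \<Longrightarrow> v [et, et] z = v [ey, ey] z + (\<Sum>b\<in>Basis. v [(b, 0, 0), (b, 0, 0)] z)"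
    and vt0: "y < Y x \<Longrightarrow> v [et] (x, y, 0) = 0"
    and P_open: "open P" and P_bounded: "bounded P" and Y_pos: "x \<in> closure P \<Longrightarrow> 0 < Y x"
    and core: "norm (x - xs) \<le> Y x \<Longrightarrow> x \<in> P"
    and growth: "bounded {x. norm (x - xs) \<le> Y x + 2}"
    and xs_pos: "0 < Y xs"
begin

definition W :: "real \<Rightarrow> ('a \<times> real \<times> real) list \<Rightarrow> 'a \<times> real \<times> real \<Rightarrow> real" where
  "W h vs z = beam_deriv h vs (z - (xs, 0, 0))"

lemma W_eq: "W h vs (x, y, t) = beam_deriv h vs (x - xs, y, t)" by (simp add: W_def)

lemma W_C2:
  assumes h: "h > 0" and S: "open S"
  shows "C2_family S (W h)"
proof -
  have der: "(W h vs has_derivative (\<lambda>v. W h (v # vs) z)) (at z)" for vs z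
  proof -
    have "((\<lambda>z. z - (xs, 0, 0)) has_derivative (\<lambda>v. v)) (at z)" by (auto intro!: derivative_eq_intros)
    from has_derivative_compose[OF this beam_deriv_has_derivative[OF h]]
    show ?thesis unfolding W_def[abs_def] .
  qed
  then have "continuous_on S (W h vs)" for vs
    by (meson continuous_at_imp_continuous_on has_derivative_continuous)
  then show ?thesis using der S by (simp add: C2_family_def)
qed

lemma W_continuous: "h > 0 \<Longrightarrow> length vs \<le> 2 \<Longrightarrow> continuous_on S (W h vs)"
  using C2_familyD(3)[OF W_C2[OF _ open_UNIV]] continuous_on_subset by blast

lemma P_closure: "P \<subseteq> closure P" "compact (closure P)"
  using closure_subset P_bounded by auto

lemma Y_pos_P: "x \<in> P \<Longrightarrow> 0 < Y x"
  using Y_pos P_closure by blast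

lemma xs_P: "xs \<in> P" by (rule core) (use xs_pos in simp)

lemma cutoff_exists:
  obtains \<epsilon> c c' K where "\<epsilon> > 0" "compact K" "K \<subseteq> P"
    and "continuous_on UNIV c" "\<And>b. b \<in> Basis \<Longrightarrow> continuous_on UNIV (c' b)"
    and "\<And>x. x \<notin> K \<Longrightarrow> c x = 0" "\<And>b x. x \<notin> K \<Longrightarrow> c' b x = 0"
    and "\<And>b x. b \<in> Basis \<Longrightarrow> ((\<lambda>s. c (x + s *\<^sub>R b)) has_real_derivative c' b x) (at 0)"
    and "c xs = 1"
    and "\<And>x. c x \<noteq> 1 \<Longrightarrow> Y x \<le> norm (x - xs) - \<epsilon>" "\<And>b x. c' b x \<noteq> 0 \<Longrightarrow> Y x \<le> norm (x - xs) - \<epsilon>"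
proof -
  define A where "A = {x. norm (x - xs) \<le> Y x + 2} - P"
  have Yc': "continuous_on S Y" for S using Yc continuous_on_subset by blast
  have cl: "closed {x. norm (x - xs) \<le> Y x + k}" for k
    by (intro closed_Collect_le continuous_intros Yc)
  have "closed A" unfolding A_def by (intro closed_Diff cl P_open)
  moreover have "bounded A" using growth bounded_subset[of _ A] by (auto simp: A_def)
  ultimately have "compact A" by (simp add: compact_eq_bounded_closed)
  have "\<exists>m>0. \<forall>x\<in>A. m \<le> norm (x - xs) - Y x"
  proof (cases "A = {}")
    case False
    have "continuous_on A (\<lambda>x. norm (x - xs) - Y x)" by (intro continuous_intros Yc')
    from continuous_attains_inf[OF \<open>compact A\<close> False this]
    obtain x0 where x0: "x0 \<in> A" "\<And>x. x \<in> A \<Longrightarrow> norm (x0 - xs) - Y x0 \<le> norm (x - xs) - Y x" by blast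
    have "0 < norm (x0 - xs) - Y x0" using core[of x0] x0(1) by (force simp: A_def)
    then show ?thesis using x0(2) by blast
  qed (auto intro: exI[of _ 1])
  then obtain m where m: "m > 0" "\<And>x. x \<in> A \<Longrightarrow> m \<le> norm (x - xs) - Y x" by blast
  define e where "e = min 1 (m / 4)"
  have e: "e > 0" "e \<le> 1" "2 * e < m" using m(1) by (auto simp: e_def min_def)
  define N where "N x = sqrt ((norm (x - xs))\<^sup>2 + e\<^sup>2)" for x
  have N: "norm (x - xs) \<le> N x" "N x \<le> norm (x - xs) + e" "N x > 0" for x
  proof -
    show "norm (x - xs) \<le> N x" unfolding N_def by (rule real_le_rsqrt) simp
    show "N x \<le> norm (x - xs) + e" unfolding N_def using e by (intro real_le_lsqrt) (auto simp: power2_sum)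
    show "N x > 0" unfolding N_def using e by (simp add: add_nonneg_pos)
  qed
  have Nc: "continuous_on S N" for S unfolding N_def[abs_def] by (intro continuous_intros)
  define q where "q x = (Y x - N x + 2 * e) * (2 / e)" for x
  have qc: "continuous_on S q" for S unfolding q_def[abs_def] by (intro continuous_intros Yc' Nc)
  define c where "c x = ramp (q x)" for x
  define c' where "c' b x = ramp' (q x) * ((Yd b x - ((x - xs) \<bullet> b) / N x) * (2 / e))" for b x
  define K where "K = {x. N x \<le> Y x + 2 * e}"
  have K_sub: "K \<subseteq> {x. norm (x - xs) \<le> Y x + 2}" using N(1) e by (force simp: K_def intro: order_trans)
  have "closed K" unfolding K_def by (intro closed_Collect_le continuous_intros Yc Nc)
  moreover have "bounded K" using growth K_sub bounded_subset by blast
  ultimately have "compact K" by (simp add: compact_eq_bounded_closed)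
  have "K \<subseteq> P"
  proof
    fix x assume x: "x \<in> K"
    have "norm (x - xs) - Y x \<le> 2 * e" using x N(1)[of x] by (simp add: K_def)
    then have "x \<notin> A" using m(2)[of x] e by force
    then show "x \<in> P" using K_sub x by (auto simp: A_def)
  qed
  have q0: "q x \<le> 0" if "x \<notin> K" for x
  proof -
    have "Y x - N x + 2 * e \<le> 0" using that by (simp add: K_def)
    then show ?thesis unfolding q_def using e by (intro mult_nonpos_nonneg) auto
  qed
  have q1: "Y x \<le> norm (x - xs) - e / 2" if "q x < 1" for x
  proof -
    have "Y x - N x + 2 * e < e / 2" using that e by (simp add: q_def field_simps)
    then show ?thesis using N(2)[of x] by linarith
  qed
  have dc: "((\<lambda>s. c (x + s *\<^sub>R b)) has_real_derivative c' b x) (at 0)" if b: "b \<in> Basis" for b x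
  proof -
    have Nd: "((\<lambda>s. N (x + s *\<^sub>R b)) has_real_derivative ((x - xs) \<bullet> b) / N x) (at 0)"
    proof -
      define k where "k s = (norm (x - xs))\<^sup>2 + e\<^sup>2 + 2 * s * ((x - xs) \<bullet> b) + s\<^sup>2 * (b \<bullet> b)" for s
      have "(norm (x + s *\<^sub>R b - xs))\<^sup>2 + e\<^sup>2 = k s" for s
        unfolding k_def power2_norm_eq_inner by (simp add: algebra_simps inner_commute power2_eq_square)
      then have N': "N (x + s *\<^sub>R b) = sqrt (k s)" for s by (simp add: N_def)
      have "(k has_real_derivative 2 * ((x - xs) \<bullet> b)) (at 0)"
        unfolding k_def[abs_def] by (auto intro!: derivative_eq_intros)
      moreover have "k 0 > 0" unfolding k_def using e by (simp add: add_nonneg_pos)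
      ultimately have "((\<lambda>s. sqrt (k s)) has_real_derivative (inverse (sqrt (k 0)) / 2) * (2 * ((x - xs) \<bullet> b))) (at 0)"
        by (intro DERIV_chain2[where f=sqrt and g=k] DERIV_real_sqrt)
      then show ?thesis using N'[of 0] by (simp add: N' field_simps)
    qed
    have "((\<lambda>s. q (x + s *\<^sub>R b)) has_real_derivative (Yd b x - ((x - xs) \<bullet> b) / N x) * (2 / e)) (at 0)"
      unfolding q_def
      by (rule DERIV_cong[OF DERIV_cmult_right[OF DERIV_add[OF DERIV_diff[OF Yd[OF b] Nd] DERIV_const]]]) simp
    moreover have "(ramp has_real_derivative ramp' (q x)) (at (q (x + 0 *\<^sub>R b)))" using DERIV_ramp by simp
    ultimately show ?thesis unfolding c_def c'_def by (rule DERIV_chain2[rotated])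
  qed
  show thesis
  proof (rule that[of "e / 2" K c c'])
    show "e / 2 > 0" using e by simp
    show "compact K" "K \<subseteq> P" by fact+
    show "continuous_on UNIV c" unfolding c_def[abs_def] by (intro continuous_on_ramp qc)
    show "continuous_on UNIV (c' b)" if "b \<in> Basis" for b
      unfolding c'_def[abs_def] using N(3) less_imp_neq[OF N(3)] by (intro continuous_intros continuous_on_ramp' qc Ydc[OF that] Nc) (metis less_irrefl)
    show "c x = 0" if "x \<notin> K" for x unfolding c_def by (rule ramp_eq_0[OF q0[OF that]])
    show "c' b x = 0" if "x \<notin> K" for b x unfolding c'_def using ramp'_eq_0[of "q x"] q0[OF that] by simp
    show "((\<lambda>s. c (x + s *\<^sub>R b)) has_real_derivative c' b x) (at 0)" if "b \<in> Basis" for b x by (rule dc[OF that])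
    show "Y x \<le> norm (x - xs) - e / 2" if "c x \<noteq> 1" for x
      using that ramp_eq_1[of "q x"] q1[of x] by (force simp: c_def)
    show "Y x \<le> norm (x - xs) - e / 2" if "c' b x \<noteq> 0" for b x
      using that ramp'_eq_0[of "q x"] q1[of x] by (force simp: c'_def)
    have "\<not> Y xs \<le> norm (xs - xs) - e / 2" using xs_pos e by simp
    then have "\<not> q xs < 1" using q1 by blast
    then show "c xs = 1" unfolding c_def by (intro ramp_eq_1) simp
  qed
qed

lemma wronsk_vW_continuous:
  assumes h: "h > 0"
  shows "continuous_on {z. fst (snd z) \<le> Y (fst z)} (wronsk v (W h) e)"
  unfolding wronsk_def[abs_def] by (intro continuous_intros vc W_continuous h) auto

lemma scaled_triangle:
  assumes "x \<in> closure P" "0 \<le> r" "r \<le> 1" "\<eta> \<in> {0..1}"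
  shows "r * Y x * \<eta> \<le> Y x"
proof -
  have "r * \<eta> \<le> 1" using assms by (auto intro: mult_le_one)
  then show ?thesis using mult_right_mono[of "r * \<eta>" 1 "Y x"] Y_pos[OF assms(1)] by (simp add: mult_ac)
qed

lemma green_cutoff_full:
  assumes h: "h > 0" and K: "compact K" "K \<subseteq> P"
    and c: "continuous_on UNIV c" "\<And>b. b \<in> Basis \<Longrightarrow> continuous_on UNIV (c' b)" "\<And>x. x \<notin> K \<Longrightarrow> c x = 0" "\<And>b x. x \<notin> K \<Longrightarrow> c' b x = 0"
    and dc: "\<And>b x. b \<in> Basis \<Longrightarrow> ((\<lambda>s. c (x + s *\<^sub>R b)) has_real_derivative c' b x) (at 0)"
  shows "integral UNIV (\<lambda>x. c x * lateral_flux v (W h) Y Yd x)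
    = integral UNIV (\<lambda>x. c x * (Phi h (x - xs, 0) / 2 * (v [] (x, 0, 0) - v [] (x, Y x, Y x))))
      + (\<Sum>b\<in>Basis. integral UNIV (\<lambda>x. c' b x * cone_flux v (W h) Y b x))"
proof -
  let ?V = "{z. fst (snd z) \<le> Y (fst z)}"
  define J where "J r x = lateral_flux v (W h) (\<lambda>x. r * Y x) (\<lambda>b x. r * Yd b x) x" for r x
  define u where "u r x = Phi h (x - xs, 0) / 2 * (v [] (x, 0, 0) - v [] (x, r * Y x, r * Y x))" for r x
  define F where "F b r x = cone_flux v (W h) (\<lambda>x. r * Y x) b x" for b r x
  have Yc': "continuous_on S Y" for S using Yc continuous_on_subset by blast
  have Ydc': "continuous_on S (Yd b)" if "b \<in> Basis" for S b using Ydc[OF that] continuous_on_subset by blast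
  let ?Q = "{1/2..1::real} \<times> P"
  have sub: "(snd q, fst q * Y (snd q) * \<eta>, fst q * Y (snd q) * \<eta> * \<tau>) \<in> ?V" if "q \<in> ?Q" "\<eta> \<in> {0..1}" for q \<eta> \<tau>
    using scaled_triangle[of "snd q" "fst q" \<eta>] that P_closure by auto
  have Yq: "continuous_on ?Q (\<lambda>q. fst q * Y (snd q))" by (intro continuous_intros continuous_on_compose2[OF Yc]) auto
  have sq: "continuous_on ?Q snd" by (intro continuous_intros)
  note wc = wronsk_vW_continuous[OF h]
  have Jc: "continuous_on ?Q (\<lambda>q. J (fst q) (snd q))"
    unfolding J_def lateral_flux_def
    by (intro continuous_on_diff continuous_on_sum continuous_on_mult continuous_on_integral_triangle(2)[OF wc Yq sq sub] continuous_on_compose2[OF Ydc] continuous_intros) auto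
  have Fc: "continuous_on ?Q (\<lambda>q. F b (fst q) (snd q))" for b
    unfolding F_def cone_flux_def by (rule continuous_on_integral_triangle(1)[OF wc Yq sq sub])
  have uc: "continuous_on ?Q (\<lambda>q. u (fst q) (snd q))"
  proof -
    have "continuous_on ?Q (\<lambda>q. v [] (snd q, 0, 0))" "continuous_on ?Q (\<lambda>q. v [] (snd q, fst q * Y (snd q), fst q * Y (snd q)))"
      using sub[of _ 0 0] sub[of _ 1 1]
      by (auto intro!: continuous_on_compose2[OF vc[of "[]"]] continuous_intros Yq[unfolded split_beta])
    moreover have "continuous_on ?Q (\<lambda>q. Phi h (snd q - xs, 0))"
      by (intro continuous_on_compose2[OF Phi_deriv_continuous[OF h, of UNIV]] continuous_intros subset_UNIV)
    ultimately show ?thesis unfolding u_def by (intro continuous_intros) auto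
  qed
  have eq: "integral UNIV (\<lambda>x. c x * J r x) = integral UNIV (\<lambda>x. c x * u r x) + (\<Sum>b\<in>Basis. integral UNIV (\<lambda>x. c' b x * F b r x))"
    if r: "1/2 < r" "r < 1" for r
    unfolding J_def u_def F_def
  proof (rule green_cone_cutoff[OF v W_C2[OF h C2_familyD(1)[OF v]] P_open K])
    show "0 < r * Y x" if "x \<in> P" for x using Y_pos_P[OF that] r by simp
    show "continuous_on P (\<lambda>x. r * Y x)" by (intro continuous_intros Yc')
    show "continuous_on P (\<lambda>x. r * Yd b x)" if "b \<in> Basis" for b by (intro continuous_intros Ydc' that)
    show "((\<lambda>s. r * Y (x + s *\<^sub>R b)) has_real_derivative r * Yd b x) (at 0)" if "b \<in> Basis" for b x
      by (rule DERIV_cmult[OF Yd[OF that]])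
    have lt: "r * Y x * \<eta> < Y x" if "x \<in> P" "\<eta> \<le> 1" "0 \<le> \<eta>" for x \<eta>
    proof -
      have "r * \<eta> < 1" using mult_left_le[of \<eta> r] that r by linarith
      then show ?thesis using mult_strict_right_mono[of "r * \<eta>" 1 "Y x"] Y_pos_P[OF that(1)] by (simp add: mult_ac)
    qed
    then show "(x, r * Y x * \<eta>, r * Y x * \<eta> * \<tau>) \<in> {z. fst (snd z) < Y (fst z)}" if "x \<in> P" "\<eta> \<in> {0..1}" for x \<eta> \<tau>
      using that by auto
    show "v [et, et] z = v [ey, ey] z + (\<Sum>b\<in>Basis. v [(b, 0, 0), (b, 0, 0)] z)" if "z \<in> {z. fst (snd z) < Y (fst z)}" for z
      using that by (intro wave_v) simp
    show "W h [et, et] z = W h [ey, ey] z + (\<Sum>b\<in>Basis. W h [(b, 0, 0), (b, 0, 0)] z)" for z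
      unfolding W_def by (rule beam_wave_equation[OF h])
    show "v [et] (x, y, 0) = 0" if "x \<in> P" "y < r * Y x" for x y
      using that lt[of x 1] by (intro vt0) auto
    show "W h [et] (x, y, 0) = 0" if "0 < y" for x y
      unfolding W_eq by (rule beam_deriv_t_zero[OF h that])
    show "W h [] (x, y, y) = Phi h (x - xs, 0) / 2" if "0 \<le> y" for x y
      unfolding W_eq by (rule beam_cone[OF h that])
    show "continuous_on P (\<lambda>x. Phi h (x - xs, 0) / 2)"
      by (intro continuous_intros continuous_on_compose2[OF Phi_deriv_continuous[OF h, of UNIV]] subset_UNIV) simp
  qed (use c dc in auto)
  have l1: "((\<lambda>r. integral UNIV (\<lambda>x. c x * J r x)) \<longlongrightarrow> integral UNIV (\<lambda>x. c x * J 1 x)) (at_left 1)"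
    by (rule tendsto_integral_cutoff[OF P_open K c(1) c(3) Jc])
  have l2: "((\<lambda>r. integral UNIV (\<lambda>x. c x * u r x) + (\<Sum>b\<in>Basis. integral UNIV (\<lambda>x. c' b x * F b r x)))
     \<longlongrightarrow> integral UNIV (\<lambda>x. c x * u 1 x) + (\<Sum>b\<in>Basis. integral UNIV (\<lambda>x. c' b x * F b 1 x))) (at_left 1)"
    by (intro tendsto_add tendsto_sum tendsto_integral_cutoff[OF P_open K c(1) c(3) uc] tendsto_integral_cutoff[OF P_open K c(2) c(4) Fc])
  have "\<forall>\<^sub>F r in at_left (1::real). 1/2 < r \<and> r < 1"
    unfolding eventually_at_left_field by (intro exI[of _ "1/2"]) auto
  then have "\<forall>\<^sub>F r in at_left 1. integral UNIV (\<lambda>x. c x * J r x) = integral UNIV (\<lambda>x. c x * u r x) + (\<Sum>b\<in>Basis. integral UNIV (\<lambda>x. c' b x * F b r x))"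
    by eventually_elim (use eq in blast)
  then have "((\<lambda>r. integral UNIV (\<lambda>x. c x * J r x)) \<longlongrightarrow> integral UNIV (\<lambda>x. c x * u 1 x) + (\<Sum>b\<in>Basis. integral UNIV (\<lambda>x. c' b x * F b 1 x))) (at_left 1)"
    using l2 by (subst tendsto_cong) auto
  from tendsto_unique[OF trivial_limit_at_left_real l1 this]
  show ?thesis by (simp add: J_def u_def F_def)
qed

end

lemma integral_abs_le_unit:
  fixes f :: "real \<Rightarrow> real"
  assumes f: "continuous_on {0..1} f" and B: "\<And>s. s \<in> {0..1} \<Longrightarrow> \<bar>f s\<bar> \<le> B"
  shows "\<bar>integral {0..1} f\<bar> \<le> B"
proof -
  have "0 \<le> B" using order_trans[OF abs_ge_zero B[of 0]] by simp
  then have "norm (integral (cbox 0 1) f) \<le> B * measure lborel (cbox 0 (1::real))"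
    by (intro has_integral_bound[OF _ integrable_integral]) (use f B in \<open>auto intro!: integrable_continuous_real\<close>)
  then show ?thesis by simp
qed

context cone_problem
begin

lemma flux_bounds:
  assumes h: "h > 0" and x: "x \<in> closure P" and E0: "0 \<le> E"
    and vM: "\<And>y t. 0 \<le> t \<Longrightarrow> t \<le> y \<Longrightarrow> y \<le> Y x \<Longrightarrow> \<bar>v [] (x, y, t)\<bar> + (\<bar>v [ey] (x, y, t)\<bar> + (\<Sum>b\<in>Basis. \<bar>v [(b, 0, 0)] (x, y, t)\<bar>)) \<le> M"
    and W0: "\<And>y t. 0 \<le> t \<Longrightarrow> t \<le> y \<Longrightarrow> y \<le> Y x \<Longrightarrow> \<bar>W h [] (x, y, t)\<bar> \<le> E"
    and W1: "\<And>y t. 0 \<le> t \<Longrightarrow> t \<le> y \<Longrightarrow> y \<le> Y x \<Longrightarrow> \<bar>W h [ey] (x, y, t)\<bar> \<le> E"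
    and W2: "\<And>y t b. 0 \<le> t \<Longrightarrow> t \<le> y \<Longrightarrow> y \<le> Y x \<Longrightarrow> b \<in> Basis \<Longrightarrow> \<bar>W h [(b, 0, 0)] (x, y, t)\<bar> \<le> E"
  shows "\<bar>lateral_flux v (W h) Y Yd x\<bar> \<le> E * (M * (Y x * (1 + (\<Sum>b\<in>Basis. \<bar>Yd b x\<bar>))))"
    and "b \<in> Basis \<Longrightarrow> \<bar>cone_flux v (W h) Y b x\<bar> \<le> E * (M * (Y x)\<^sup>2)"
proof -
  let ?V = "{z. fst (snd z) \<le> Y (fst z)}"
  have Y0: "0 < Y x" using Y_pos[OF x] .
  have X: "\<bar>wronsk v (W h) e (x, y, t)\<bar> \<le> E * M"
    if e: "e = ey \<or> (\<exists>b\<in>Basis. e = (b, 0, 0))" and yt: "0 \<le> t" "t \<le> y" "y \<le> Y x" for e y t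
  proof -
    have We: "\<bar>W h [e] (x, y, t)\<bar> \<le> E" using e W1[OF yt] W2[OF yt] by auto
    have ve: "\<bar>v [e] (x, y, t)\<bar> \<le> \<bar>v [ey] (x, y, t)\<bar> + (\<Sum>b\<in>Basis. \<bar>v [(b, 0, 0)] (x, y, t)\<bar>)"
    proof (cases "e = ey")
      case True
      then show ?thesis by (simp add: sum_nonneg)
    next
      case False
      then obtain b where b: "b \<in> Basis" "e = (b, 0, 0)" using e by blast
      have "\<bar>v [(b, 0, 0)] (x, y, t)\<bar> \<le> (\<Sum>b\<in>Basis. \<bar>v [(b, 0, 0)] (x, y, t)\<bar>)"
        by (rule member_le_sum[OF b(1)]) auto
      then show ?thesis using b by simp
    qed
    have "\<bar>wronsk v (W h) e (x, y, t)\<bar> \<le> \<bar>v [] (x, y, t)\<bar> * \<bar>W h [e] (x, y, t)\<bar> + \<bar>W h [] (x, y, t)\<bar> * \<bar>v [e] (x, y, t)\<bar>"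
      unfolding wronsk_def abs_mult[symmetric] by (rule abs_triangle_ineq4)
    also have "\<dots> \<le> \<bar>v [] (x, y, t)\<bar> * E + E * \<bar>v [e] (x, y, t)\<bar>"
      by (intro add_mono mult_mono We W0[OF yt]) (use E0 in auto)
    also have "\<dots> = E * (\<bar>v [] (x, y, t)\<bar> + \<bar>v [e] (x, y, t)\<bar>)" by (simp add: algebra_simps)
    also have "\<dots> \<le> E * M" using ve vM[OF yt] by (intro mult_left_mono E0) linarith
    finally show ?thesis .
  qed
  have tri: "Y x * \<eta> \<le> Y x" "0 \<le> Y x * \<eta> * \<tau>" "Y x * \<eta> * \<tau> \<le> Y x * \<eta>" if "\<eta> \<in> {0..1}" "\<tau> \<in> {0..1}" for \<eta> \<tau>
  proof -
    have Y\<eta>: "0 \<le> Y x * \<eta>" using that Y0 by simp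
    show "Y x * \<eta> \<le> Y x" by (rule mult_left_le) (use that Y0 in auto)
    show "0 \<le> Y x * \<eta> * \<tau>" by (rule mult_nonneg_nonneg[OF Y\<eta>]) (use that in auto)
    show "Y x * \<eta> * \<tau> \<le> Y x * \<eta>" by (rule mult_left_le[OF _ Y\<eta>]) (use that in auto)
  qed
  note wc = wronsk_vW_continuous[OF h]
  have top: "\<bar>integral {0..1} (\<lambda>\<tau>. Y x * wronsk v (W h) e (x, Y x, Y x * \<tau>))\<bar> \<le> Y x * (E * M)"
    if e: "e = ey \<or> (\<exists>b\<in>Basis. e = (b, 0, 0))" for e
  proof (rule integral_abs_le_unit)
    have "continuous_on {0..1} (\<lambda>\<tau>. wronsk v (W h) e (x, Y x * 1, Y x * 1 * \<tau>))"
      by (rule continuous_on_triangle[OF wc]) (auto intro!: continuous_intros)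
    then show "continuous_on {0..1} (\<lambda>\<tau>. Y x * wronsk v (W h) e (x, Y x, Y x * \<tau>))" by (intro continuous_intros) simp
    show "\<bar>Y x * wronsk v (W h) e (x, Y x, Y x * \<tau>)\<bar> \<le> Y x * (E * M)" if "\<tau> \<in> {0..1}" for \<tau>
      using X[OF e, of "Y x * \<tau>" "Y x"] tri[of 1 \<tau>] that Y0 by (simp add: abs_mult)
  qed
  show "\<bar>lateral_flux v (W h) Y Yd x\<bar> \<le> E * (M * (Y x * (1 + (\<Sum>b\<in>Basis. \<bar>Yd b x\<bar>))))"
  proof -
    have "\<bar>\<Sum>b\<in>Basis. Yd b x * integral {0..1} (\<lambda>\<tau>. Y x * wronsk v (W h) (b, 0, 0) (x, Y x, Y x * \<tau>))\<bar>
       \<le> (\<Sum>b\<in>Basis. \<bar>Yd b x\<bar> * (Y x * (E * M)))"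
    proof (rule order_trans[OF sum_abs], rule sum_mono)
      fix b :: 'a assume "b \<in> Basis"
      then show "\<bar>Yd b x * integral {0..1} (\<lambda>\<tau>. Y x * wronsk v (W h) (b, 0, 0) (x, Y x, Y x * \<tau>))\<bar> \<le> \<bar>Yd b x\<bar> * (Y x * (E * M))"
        unfolding abs_mult[of "Yd b x"] by (intro mult_left_mono top) auto
    qed
    then have "\<bar>lateral_flux v (W h) Y Yd x\<bar> \<le> Y x * (E * M) + (\<Sum>b\<in>Basis. \<bar>Yd b x\<bar> * (Y x * (E * M)))"
      unfolding lateral_flux_def using top[of ey, OF disjI1[OF refl]] by linarith
    also have "(\<Sum>b\<in>Basis. \<bar>Yd b x\<bar> * (Y x * (E * M))) = (\<Sum>b\<in>Basis. \<bar>Yd b x\<bar>) * (Y x * (E * M))"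
      by (rule sum_distrib_right[symmetric])
    finally show ?thesis by (simp only: distrib_left distrib_right mult_1_right mult_ac)
  qed
  show "\<bar>cone_flux v (W h) Y b x\<bar> \<le> E * (M * (Y x)\<^sup>2)" if b: "b \<in> Basis"
    unfolding cone_flux_def
  proof (rule integral_abs_le_unit)
    have c2: "continuous_on ({0..1} \<times> cbox 0 1) (\<lambda>p. (Y x)\<^sup>2 * fst p * wronsk v (W h) (b, 0, 0) (x, Y x * fst p, Y x * fst p * snd p))"
      by (intro continuous_intros continuous_on_triangle[OF wc]) (use tri in auto)
    then show "continuous_on {0..1} (\<lambda>\<eta>. integral {0..1} (\<lambda>\<tau>. (Y x)\<^sup>2 * \<eta> * wronsk v (W h) (b, 0, 0) (x, Y x * \<eta>, Y x * \<eta> * \<tau>)))"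
      using integral_continuous_on_param[of "{0..1}" 0 1 "\<lambda>\<eta> \<tau>. (Y x)\<^sup>2 * \<eta> * wronsk v (W h) (b, 0, 0) (x, Y x * \<eta>, Y x * \<eta> * \<tau>)"]
      by (simp add: split_beta)
    fix \<eta> :: real assume \<eta>: "\<eta> \<in> {0..1}"
    show "\<bar>integral {0..1} (\<lambda>\<tau>. (Y x)\<^sup>2 * \<eta> * wronsk v (W h) (b, 0, 0) (x, Y x * \<eta>, Y x * \<eta> * \<tau>))\<bar> \<le> E * (M * (Y x)\<^sup>2)"
    proof (rule integral_abs_le_unit)
      show "continuous_on {0..1} (\<lambda>\<tau>. (Y x)\<^sup>2 * \<eta> * wronsk v (W h) (b, 0, 0) (x, Y x * \<eta>, Y x * \<eta> * \<tau>))"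
        by (intro continuous_intros continuous_on_triangle[OF wc]) (use tri \<eta> in auto)
      fix \<tau> :: real assume \<tau>: "\<tau> \<in> {0..1}"
      have "\<bar>wronsk v (W h) (b, 0, 0) (x, Y x * \<eta>, Y x * \<eta> * \<tau>)\<bar> \<le> E * M"
        using X[of "(b, 0, 0)"] b tri[OF \<eta> \<tau>] by blast
      then have "(Y x)\<^sup>2 * \<eta> * \<bar>wronsk v (W h) (b, 0, 0) (x, Y x * \<eta>, Y x * \<eta> * \<tau>)\<bar> \<le> (Y x)\<^sup>2 * 1 * (E * M)"
        using \<eta> by (intro mult_mono) auto
      then show "\<bar>(Y x)\<^sup>2 * \<eta> * wronsk v (W h) (b, 0, 0) (x, Y x * \<eta>, Y x * \<eta> * \<tau>)\<bar> \<le> E * (M * (Y x)\<^sup>2)"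
        using \<eta> by (simp add: abs_mult mult_ac)
    qed
  qed
qed

lemma triangle_bounded:
  obtains M where "0 \<le> M" and "\<And>x y t. x \<in> closure P \<Longrightarrow> 0 \<le> t \<Longrightarrow> t \<le> y \<Longrightarrow> y \<le> Y x \<Longrightarrow>
    \<bar>v [] (x, y, t)\<bar> + (\<bar>v [ey] (x, y, t)\<bar> + (\<Sum>b\<in>Basis. \<bar>v [(b, 0, 0)] (x, y, t)\<bar>)) \<le> M"
proof -
  define m where "m z = \<bar>v [] z\<bar> + (\<bar>v [ey] z\<bar> + (\<Sum>b\<in>Basis. \<bar>v [(b, 0, 0)] z\<bar>))" for z
  have mc: "continuous_on {z. fst (snd z) \<le> Y (fst z)} m"
    unfolding m_def[abs_def] by (intro continuous_intros vc) auto
  define f where "f q = (fst q, Y (fst q) * fst (snd q), Y (fst q) * fst (snd q) * snd (snd q))" for q :: "'a \<times> real \<times> real"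
  have "continuous_on S f" for S unfolding f_def[abs_def] by (intro continuous_intros continuous_on_compose2[OF Yc]) auto
  moreover have "f ` (closure P \<times> {0..1} \<times> {0..1}) \<subseteq> {z. fst (snd z) \<le> Y (fst z)}"
  proof
    fix z assume "z \<in> f ` (closure P \<times> {0..1} \<times> {0..1})"
    then obtain q where q: "q \<in> closure P \<times> {0..1} \<times> {0..1}" and z: "z = f q" by blast
    have "fst q \<in> closure P" "fst (snd q) \<in> {0..1}" using q by auto
    then show "z \<in> {z. fst (snd z) \<le> Y (fst z)}" using scaled_triangle[of "fst q" 1 "fst (snd q)"] by (simp add: z f_def)
  qed
  ultimately have "continuous_on (closure P \<times> {0..1} \<times> {0..1}) (\<lambda>q. m (f q))"
    by (intro continuous_on_compose2[OF mc])
  then have "bounded ((\<lambda>q. m (f q)) ` (closure P \<times> {0..1} \<times> {0..1}))"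
    by (intro compact_imp_bounded compact_continuous_image compact_Times P_closure(2) compact_Icc)
  then obtain M where M: "\<And>q. q \<in> closure P \<times> {0..1} \<times> {0..1} \<Longrightarrow> norm (m (f q)) \<le> M"
    unfolding bounded_iff by blast
  show thesis
  proof (rule that[of "\<bar>M\<bar>"])
    fix x y t assume x: "x \<in> closure P" and yt: "0 \<le> t" "t \<le> y" "y \<le> Y x"
    have Y0: "0 < Y x" by (rule Y_pos[OF x])
    have "(x, y, t) = f (x, y / Y x, t / y)" "(x, y / Y x, t / y) \<in> closure P \<times> {0..1} \<times> {0..1}"
      using Y0 yt x by (auto simp: f_def divide_le_eq_1)
    then show "\<bar>v [] (x, y, t)\<bar> + (\<bar>v [ey] (x, y, t)\<bar> + (\<Sum>b\<in>Basis. \<bar>v [(b, 0, 0)] (x, y, t)\<bar>)) \<le> \<bar>M\<bar>"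
      using M[of "(x, y / Y x, t / y)"] by (simp add: m_def)
  qed simp
qed

lemma lateral_flux_continuous:
  assumes h: "h > 0"
  shows "continuous_on (closure P) (lateral_flux v (W h) Y Yd)"
proof -
  have sub: "(x, Y x * \<eta>, Y x * \<eta> * \<tau>) \<in> {z. fst (snd z) \<le> Y (fst z)}" if "x \<in> closure P" "\<eta> \<in> {0..1}" for x \<eta> \<tau>
    using scaled_triangle[of x 1 \<eta>] that by auto
  have Yc': "continuous_on (closure P) Y" using Yc continuous_on_subset by blast
  note t = continuous_on_integral_triangle(2)[OF wronsk_vW_continuous[OF h] Yc' continuous_on_id sub]
  show ?thesis
    unfolding lateral_flux_def[abs_def]
    by (intro continuous_on_diff continuous_on_sum continuous_on_mult t continuous_on_subset[OF Ydc]) auto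
qed

lemma lateral_flux_limit:
  "((\<lambda>h. integral P (lateral_flux v (W h) Y Yd)) \<longlongrightarrow> (v [] (xs, 0, 0) - v [] (xs, Y xs, Y xs)) / 2) (at_right 0)"
proof -
  obtain \<delta> c c' K where \<delta>: "\<delta> > 0" and K: "compact K" "K \<subseteq> P"
    and c: "continuous_on UNIV c" "\<And>b. b \<in> Basis \<Longrightarrow> continuous_on UNIV (c' b)"
      "\<And>x. x \<notin> K \<Longrightarrow> c x = 0" "\<And>b x. x \<notin> K \<Longrightarrow> c' b x = 0"
    and dc: "\<And>b x. b \<in> Basis \<Longrightarrow> ((\<lambda>s. c (x + s *\<^sub>R b)) has_real_derivative c' b x) (at 0)"
    and c1: "c xs = 1"
    and far: "\<And>x. c x \<noteq> 1 \<Longrightarrow> Y x \<le> norm (x - xs) - \<delta>" "\<And>b x. c' b x \<noteq> 0 \<Longrightarrow> Y x \<le> norm (x - xs) - \<delta>"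
    by (rule cutoff_exists) blast
  obtain a1 a2 where box: "K \<subseteq> cbox a1 a2" using compact_subset_cbox[OF K(1)] by blast
  obtain R where R: "R > 0" "\<And>x. x \<in> closure P \<Longrightarrow> norm (x - xs) \<le> R"
  proof -
    have "bounded ((\<lambda>x. x - xs) ` closure P)"
      by (intro compact_imp_bounded compact_continuous_image P_closure(2) continuous_intros)
    then obtain R0 where "\<forall>x\<in>closure P. norm (x - xs) \<le> R0" unfolding bounded_iff by blast
    then show thesis by (intro that[of "\<bar>R0\<bar> + 1"]) force+
  qed
  obtain \<epsilon> :: "real \<Rightarrow> real" where \<epsilon>: "(\<epsilon> \<longlongrightarrow> 0) (at_right 0)"
    and e1: "\<And>h (x::'a) y t. 0 < h \<Longrightarrow> h \<le> 1 \<Longrightarrow> norm x \<le> R \<Longrightarrow> \<bar>t\<bar> \<le> y \<Longrightarrow> y \<le> norm x - \<delta> \<Longrightarrow> \<bar>beam h (x, y, t)\<bar> \<le> \<epsilon> h"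
    and e2: "\<And>h (x::'a) y t b. 0 < h \<Longrightarrow> h \<le> 1 \<Longrightarrow> norm x \<le> R \<Longrightarrow> \<bar>t\<bar> \<le> y \<Longrightarrow> y \<le> norm x - \<delta> \<Longrightarrow> b \<in> Basis \<Longrightarrow> \<bar>beam_deriv h [(b, 0, 0)] (x, y, t)\<bar> \<le> \<epsilon> h"
    and e3: "\<And>h (x::'a) y t. 0 < h \<Longrightarrow> h \<le> 1 \<Longrightarrow> norm x \<le> R \<Longrightarrow> \<bar>t\<bar> \<le> y \<Longrightarrow> y \<le> norm x - \<delta> \<Longrightarrow> \<bar>beam_deriv h [(0, 1, 0)] (x, y, t)\<bar> \<le> \<epsilon> h"
    by (rule beam_decay[OF \<delta> R(1), where 'a='a]) blast
  obtain M where M: "0 \<le> M" "\<And>x y t. x \<in> closure P \<Longrightarrow> 0 \<le> t \<Longrightarrow> t \<le> y \<Longrightarrow> y \<le> Y x \<Longrightarrow>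
    \<bar>v [] (x, y, t)\<bar> + (\<bar>v [ey] (x, y, t)\<bar> + (\<Sum>b\<in>Basis. \<bar>v [(b, 0, 0)] (x, y, t)\<bar>)) \<le> M"
    using triangle_bounded by blast
  define E where "E h = \<bar>\<epsilon> h\<bar>" for h
  have Elim: "(E \<longlongrightarrow> 0) (at_right 0)" unfolding E_def[abs_def] using tendsto_rabs_zero[OF \<epsilon>] .
  define q where "q x = \<bar>1 - c x\<bar> * (M * (Y x * (1 + (\<Sum>b\<in>Basis. \<bar>Yd b x\<bar>)))) + (\<Sum>b\<in>Basis. \<bar>c' b x\<bar> * (M * (Y x)\<^sup>2))" for x
  have qc: "continuous_on (closure P) q"
    unfolding q_def[abs_def]
    by (intro continuous_intros continuous_on_subset[OF c(1)] continuous_on_subset[OF c(2)] continuous_on_subset[OF Yc] continuous_on_subset[OF Ydc]) auto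
  have "bounded (q ` closure P)" by (intro compact_imp_bounded compact_continuous_image qc P_closure(2))
  then obtain L where L: "\<And>x. x \<in> closure P \<Longrightarrow> \<bar>q x\<bar> \<le> L" unfolding bounded_iff by fastforce
  have parts: "\<bar>1 - c x\<bar> * (M * (Y x * (1 + (\<Sum>b\<in>Basis. \<bar>Yd b x\<bar>)))) \<le> L" "\<bar>c' b x\<bar> * (M * (Y x)\<^sup>2) \<le> L"
    if x: "x \<in> closure P" and b: "b \<in> Basis" for x b
  proof -
    have nn: "0 \<le> \<bar>1 - c x\<bar> * (M * (Y x * (1 + (\<Sum>b\<in>Basis. \<bar>Yd b x\<bar>))))" "0 \<le> (\<Sum>b\<in>Basis. \<bar>c' b x\<bar> * (M * (Y x)\<^sup>2))"
      using M(1) Y_pos[OF x] by (auto intro!: mult_nonneg_nonneg sum_nonneg add_nonneg_nonneg)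
    have "\<bar>c' b x\<bar> * (M * (Y x)\<^sup>2) \<le> (\<Sum>b\<in>Basis. \<bar>c' b x\<bar> * (M * (Y x)\<^sup>2))"
      by (rule member_le_sum[OF b]) (use M(1) in auto)
    then show "\<bar>1 - c x\<bar> * (M * (Y x * (1 + (\<Sum>b\<in>Basis. \<bar>Yd b x\<bar>)))) \<le> L" "\<bar>c' b x\<bar> * (M * (Y x)\<^sup>2) \<le> L"
      using L[OF x] nn unfolding q_def by linarith+
  qed
  have L0: "0 \<le> L" using L[of xs] xs_P P_closure(1) by force
  have fb: "\<bar>lateral_flux v (W h) Y Yd x\<bar> \<le> E h * (M * (Y x * (1 + (\<Sum>b\<in>Basis. \<bar>Yd b x\<bar>))))"
    "b \<in> Basis \<Longrightarrow> \<bar>cone_flux v (W h) Y b x\<bar> \<le> E h * (M * (Y x)\<^sup>2)"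
    if h: "0 < h" "h \<le> 1" and x: "x \<in> closure P" "Y x \<le> norm (x - xs) - \<delta>" for h x b
  proof -
    have "\<bar>W h [] (x, y, t)\<bar> \<le> E h" "\<bar>W h [ey] (x, y, t)\<bar> \<le> E h" "b \<in> Basis \<Longrightarrow> \<bar>W h [(b, 0, 0)] (x, y, t)\<bar> \<le> E h"
      if yt: "0 \<le> t" "t \<le> y" "y \<le> Y x" for y t b
    proof -
      have a: "\<bar>t\<bar> \<le> y" "y \<le> norm (x - xs) - \<delta>" using yt x by auto
      note le = order_trans[OF _ abs_ge_self]
      show "\<bar>W h [] (x, y, t)\<bar> \<le> E h" unfolding W_eq E_def by (rule le[OF e1[OF h R(2)[OF x(1)] a]])
      show "\<bar>W h [ey] (x, y, t)\<bar> \<le> E h" unfolding W_eq E_def by (rule le[OF e3[OF h R(2)[OF x(1)] a]])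
      show "\<bar>W h [(b, 0, 0)] (x, y, t)\<bar> \<le> E h" if "b \<in> Basis" unfolding W_eq E_def by (rule le[OF e2[OF h R(2)[OF x(1)] a that]])
    qed
    note w = this
    have E0: "0 \<le> E h" by (simp add: E_def)
    show "\<bar>lateral_flux v (W h) Y Yd x\<bar> \<le> E h * (M * (Y x * (1 + (\<Sum>b\<in>Basis. \<bar>Yd b x\<bar>))))"
      by (rule flux_bounds(1)[OF h(1) x(1) E0 M(2)[OF x(1)]]) (use w in auto)
    show "\<bar>cone_flux v (W h) Y b x\<bar> \<le> E h * (M * (Y x)\<^sup>2)" if "b \<in> Basis"
      by (rule flux_bounds(2)[OF h(1) x(1) E0 M(2)[OF x(1)] _ _ _ that]) (use w in auto)
  qed
  define A where "A h = integral UNIV (\<lambda>x. c x * (Phi h (x - xs, 0) / 2 * (v [] (x, 0, 0) - v [] (x, Y x, Y x))))" for h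
  define D where "D h = (\<Sum>b\<in>Basis. integral UNIV (\<lambda>x. c' b x * cone_flux v (W h) Y b x))" for h
  define T where "T h = integral P (\<lambda>x. (1 - c x) * lateral_flux v (W h) Y Yd x)" for h
  have P_meas: "P \<in> lmeasurable" by (rule lmeasurable_open[OF P_bounded P_open])
  have split: "integral P (lateral_flux v (W h) Y Yd) = A h + D h + T h"
    and T_le: "h \<le> 1 \<Longrightarrow> \<bar>T h\<bar> \<le> E h * L * measure lebesgue P"
    if h: "0 < h" for h
  proof -
    let ?J = "lateral_flux v (W h) Y Yd"
    have bd_int: "f integrable_on P" if f: "continuous_on (closure P) f" for f :: "'a \<Rightarrow> real"
    proof -
      have "bounded (f ` closure P)" by (intro compact_imp_bounded compact_continuous_image f P_closure(2))
      then obtain B where B: "\<And>x. x \<in> closure P \<Longrightarrow> norm (f x) \<le> B" unfolding bounded_iff by blast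
      show ?thesis
      proof (rule measurable_bounded_by_integrable_imp_integrable)
        show "f \<in> borel_measurable (lebesgue_on P)"
          by (rule continuous_imp_measurable_on_sets_lebesgue[OF continuous_on_subset[OF f P_closure(1)]]) (use P_meas in auto)
        show "(\<lambda>x. B) integrable_on P" by (rule integrable_on_const[OF P_meas])
      qed (use B P_closure(1) P_meas in auto)
    qed
    have Jc: "continuous_on (closure P) ?J" by (rule lateral_flux_continuous[OF h])
    have cc: "continuous_on (closure P) c" using c(1) continuous_on_subset by blast
    have i1: "(\<lambda>x. c x * ?J x) integrable_on P" and i2: "(\<lambda>x. (1 - c x) * ?J x) integrable_on P"
      by (rule bd_int, intro continuous_intros cc Jc)+
    have "integral P ?J = integral P (\<lambda>x. c x * ?J x + (1 - c x) * ?J x)"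
      by (rule Henstock_Kurzweil_Integration.integral_cong) (simp add: algebra_simps)
    also have "\<dots> = integral P (\<lambda>x. c x * ?J x) + T h"
      unfolding T_def by (rule Henstock_Kurzweil_Integration.integral_add[OF i1 i2])
    also have "integral P (\<lambda>x. c x * ?J x) = integral UNIV (\<lambda>x. if x \<in> P then c x * ?J x else 0)"
      by (rule integral_restrict_UNIV[symmetric])
    also have "(\<lambda>x. if x \<in> P then c x * ?J x else 0) = (\<lambda>x. c x * ?J x)"
      using c(3) K(2) by (auto simp: fun_eq_iff)
    also have "integral UNIV (\<lambda>x. c x * ?J x) = A h + D h"
      unfolding A_def D_def by (rule green_cutoff_full[OF h K c dc])
    finally show "integral P ?J = A h + D h + T h" .
    assume h1: "h \<le> 1"
    have "norm (T h) \<le> integral P (\<lambda>x. E h * L)"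
      unfolding T_def
    proof (rule integral_norm_bound_integral[OF i2 integrable_on_const[OF P_meas]])
      fix x assume "x \<in> P"
      then have x: "x \<in> closure P" using P_closure by auto
      obtain b0 :: 'a where b0: "b0 \<in> Basis" using nonempty_Basis by blast
      show "norm ((1 - c x) * ?J x) \<le> E h * L"
      proof (cases "c x = 1")
        case False
        have "\<bar>1 - c x\<bar> * \<bar>?J x\<bar> \<le> \<bar>1 - c x\<bar> * (E h * (M * (Y x * (1 + (\<Sum>b\<in>Basis. \<bar>Yd b x\<bar>)))))"
          by (intro mult_left_mono fb(1)[OF h h1 x far(1)[OF False]]) auto
        also have "\<dots> = E h * (\<bar>1 - c x\<bar> * (M * (Y x * (1 + (\<Sum>b\<in>Basis. \<bar>Yd b x\<bar>)))))" by (simp only: mult_ac)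
        also have "\<dots> \<le> E h * L" by (intro mult_left_mono parts(1)[OF x b0]) (simp add: E_def)
        finally show ?thesis by (simp add: abs_mult)
      qed (use L0 in \<open>simp add: E_def\<close>)
    qed
    also have "\<dots> = E h * L * measure lebesgue P"
      using integral_mult_right[of P "E h * L" "\<lambda>x. 1"] unfolding lmeasure_integral[OF P_meas] mult_1_right .
    finally show "\<bar>T h\<bar> \<le> E h * L * measure lebesgue P" by simp
  qed
  have D_le: "\<bar>D h\<bar> \<le> real DIM('a) * (E h * L * measure lborel (cbox a1 a2))" if h: "0 < h" "h \<le> 1" for h
  proof -
    have cfc: "continuous_on P (cone_flux v (W h) Y b)" for b
      unfolding cone_flux_def[abs_def]
      by (rule continuous_on_integral_triangle(1)[OF wronsk_vW_continuous[OF h(1)] continuous_on_subset[OF Yc] continuous_on_id])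
        (use scaled_triangle[of _ 1] P_closure in auto)
    have "\<bar>integral UNIV (\<lambda>x. c' b x * cone_flux v (W h) Y b x)\<bar> \<le> E h * L * measure lborel (cbox a1 a2)" if b: "b \<in> Basis" for b
    proof -
      have cc: "continuous_on UNIV (\<lambda>x. c' b x * cone_flux v (W h) Y b x)"
        by (rule continuous_on_cutoff_mult[OF P_open K continuous_on_subset[OF c(2)[OF b]] cfc c(4)]) auto
      have "integral UNIV (\<lambda>x. c' b x * cone_flux v (W h) Y b x) = integral (cbox a1 a2) (\<lambda>x. c' b x * cone_flux v (W h) Y b x)"
        by (rule integral_compact_support(2)[OF cc _ refl]) (use c(4) box in auto)
      also have "norm \<dots> \<le> E h * L * measure lborel (cbox a1 a2)"
      proof (rule has_integral_bound[OF _ integrable_integral])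
        show "(\<lambda>x. c' b x * cone_flux v (W h) Y b x) integrable_on cbox a1 a2"
          by (rule integrable_continuous[OF continuous_on_subset[OF cc]]) simp
        show "norm (c' b x * cone_flux v (W h) Y b x) \<le> E h * L" for x
        proof (cases "c' b x = 0")
          case False
          then have x: "x \<in> closure P" using c(4) K P_closure by blast
          have "\<bar>c' b x\<bar> * \<bar>cone_flux v (W h) Y b x\<bar> \<le> \<bar>c' b x\<bar> * (E h * (M * (Y x)\<^sup>2))"
            by (intro mult_left_mono fb(2)[OF h x far(2)[OF False] b]) auto
          also have "\<dots> = E h * (\<bar>c' b x\<bar> * (M * (Y x)\<^sup>2))" by (simp only: mult_ac)
          also have "\<dots> \<le> E h * L" by (intro mult_left_mono parts(2)[OF x b]) (simp add: E_def)
          finally show ?thesis by (simp add: abs_mult)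
        qed (use L0 in \<open>simp add: E_def\<close>)
      qed (use L0 in \<open>simp add: E_def\<close>)
      finally show ?thesis by simp
    qed
    then have "\<bar>D h\<bar> \<le> (\<Sum>b\<in>(Basis::'a set). E h * L * measure lborel (cbox a1 a2))"
      unfolding D_def by (intro order_trans[OF sum_abs] sum_mono)
    then show ?thesis by simp
  qed
  have ev: "\<forall>\<^sub>F h::real in at_right 0. 0 < h \<and> h \<le> 1"
    by (auto simp: eventually_at_right_field intro!: exI[of _ 1])
  have T_lim: "(T \<longlongrightarrow> 0) (at_right 0)"
  proof (rule Lim_null_comparison)
    show "((\<lambda>h. E h * L * measure lebesgue P) \<longlongrightarrow> 0) (at_right 0)"
      by (intro tendsto_mult_left_zero Elim)
    show "\<forall>\<^sub>F h in at_right 0. norm (T h) \<le> E h * L * measure lebesgue P"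
      using ev by eventually_elim (use T_le in auto)
  qed
  have D_lim: "(D \<longlongrightarrow> 0) (at_right 0)"
  proof (rule Lim_null_comparison)
    show "((\<lambda>h. real DIM('a) * (E h * L * measure lborel (cbox a1 a2))) \<longlongrightarrow> 0) (at_right 0)"
      by (intro tendsto_mult_right_zero tendsto_mult_left_zero Elim)
    show "\<forall>\<^sub>F h in at_right 0. norm (D h) \<le> real DIM('a) * (E h * L * measure lborel (cbox a1 a2))"
      using ev by eventually_elim (use D_le in auto)
  qed
  have A_lim: "(A \<longlongrightarrow> (v [] (xs, 0, 0) - v [] (xs, Y xs, Y xs)) / 2) (at_right 0)"
  proof -
    define f where "f x = c x * ((v [] (x, 0, 0) - v [] (x, Y x, Y x)) / 2)" for x
    have Yp: "continuous_on P Y" using Yc continuous_on_subset by blast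
    have "continuous_on P (\<lambda>x. v [] (x, 0, 0))"
    proof (rule continuous_on_compose2[OF vc[of "[]"]])
      show "continuous_on P (\<lambda>x. (x, 0::real, 0::real))" by (intro continuous_intros)
      show "(\<lambda>x. (x, 0, 0)) ` P \<subseteq> {z. fst (snd z) \<le> Y (fst z)}" 
      proof clarsimp
        fix x assume "x \<in> P"
        from Y_pos_P[OF this] show "0 \<le> Y x" by (rule less_imp_le)
      qed
    qed simp
    moreover have "continuous_on P (\<lambda>x. v [] (x, Y x, Y x))"
    proof (rule continuous_on_compose2[OF vc[of "[]"]])
      show "continuous_on P (\<lambda>x. (x, Y x, Y x))" by (intro continuous_intros Yp)
    qed auto
    ultimately have "continuous_on P (\<lambda>x. (v [] (x, 0, 0) - v [] (x, Y x, Y x)) / 2)" by (intro continuous_intros) auto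
    then have fc: "continuous_on UNIV f"
      unfolding f_def[abs_def] by (rule continuous_on_cutoff_mult[OF P_open K continuous_on_subset[OF c(1) subset_UNIV] _ c(3)])
    have f0: "f x = 0" if "x \<notin> K" for x using c(3)[OF that] by (simp add: f_def)
    have "bounded (f ` K)"
      by (rule compact_imp_bounded, rule compact_continuous_image[OF continuous_on_subset[OF fc] K(1)]) simp
    then obtain B where "\<And>x. x \<in> K \<Longrightarrow> \<bar>f x\<bar> \<le> B" unfolding bounded_iff by fastforce
    then have "\<bar>f x\<bar> \<le> \<bar>B\<bar>" for x using f0[of x] by (cases "x \<in> K") force+
    from gaussian_approx_identity[OF fc this, of xs]
    have lim: "((\<lambda>h. \<integral>x. f x * ((pi * h) powr (- real DIM('a) / 2) * exp (- (norm (x - xs))\<^sup>2 / h)) \<partial>lborel) \<longlongrightarrow> f xs) (at_right 0)" .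
    have "A h = (\<integral>x. f x * ((pi * h) powr (- real DIM('a) / 2) * exp (- (norm (x - xs))\<^sup>2 / h)) \<partial>lborel)" if h: "h > 0" for h
    proof -
      have Pc: "continuous_on UNIV (\<lambda>x. Phi h (x - xs, 0))"
        by (intro continuous_on_compose2[OF Phi_deriv_continuous[OF h, of UNIV]] continuous_intros subset_UNIV)
      have cc: "continuous_on UNIV (\<lambda>x. f x * Phi h (x - xs, 0))" by (intro continuous_intros fc Pc)
      have "A h = integral UNIV (\<lambda>x. f x * Phi h (x - xs, 0))"
        unfolding A_def f_def by (rule Henstock_Kurzweil_Integration.integral_cong) (simp add: algebra_simps)
      also have "\<dots> = (\<integral>x. f x * Phi h (x - xs, 0) \<partial>lborel)"
        by (rule integral_compact_support(3)[OF cc _ refl]) (use f0 box in auto)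
      finally show ?thesis by (simp add: Phi_initial[OF h])
    qed
    then have "\<forall>\<^sub>F h in at_right 0. A h = (\<integral>x. f x * ((pi * h) powr (- real DIM('a) / 2) * exp (- (norm (x - xs))\<^sup>2 / h)) \<partial>lborel)"
      using eventually_at_right_less[of "0::real"] by (rule eventually_mono[rotated]) blast
    then have "(A \<longlongrightarrow> f xs) (at_right 0)" using lim by (subst tendsto_cong) auto
    then show ?thesis by (simp add: f_def c1)
  qed
  have "((\<lambda>h. A h + D h + T h) \<longlongrightarrow> (v [] (xs, 0, 0) - v [] (xs, Y xs, Y xs)) / 2 + 0 + 0) (at_right 0)"
    by (intro tendsto_add A_lim D_lim T_lim)
  moreover have "\<forall>\<^sub>F h in at_right 0. integral P (lateral_flux v (W h) Y Yd) = A h + D h + T h"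
    using ev by eventually_elim (use split in auto)
  ultimately show ?thesis by (subst tendsto_cong) auto
qed

end

subsection \<open>The boundary integrand\<close>

lemma integral_symmetric_fold:
  fixes k :: "real \<Rightarrow> real"
  assumes a: "a > 0" and k: "continuous_on {c - a..c + a} k"
  shows "integral {c - a..c + a} k = integral {0..1} (\<lambda>\<tau>. a * (k (c + a * \<tau>) + k (c - a * \<tau>)))"
proof -
  have k1: "continuous_on (cbox c (c + a)) k" and k2: "continuous_on (cbox (c - a) c) k"
    using k a by (auto intro: continuous_on_subset)
  define I1 I2 where "I1 = integral (cbox c (c + a)) k" and "I2 = integral (cbox (c - a) c) k"
  have h1: "(k has_integral I1) (cbox c (c + a))" and h2: "(k has_integral I2) (cbox (c - a) c)"
    unfolding I1_def I2_def by (rule integrable_integral[OF integrable_continuous], fact)+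
  have 1: "((\<lambda>\<tau>. k (c + a * \<tau>)) has_integral (1 / a) * I1) {0..1}"
  proof -
    have "(\<lambda>x. (1 / a) *\<^sub>R x + - ((1 / a) *\<^sub>R c)) ` cbox c (c + a) = {0..1}"
    proof -
      have "x \<in> (\<lambda>x. (1 / a) *\<^sub>R x + - ((1 / a) *\<^sub>R c)) ` cbox c (c + a)" if "x \<in> {0..1}" for x
        by (rule image_eqI[of _ _ "c + a * x"]) (use that a in \<open>auto simp: field_simps\<close>)
      then show ?thesis using a by (auto simp: field_simps)
    qed
    then show ?thesis using has_integral_affinity[OF h1, of a c] a by (simp add: add.commute)
  qed
  have 2: "((\<lambda>\<tau>. k (c - a * \<tau>)) has_integral (1 / a) * I2) {0..1}"
  proof -
    have "(\<lambda>x. (1 / - a) *\<^sub>R x + - ((1 / - a) *\<^sub>R c)) ` cbox (c - a) c = {0..1}"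
    proof -
      have "x \<in> (\<lambda>x. (1 / - a) *\<^sub>R x + - ((1 / - a) *\<^sub>R c)) ` cbox (c - a) c" if "x \<in> {0..1}" for x
        by (rule image_eqI[of _ _ "c - a * x"]) (use that a in \<open>auto simp: field_simps\<close>)
      then show ?thesis using a by (auto simp: field_simps)
    qed
    then show ?thesis using has_integral_affinity[OF h2, of "- a" c] a by (simp add: add.commute)
  qed
  have "((\<lambda>\<tau>. a * (k (c + a * \<tau>) + k (c - a * \<tau>))) has_integral a * ((1 / a) * I1 + (1 / a) * I2)) {0..1}"
    by (intro has_integral_mult_right has_integral_add 1 2)
  moreover have "(k has_integral (I2 + I1)) {c - a..c + a}"
    using h1 h2 a by (intro has_integral_combine[of "c - a" c "c + a"]) auto
  moreover have "a * ((1 / a) * I1 + (1 / a) * I2) = I2 + I1" using a by (simp add: distrib_left)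
  ultimately show ?thesis by (metis integral_unique)
qed

lemma beam_linear: "h > 0 \<Longrightarrow> linear (\<lambda>e. beam_deriv h [e] z)"
  using has_derivative_linear[OF beam_deriv_has_derivative[of h "[]" z]] .

lemma beam_even: "h > 0 \<Longrightarrow> \<bar>t\<bar> < y \<Longrightarrow> beam h (x, y, - t) = beam h (x, y, t)"
  by (simp add: beam_average)

lemma beam_deriv_even:
  assumes h: "h > 0" and t: "\<bar>t\<bar> < y"
  shows "beam_deriv h [(b, p, 0)] (x, y, - t) = beam_deriv h [(b, p, 0)] (x, y, t)"
proof -
  have d: "((\<lambda>s. beam h ((x, y, t) + s *\<^sub>R (b, p, 0))) has_real_derivative beam_deriv h [(b, p, 0)] (x, y, t)) (at 0)" for t
    by (rule has_derivative_directional[OF beam_deriv_has_derivative[OF h]])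
  have "\<forall>\<^sub>F s in nhds (0::real). \<bar>t\<bar> < y + s * p"
  proof -
    have "((\<lambda>s. y + s * p) \<longlongrightarrow> y + 0 * p) (nhds 0)" by (intro tendsto_intros filterlim_ident)
    then show ?thesis using t by (auto intro: order_tendstoD(1))
  qed
  then have "\<forall>\<^sub>F s in nhds (0::real). beam h ((x, y, - t) + s *\<^sub>R (b, p, 0)) = beam h ((x, y, t) + s *\<^sub>R (b, p, 0))"
    by eventually_elim (simp add: beam_even[OF h])
  from DERIV_cong_ev[OF refl this refl] d[of "- t"]
  have "((\<lambda>s. beam h ((x, y, t) + s *\<^sub>R (b, p, 0))) has_real_derivative beam_deriv h [(b, p, 0)] (x, y, - t)) (at 0)"
    by blast
  from DERIV_unique[OF this d] show ?thesis .
qed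

lemma w_eq_beam:
  assumes h: "h > 0" and t: "\<bar>t\<bar> < y"
  shows "w h x y t = beam h (x, y, t)"
  unfolding w_def phi_eq_Phi[OF h] by (rule beam_average[OF h t, symmetric])

lemma frechet_derivative_w:
  fixes xs :: "real^'m"
  assumes h: "h > 0" and t: "\<bar>t\<bar> < y - ys"
  shows "frechet_derivative (\<lambda>p. w h (fst p - xs) (snd p - ys) t) (at (x, y)) e = beam_deriv h [(fst e, snd e, 0)] (x - xs, y - ys, t)"
proof -
  have "((\<lambda>p. (fst p - xs, snd p - ys, t)) has_derivative (\<lambda>e. (fst e, snd e, 0))) (at (x, y))"
    by (auto intro!: derivative_eq_intros)
  from has_derivative_compose[OF this, of "beam h" "\<lambda>v. beam_deriv h [v] (x - xs, y - ys, t)"]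
  have "((\<lambda>p. beam h (fst p - xs, snd p - ys, t)) has_derivative (\<lambda>e. beam_deriv h [(fst e, snd e, 0)] (x - xs, y - ys, t))) (at (x, y))"
    using beam_deriv_has_derivative[OF h, of "[]" "(x - xs, y - ys, t)"] by simp
  then have "((\<lambda>p. w h (fst p - xs) (snd p - ys) t) has_derivative (\<lambda>e. beam_deriv h [(fst e, snd e, 0)] (x - xs, y - ys, t))) (at (x, y))"
  proof (rule has_derivative_transform_within_open)
    show "open {p :: (real^'m) \<times> real. \<bar>t\<bar> < snd p - ys}"
      by (intro open_Collect_less continuous_intros)
    show "beam h (fst p - xs, snd p - ys, t) = w h (fst p - xs) (snd p - ys) t" if "p \<in> {p. \<bar>t\<bar> < snd p - ys}" for p :: "(real^'m) \<times> real"
      using that by (simp add: w_eq_beam[OF h])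
  qed (use t in auto)
  from frechet_derivative_at[OF this] show ?thesis by (simp add: fun_eq_iff)
qed

lemma C2_closure_witness_linear:
  assumes g: "C2_closure_witness S u g" and z: "z \<in> closure S"
  shows "linear (\<lambda>e. g [e] z)"
proof -
  have lin: "linear (\<lambda>e. g [e] z)" if "z \<in> S" for z
    using g that has_derivative_linear[of "g []" "\<lambda>e. g [e] z"] unfolding C2_closure_witness_def by force
  have c: "continuous_on (closure S) (g [e])" for e
    using g unfolding C2_closure_witness_def by force
  have "g [a + b] z - g [a] z - g [b] z = 0" for a b
    by (rule continuous_constant_on_closure[of S "\<lambda>z. g [a + b] z - g [a] z - g [b] z", OF _ _ z])
      (auto intro!: continuous_intros c simp: linear_add[OF lin])
  moreover have "g [r *\<^sub>R a] z - r * g [a] z = 0" for a r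
    by (rule continuous_constant_on_closure[of S "\<lambda>z. g [r *\<^sub>R a] z - r * g [a] z", OF _ _ z])
      (auto intro!: continuous_intros c simp: linear_scale[OF lin])
  ultimately show ?thesis by (intro linearI) (auto simp: algebra_simps)
qed

lemma C2_closure_witness_minus_minus:
  assumes g: "C2_closure_witness S u g" and z: "z \<in> S"
  shows "g [- e, - e] z = g [e, e] z"
proof -
  have S: "open S" and der: "\<And>e z. z \<in> S \<Longrightarrow> (g [e] has_derivative (\<lambda>v. g [v, e] z)) (at z)"
    using g unfolding C2_closure_witness_def by auto
  have neg: "g [- e] z = - g [e] z" if "z \<in> S" for z
    using linear_neg[OF C2_closure_witness_linear[OF g]] that closure_subset by blast
  have "(g [- e] has_derivative (\<lambda>v. - g [v, e] z)) (at z)"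
    by (rule has_derivative_transform_within_open[OF has_derivative_minus[OF der[OF z]] S z]) (simp add: neg)
  from has_derivative_unique[OF this der[OF z]] have "g [v, - e] z = - g [v, e] z" for v by (metis)
  moreover have "g [- e, e] z = - g [e, e] z"
    using linear_neg[OF has_derivative_linear[OF der[OF z, of e]]] .
  ultimately show ?thesis by simp
qed

lemma graph_region:
  fixes Y :: "'a::euclidean_space \<Rightarrow> real"
  assumes Y: "continuous_on UNIV Y"
  shows "open {(x, y). y < Y x}" "closure {(x, y). y < Y x} = {(x, y). y \<le> Y x}"
    "frontier {(x, y). y < Y x} = {(x, y). y = Y x}"
proof -
  have Yf: "continuous_on UNIV (\<lambda>p::'a \<times> real. Y (fst p))" by (intro continuous_on_compose2[OF Y] continuous_intros) auto
  show o: "open {(x, y). y < Y x}"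
    unfolding case_prod_unfold by (intro open_Collect_less continuous_intros Yf)
  have cl: "closed {(x, y). y \<le> Y x}"
    unfolding case_prod_unfold by (intro closed_Collect_le continuous_intros Yf)
  show c: "closure {(x, y). y < Y x} = {(x, y). y \<le> Y x}"
  proof
    show "closure {(x, y). y < Y x} \<subseteq> {(x, y). y \<le> Y x}" by (rule closure_minimal[OF _ cl]) auto
    show "{(x, y). y \<le> Y x} \<subseteq> closure {(x, y). y < Y x}"
    proof clarify
      fix x y assume y: "y \<le> Y x"
      show "(x, y) \<in> closure {(x, y). y < Y x}"
        unfolding closure_approachable
      proof (intro allI impI)
        fix e :: real assume "e > 0"
        then show "\<exists>p\<in>{(x, y). y < Y x}. dist p (x, y) < e"
          using y by (intro bexI[of _ "(x, y - e / 2)"]) (auto simp: dist_Pair_Pair dist_real_def)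
      qed
    qed
  qed
  show "frontier {(x, y). y < Y x} = {(x, y). y = Y x}"
    unfolding frontier_def c interior_open[OF o] by auto
qed

text \<open>The data of the theorem, with \<open>y\<close> and \<open>t\<close> measured from \<open>ys\<close> and \<open>ts\<close>, and the solution symmetrised
  in time: \<open>v (x, y, t) = u (x, ys + y, ts + t) + u (x, ys + y, ts - t)\<close>.\<close>

definition time_sign :: "real \<Rightarrow> 'a \<times> real \<times> real \<Rightarrow> ('a \<times> real) \<times> real" where
  "time_sign \<sigma> z = ((fst z, fst (snd z)), \<sigma> * snd (snd z))"

definition even_part :: "real \<Rightarrow> real \<Rightarrow> ((('a::real_normed_vector \<times> real) \<times> real) list \<Rightarrow> ('a \<times> real) \<times> real \<Rightarrow> real)
    \<Rightarrow> ('a \<times> real \<times> real) list \<Rightarrow> 'a \<times> real \<times> real \<Rightarrow> real" where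
  "even_part ys ts g vs z = g (map (time_sign 1) vs) (time_sign 1 z + ((0, ys), ts))
     + g (map (time_sign (-1)) vs) (time_sign (-1) z + ((0, ys), ts))"

lemma time_sign_linear: "bounded_linear (time_sign \<sigma> :: 'a::real_normed_vector \<times> real \<times> real \<Rightarrow> _)"
  unfolding time_sign_def[abs_def]
  by (intro bounded_linear_Pair bounded_linear_const_mult bounded_linear_compose[OF bounded_linear_fst bounded_linear_snd]
      bounded_linear_compose[OF bounded_linear_snd bounded_linear_snd] bounded_linear_fst)

lemma even_part_continuous:
  assumes c: "\<And>vs. length vs \<le> 2 \<Longrightarrow> continuous_on T (g vs)" and vs: "length vs \<le> 2"
    and sub: "\<And>z \<sigma>. z \<in> U \<Longrightarrow> time_sign \<sigma> z + ((0, ys), ts) \<in> T"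
  shows "continuous_on U (even_part ys ts g vs)"
proof -
  have l: "continuous_on U (\<lambda>z. time_sign \<sigma> z + ((0, ys), ts))" for \<sigma>
    by (intro continuous_intros linear_continuous_on time_sign_linear)
  show ?thesis
    unfolding even_part_def[abs_def]
    by (intro continuous_on_add continuous_on_compose2[OF c l]) (use vs sub in auto)
qed

lemma even_part_C2:
  assumes g: "C2_closure_witness S u g" and U: "open U"
    and sub: "\<And>z \<sigma>. z \<in> U \<Longrightarrow> time_sign \<sigma> z + ((0, ys), ts) \<in> S"
  shows "C2_family U (even_part ys ts g)"
proof -
  have "(even_part ys ts g vs has_derivative (\<lambda>v. even_part ys ts g (v # vs) z)) (at z)"
    if z: "z \<in> U" and vs: "length vs < 2" for vs z
  proof -
    have "((\<lambda>z. g (map (time_sign \<sigma>) vs) (time_sign \<sigma> z + ((0, ys), ts))) has_derivative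
        (\<lambda>v. g (map (time_sign \<sigma>) (v # vs)) (time_sign \<sigma> z + ((0, ys), ts)))) (at z)" for \<sigma>
    proof -
      have "((\<lambda>z. time_sign \<sigma> z + ((0, ys), ts)) has_derivative (\<lambda>v. time_sign \<sigma> v + 0)) (at z)"
        by (intro has_derivative_add bounded_linear_imp_has_derivative time_sign_linear has_derivative_const)
      moreover have "(g (map (time_sign \<sigma>) vs) has_derivative (\<lambda>v. g (v # map (time_sign \<sigma>) vs) (time_sign \<sigma> z + ((0, ys), ts)))) (at (time_sign \<sigma> z + ((0, ys), ts)))"
        using g sub[OF z] vs unfolding C2_closure_witness_def by simp
      ultimately show ?thesis using has_derivative_compose by fastforce
    qed
    then show ?thesis unfolding even_part_def[abs_def] by (intro has_derivative_add)
  qed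
  moreover have "continuous_on U (even_part ys ts g vs)" if "length vs \<le> 2" for vs
  proof (rule even_part_continuous[where T="closure S", OF _ that])
    show "continuous_on (closure S) (g vs)" if "length vs \<le> 2" for vs
      using g that unfolding C2_closure_witness_def by blast
  qed (use sub closure_subset in blast)
  ultimately show ?thesis using U by (simp add: C2_family_def)
qed

theorem theorem1:
  fixes Y :: "real^'m \<Rightarrow> real"
    and C1 C2 :: real
    and xs :: "real^'m" and ys ts :: real
    and S :: "((real^'m) \<times> real) set"
    and u :: "((real^'m) \<times> real) \<times> real \<Rightarrow> real"
    and g :: "(((real^'m) \<times> real) \<times> real) list \<Rightarrow> ((real^'m) \<times> real) \<times> real \<Rightarrow> real"
  defines "\<Omega> \<equiv> {(x, y). y < Y x}"
    and "K \<equiv> {(x, y). y - ys \<ge> norm (x - xs)}"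
    and "Tp \<equiv> (\<lambda>x. ts + (Y x - ys))"
    and "Tm \<equiv> (\<lambda>x. ts - (Y x - ys))"
  assumes Y_smooth: "C_inf_on UNIV Y"
    and Y_growth: "C2 < 1" "\<forall>x. \<bar>Y x\<bar> \<le> C1 + C2 * norm x"
    and pt: "(xs, ys) \<in> \<Omega>"
    and S_open: "openin (top_of_set (frontier \<Omega>)) S"
    and S_bdd: "bounded S"
    and S_K: "K \<inter> frontier \<Omega> \<subseteq> S"
    and S_above: "\<forall>p\<in>closure S. Y (fst p) > ys"
    and u_C2: "C2_closure_witness (\<Omega> \<times> UNIV) u g"
    and wave: "\<forall>z\<in>\<Omega> \<times> UNIV. g [((0, 0), 1), ((0, 0), 1)] z
                  - (\<Sum>b\<in>(Basis :: ((real^'m) \<times> real) set). g [(b, 0), (b, 0)] z) = 0"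
  shows "((\<lambda>h. surf_int Y S (\<lambda>(x, y). integral {Tm x .. Tp x} (\<lambda>t.
             u ((x, y), t) * frechet_derivative (\<lambda>p. w h (fst p - xs) (snd p - ys) (t - ts)) (at (x, y)) (normal Y x)
             - g [(normal Y x, 0)] ((x, y), t) * w h (x - xs) (y - ys) (t - ts))))
          \<longlongrightarrow> u ((xs, ys), ts) - (1/2) * (u ((xs, Y xs), Tp xs) + u ((xs, Y xs), Tm xs))) (at_right 0)"
proof -
  have S_graph: "openin (top_of_set (frontier {(x, y). y < Y x})) S" and K_S: "K \<inter> frontier {(x, y). y < Y x} \<subseteq> S"
    using S_open S_K by (simp_all add: \<Omega>_def)
  obtain gY where gY: "\<And>x. gY [] x = Y x" "\<And>vs x. (gY vs has_derivative (\<lambda>v. gY (v # vs) x)) (at x)"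
    using Y_smooth unfolding C_inf_on_def deriv_family_on_def by auto
  have Y_eq: "Y = gY []" using gY(1) by auto
  have gYc: "continuous_on S (gY vs)" for S vs
    by (meson gY(2) continuous_at_imp_continuous_on has_derivative_continuous)
  have Yc: "continuous_on S Y" for S using gYc by (simp add: Y_eq)
  note region = graph_region[OF Yc[of UNIV]]
  define P where "P = fst ` S"
  define Z where "Z x = Y x - ys" for x
  define Zd where "Zd b x = gY [b] x" for b x
  define v where "v = even_part ys ts g"
  have clO: "closure (\<Omega> \<times> (UNIV :: real set)) = {z. snd (fst z) \<le> Y (fst (fst z))}"
    unfolding closure_Times \<Omega>_def region(2) by auto
  have subO: "time_sign \<sigma> z + ((0, ys), ts) \<in> \<Omega> \<times> UNIV" if "fst (snd z) < Z (fst z)" for \<sigma> z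
    using that by (simp add: time_sign_def \<Omega>_def Z_def)
  have subC: "time_sign \<sigma> z + ((0, ys), ts) \<in> closure (\<Omega> \<times> UNIV)" if "fst (snd z) \<le> Z (fst z)" for \<sigma> z
    using that by (simp add: time_sign_def clO Z_def)
  have openU: "open {z :: (real^'m) \<times> real \<times> real. fst (snd z) < Z (fst z)}"
    unfolding Z_def by (intro open_Collect_less continuous_intros continuous_on_compose2[OF Yc[of UNIV]]) auto
  have S_mem: "p \<in> S \<Longrightarrow> snd p = Y (fst p)" for p
    using openin_imp_subset[OF S_graph] region(3) by auto
  have P_iff: "x \<in> P \<longleftrightarrow> (x, Y x) \<in> S" for x
    using S_mem by (force simp: P_def)
  have "open P"
  proof -
    obtain T where T: "open T" "S = frontier {(x, y). y < Y x} \<inter> T" using S_graph by (auto simp: openin_open)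
    have "P = (\<lambda>x. (x, Y x)) -` T" using P_iff T(2) region(3) by auto
    moreover have "continuous_on UNIV (\<lambda>x. (x, Y x))" by (intro continuous_intros Yc)
    ultimately show ?thesis using T(1) by (simp add: open_vimage)
  qed
  have dgY: "((\<lambda>s. Y (x + s *\<^sub>R b)) has_real_derivative Zd b x) (at 0)" for x b
    using has_derivative_directional[OF gY(2), of "[]" x b] by (simp add: Y_eq Zd_def)
  have glin: "linear (\<lambda>e. g [e] z)" if "z \<in> closure (\<Omega> \<times> UNIV)" for z
    by (rule C2_closure_witness_linear[OF u_C2 that])
  interpret cone_problem Z Zd v P xs
  proof
    show "continuous_on UNIV Z" unfolding Z_def[abs_def] by (intro continuous_intros Yc)
    show "continuous_on UNIV (Zd b)" for b unfolding Zd_def[abs_def] by (rule gYc)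
    show "((\<lambda>s. Z (x + s *\<^sub>R b)) has_real_derivative Zd b x) (at 0)" for b x
      using DERIV_diff[OF dgY DERIV_const[of ys]] by (simp add: Z_def)
    show "C2_family {z. fst (snd z) < Z (fst z)} v"
      unfolding v_def by (rule even_part_C2[OF u_C2 openU]) (use subO in auto)
    show "continuous_on {z. fst (snd z) \<le> Z (fst z)} (v vs)" if "length vs \<le> 1" for vs
      unfolding v_def
    proof (rule even_part_continuous[where T="closure (\<Omega> \<times> UNIV)"])
      show "continuous_on (closure (\<Omega> \<times> UNIV)) (g vs)" if "length vs \<le> 2" for vs
        using u_C2 that unfolding C2_closure_witness_def by blast
    qed (use that subC in auto)
    show "v [et, et] z = v [ey, ey] z + (\<Sum>b\<in>Basis. v [(b, 0, 0), (b, 0, 0)] z)" if z: "fst (snd z) < Z (fst z)" for z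
    proof -
      have wv: "g [((0, 0), 1), ((0, 0), 1)] z' = g [((0, 1), 0), ((0, 1), 0)] z' + (\<Sum>b\<in>Basis. g [((b, 0), 0), ((b, 0), 0)] z')"
        if "z' \<in> \<Omega> \<times> UNIV" for z'
        using wave[rule_format, OF that] by (simp add: sum_Basis_prod)
      have "g [((0, 0), - 1), ((0, 0), - 1)] (time_sign (-1) z + ((0, ys), ts)) = g [((0, 0), 1), ((0, 0), 1)] (time_sign (-1) z + ((0, ys), ts))"
        using C2_closure_witness_minus_minus[OF u_C2 subO[OF z, of "-1"], of "((0, 0), 1)"] by simp
      then show ?thesis
        using wv[OF subO[OF z, of 1]] wv[OF subO[OF z, of "-1"]]
        by (simp add: v_def even_part_def time_sign_def[of _ "(_, _)"] sum.distrib)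
    qed
    show "v [et] (x, y, 0) = 0" if y: "y < Z x" for x y
    proof -
      have "((x, y + ys), ts) \<in> closure (\<Omega> \<times> UNIV)" using subC[of "(x, y, 0)" 1] y by (simp add: time_sign_def)
      from linear_neg[OF glin[OF this], of "((0, 0), 1)"] show ?thesis
        by (simp add: v_def even_part_def time_sign_def)
    qed
    show "open P" by fact
    show "bounded P" unfolding P_def by (rule bounded_fst[OF S_bdd])
    show "0 < Z x" if x: "x \<in> closure P" for x
    proof -
      have "(\<lambda>x. (x, Y x)) ` closure P \<subseteq> closure S"
        by (rule image_closure_subset) (use P_iff closure_subset in \<open>auto intro!: continuous_intros Yc\<close>)
      then have "(x, Y x) \<in> closure S" using x by blast
      then show ?thesis using S_above by (auto simp: Z_def)
    qed
    show "x \<in> P" if "norm (x - xs) \<le> Z x" for x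
      using that K_S region(3) by (auto simp: P_iff K_def Z_def)
    show "bounded {x. norm (x - xs) \<le> Z x + 2}"
    proof (rule boundedI)
      fix x assume "x \<in> {x. norm (x - xs) \<le> Z x + 2}"
      then have "norm (x - xs) \<le> Y x - ys + 2" by (simp add: Z_def)
      moreover have "Y x \<le> C1 + C2 * norm x" using Y_growth(2) abs_le_D1 by blast
      moreover have "norm x \<le> norm (x - xs) + norm xs" by (metis norm_triangle_sub add.commute)
      ultimately have "(1 - C2) * norm x \<le> C1 - ys + 2 + norm xs" by (simp add: algebra_simps)
      then show "norm x \<le> (C1 - ys + 2 + norm xs) / (1 - C2)" using Y_growth(1) by (simp add: pos_le_divide_eq mult.commute)
    qed
    show "0 < Z xs" using pt by (simp add: \<Omega>_def Z_def)
  qed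
  have grad_inner: "grad Y x \<bullet> b = Zd b x" if b: "b \<in> Basis" for x b
  proof -
    obtain i where i: "b = axis i 1" using b by (auto simp: Basis_vec_def)
    have "frechet_derivative Y (at x) = (\<lambda>e. gY [e] x)"
      using frechet_derivative_at[OF gY(2)[of "[]" x]] by (simp add: Y_eq)
    then show ?thesis by (simp add: i grad_def inner_axis Zd_def)
  qed
  have integrand: "integral {Tm x .. Tp x} (\<lambda>t.
             u ((x, Y x), t) * frechet_derivative (\<lambda>p. w h (fst p - xs) (snd p - ys) (t - ts)) (at (x, Y x)) (normal Y x)
             - g [(normal Y x, 0)] ((x, Y x), t) * w h (x - xs) (Y x - ys) (t - ts)) * sqrt (1 + (norm (grad Y x))\<^sup>2)
       = lateral_flux v (W h) Z Zd x" if h: "h > 0" and x: "x \<in> P" for h x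
  proof -
    define a where "a = Z x"
    have a: "a > 0" using Y_pos_P[OF x] by (simp add: a_def)
    have Ya: "Y x = ys + a" by (simp add: a_def Z_def)
    define r where "r = sqrt (1 + (norm (grad Y x))\<^sup>2)"
    have r: "r > 0" unfolding r_def by (simp add: add_pos_nonneg)
    define e :: "(real^'m) \<times> real" where "e = (- grad Y x, 1)"
    define d :: "(real^'m) \<times> real \<times> real" where "d = (- grad Y x, 1, 0)"
    have ne: "normal Y x = (1 / r) *\<^sub>R e" by (simp add: normal_def Let_def r_def e_def)
    have mem: "((x, Y x), t) \<in> closure (\<Omega> \<times> UNIV)" for t :: real by (simp add: clO)
    define k where "k t = u ((x, Y x), t) * W h [d] (x, a, t - ts) - g [(e, 0)] ((x, Y x), t) * W h [] (x, a, t - ts)" for t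
    have kc: "continuous_on S k" for S
    proof -
      have "continuous_on S (\<lambda>t. g vs ((x, Y x), t))" if "length vs \<le> 2" for vs
        by (rule continuous_on_compose2[of "closure (\<Omega> \<times> UNIV)" "g vs"])
          (use u_C2 that mem in \<open>auto simp: C2_closure_witness_def intro!: continuous_intros\<close>)
      moreover have "u ((x, Y x), t) = g [] ((x, Y x), t)" for t
        using u_C2 mem by (simp add: C2_closure_witness_def)
      moreover have "continuous_on S (\<lambda>t. W h vs (x, a, t - ts))" if "length vs \<le> 2" for vs
        by (rule continuous_on_compose2[OF W_continuous[OF h that, of UNIV]]) (auto intro!: continuous_intros)
      ultimately show ?thesis unfolding k_def[abs_def] by (intro continuous_intros) auto
    qed
    have "integral {Tm x .. Tp x} (\<lambda>t.
             u ((x, Y x), t) * frechet_derivative (\<lambda>p. w h (fst p - xs) (snd p - ys) (t - ts)) (at (x, Y x)) (normal Y x)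
             - g [(normal Y x, 0)] ((x, Y x), t) * w h (x - xs) (Y x - ys) (t - ts))
       = integral {Tm x .. Tp x} (\<lambda>t. (1 / r) * k t)"
    proof (rule integral_spike[where S="{Tm x, Tp x}"])
      fix t assume "t \<in> {Tm x .. Tp x} - {Tm x, Tp x}"
      then have t: "\<bar>t - ts\<bar> < Y x - ys" by (auto simp: Tm_def Tp_def)
      have 1: "frechet_derivative (\<lambda>p. w h (fst p - xs) (snd p - ys) (t - ts)) (at (x, Y x)) (normal Y x) = (1 / r) * W h [d] (x, a, t - ts)"
      proof -
        have nd: "(fst (normal Y x), snd (normal Y x), 0) = (1 / r) *\<^sub>R d" by (simp add: ne e_def d_def)
        show ?thesis unfolding frechet_derivative_w[OF h t] nd linear_scale[OF beam_linear[OF h]]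
          by (simp add: W_eq a_def Z_def)
      qed
      have 2: "g [(normal Y x, 0)] ((x, Y x), t) = (1 / r) * g [(e, 0)] ((x, Y x), t)"
        using linear_scale[OF glin[OF mem], of "1 / r" "(e, 0)"] by (simp add: ne)
      have 3: "w h (x - xs) (Y x - ys) (t - ts) = W h [] (x, a, t - ts)"
        using w_eq_beam[OF h t] by (simp add: W_eq a_def Z_def)
      show "(1 / r) * k t = u ((x, Y x), t) * frechet_derivative (\<lambda>p. w h (fst p - xs) (snd p - ys) (t - ts)) (at (x, Y x)) (normal Y x)
             - g [(normal Y x, 0)] ((x, Y x), t) * w h (x - xs) (Y x - ys) (t - ts)"
        unfolding 1 2 3 k_def by (simp add: algebra_simps)
    qed auto
    also have "\<dots> = (1 / r) * integral {ts - a..ts + a} k"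
      by (simp add: Tm_def Tp_def Ya)
    also have "integral {ts - a..ts + a} k = integral {0..1} (\<lambda>\<tau>. a * (k (ts + a * \<tau>) + k (ts - a * \<tau>)))"
      by (rule integral_symmetric_fold[OF a kc])
    also have "\<dots> = integral {0..1} (\<lambda>\<tau>. a * wronsk v (W h) d (x, a, a * \<tau>))"
    proof (rule integral_spike[where S="{1}"])
      fix \<tau> :: real assume "\<tau> \<in> {0..1} - {1}"
      then have \<tau>: "0 \<le> \<tau>" "\<tau> < 1" by auto
      then have s: "\<bar>a * \<tau>\<bar> < a" using a by (simp add: abs_mult)
      have ev: "W h [] (x, a, - (a * \<tau>)) = W h [] (x, a, a * \<tau>)" "W h [d] (x, a, - (a * \<tau>)) = W h [d] (x, a, a * \<tau>)"
        unfolding W_eq d_def by (rule beam_even[OF h s], rule beam_deriv_even[OF h s])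
      have u: "u ((x, Y x), t) = g [] ((x, Y x), t)" for t
        using u_C2 mem by (simp add: C2_closure_witness_def)
      have v0: "v [] (x, a, a * \<tau>) = u ((x, Y x), ts + a * \<tau>) + u ((x, Y x), ts - a * \<tau>)"
        unfolding u by (simp add: v_def even_part_def time_sign_def Ya add.commute)
      have v1: "v [d] (x, a, a * \<tau>) = g [(e, 0)] ((x, Y x), ts + a * \<tau>) + g [(e, 0)] ((x, Y x), ts - a * \<tau>)"
        by (simp add: v_def even_part_def time_sign_def Ya d_def e_def add.commute)
      show "a * wronsk v (W h) d (x, a, a * \<tau>) = a * (k (ts + a * \<tau>) + k (ts - a * \<tau>))"
      proof -
        have t: "ts + a * \<tau> - ts = a * \<tau>" "ts - a * \<tau> - ts = - (a * \<tau>)" by simp_all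
        show ?thesis unfolding wronsk_def v0 v1 k_def t ev by algebra
      qed
    qed auto
    also have "\<dots> = lateral_flux v (W h) Z Zd x"
    proof -
      have V: "(x, a, a * \<tau>) \<in> {z. fst (snd z) \<le> Z (fst z)}" for \<tau> by (simp add: a_def)
      have vlin: "linear (\<lambda>e. v [e] z)" if "fst (snd z) \<le> Z (fst z)" for z
      proof -
        have "linear (\<lambda>e. g [time_sign \<sigma> e] (time_sign \<sigma> z + ((0, ys), ts)))" for \<sigma>
          using linear_compose[OF bounded_linear.linear[OF time_sign_linear[of \<sigma>]] glin[OF subC[OF that, of \<sigma>]]] by (simp add: o_def)
        then show ?thesis unfolding v_def even_part_def by (simp add: linear_compose_add)
      qed
      have wlin: "linear (\<lambda>e. wronsk v (W h) e z)" if "fst (snd z) \<le> Z (fst z)" for z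
        unfolding wronsk_def W_def
        using linear_compose_sub[OF linear_compose_scale_right[OF beam_linear[OF h]] linear_compose_scale_right[OF vlin[OF that]]]
        by simp
      have dd: "d = ey + (\<Sum>b\<in>Basis. - Zd b x *\<^sub>R (b, 0, 0))"
      proof -
        have "grad Y x = (\<Sum>b\<in>Basis. Zd b x *\<^sub>R b)"
          using euclidean_representation[of "grad Y x"] by (simp add: grad_inner)
        moreover have "(\<Sum>b\<in>Basis. - Zd b x *\<^sub>R (b, 0, 0)) = (- (\<Sum>b\<in>Basis. Zd b x *\<^sub>R b), 0 :: real, 0 :: real)"
          by (simp add: prod_eq_iff fst_sum snd_sum sum_negf)
        ultimately show ?thesis by (simp add: d_def)
      qed
      have wd: "wronsk v (W h) d (x, a, a * \<tau>) = wronsk v (W h) ey (x, a, a * \<tau>) - (\<Sum>b\<in>Basis. Zd b x * wronsk v (W h) (b, 0, 0) (x, a, a * \<tau>))" for \<tau>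
      proof -
        have l: "linear (\<lambda>e. wronsk v (W h) e (x, a, a * \<tau>))" by (rule wlin) (simp add: a_def)
        show ?thesis
          unfolding dd linear_add[OF l] linear_sum[OF l] linear_scale[OF l] by (simp add: sum_negf)
      qed
      have c: "continuous_on {0..1} (\<lambda>\<tau>. wronsk v (W h) e (x, a, a * \<tau>))" for e
        by (rule continuous_on_compose2[OF wronsk_vW_continuous[OF h]]) (auto intro!: continuous_intros simp: a_def)
      have i: "(\<lambda>\<tau>. a * wronsk v (W h) e (x, a, a * \<tau>)) integrable_on {0..1}" for e
        by (intro integrable_continuous_real continuous_intros c)
      have i': "(\<lambda>\<tau>. Zd b x * (a * wronsk v (W h) (b, 0, 0) (x, a, a * \<tau>))) integrable_on {0..1}" for b
        by (intro integrable_continuous_real continuous_intros c)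
      have "integral {0..1} (\<lambda>\<tau>. a * wronsk v (W h) d (x, a, a * \<tau>))
        = integral {0..1} (\<lambda>\<tau>. a * wronsk v (W h) ey (x, a, a * \<tau>) - (\<Sum>b\<in>Basis. Zd b x * (a * wronsk v (W h) (b, 0, 0) (x, a, a * \<tau>))))"
        by (rule Henstock_Kurzweil_Integration.integral_cong)
          (simp only: wd right_diff_distrib sum_distrib_left mult.left_commute[of a])
      also have "\<dots> = integral {0..1} (\<lambda>\<tau>. a * wronsk v (W h) ey (x, a, a * \<tau>))
          - (\<Sum>b\<in>Basis. integral {0..1} (\<lambda>\<tau>. Zd b x * (a * wronsk v (W h) (b, 0, 0) (x, a, a * \<tau>))))"
        by (simp only: Henstock_Kurzweil_Integration.integral_diff[OF i integrable_sum[OF finite_Basis i']]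
            Henstock_Kurzweil_Integration.integral_sum[OF finite_Basis i'])
      also have "\<dots> = lateral_flux v (W h) Z Zd x"
        unfolding lateral_flux_def a_def[symmetric] by (simp only: integral_mult_right)
      finally show ?thesis .
    qed
    finally show ?thesis using r by (simp add: r_def)
  qed
  have limit_eq: "(v [] (xs, 0, 0) - v [] (xs, Z xs, Z xs)) / 2 = u ((xs, ys), ts) - (1/2) * (u ((xs, Y xs), Tp xs) + u ((xs, Y xs), Tm xs))"
  proof -
    have u: "u z = g [] z" if "z \<in> closure (\<Omega> \<times> UNIV)" for z
      using u_C2 that by (simp add: C2_closure_witness_def)
    have m: "((xs, ys), t) \<in> closure (\<Omega> \<times> UNIV)" "((xs, Y xs), t) \<in> closure (\<Omega> \<times> UNIV)" for t :: real
      unfolding clO using pt by (auto simp: \<Omega>_def)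
    show ?thesis
      unfolding u[OF m(1)] u[OF m(2)]
      by (simp add: v_def even_part_def time_sign_def Z_def Tp_def Tm_def algebra_simps diff_divide_distrib add_divide_distrib)
  qed
  have "\<forall>\<^sub>F h in at_right 0. integral P (lateral_flux v (W h) Z Zd)
     = surf_int Y S (\<lambda>(x, y). integral {Tm x .. Tp x} (\<lambda>t.
             u ((x, y), t) * frechet_derivative (\<lambda>p. w h (fst p - xs) (snd p - ys) (t - ts)) (at (x, y)) (normal Y x)
             - g [(normal Y x, 0)] ((x, y), t) * w h (x - xs) (y - ys) (t - ts)))"
    using eventually_at_right_less[of "0::real"]
  proof eventually_elim
    case (elim h)
    show ?case
      unfolding surf_int_def P_def[symmetric]
      by (rule Henstock_Kurzweil_Integration.integral_cong) (simp only: integrand[OF elim] prod.case)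
  qed
  then show ?thesis
    using lateral_flux_limit unfolding limit_eq by (rule Lim_transform_eventually[rotated])
qed

end
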